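(* Let $n<n'$ be non-negative integers and let $R$ be an $N=n$ supersymmetric (SUSY) Lie conformal algebra over $\mathbb{C}$ (for $n=0$: a Lie conformal algebra). Then the universal enveloping $N=n$ SUSY vertex algebra $V(R)$ has an $N=n'$ SUSY extension; that is, there is a differential algebra $W$ such that $V(R)\otimes W$ carries an $N=n'$ SUSY vertex algebra structure containing $V(R)$ as an $N=n$ SUSY vertex subalgebra.
   Context: Everything is over $\mathbb{C}$ and $\mathbb{Z}/2\mathbb{Z}$-graded, $p$ denotes parity, $[\,,\,]$ of operators or variables denotes the supercommutator. Operators and variables. $\nabla=(\partial,D^1,\dots,D^n)$ with $\partial$ even, $D^i$ odd, $[D^i,D^j]=2\delta_{ij}\partial$. $\Lambda=(\lambda,\chi^1,\dots,\chi^n)$ with $\lambda$ even, $\chi^i$ odd, $[\chi^i,\chi^j]=-2\delta_{ij}\lambda$, $\lambda$ central; $[D^i,\chi^j]=2\delta_{ij}\lambda$, $[D^i,\lambda]=0$. $\Gamma=(\gamma,\eta^1,\dots,\eta^n)$ is a second such set, supercommuting with $\Lambda$. $N=n$ SUSY Lie conformal algebra: a $\mathbb{Z}/2\mathbb{Z}$-graded $\mathbb{C}[\nabla]$-module $R$ with a $\mathbb{C}$-linear map $R\otimes R\to\mathbb{C}[\Lambda]\otimes R$, $a\otimes b\mapsto[a\,{}_\Lambda\,b]$, of parity $n \bmod 2$, such that (sesquilinearity) $[D^ia\,{}_\Lambda\,b]=(-1)^{n+1}\chi^i[a\,{}_\Lambda\,b]$, $[a\,{}_\Lambda\,D^ib]=(-1)^{p(a)+n}(D^i+\chi^i)[a\,{}_\Lambda\,b]$;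 (skew-symmetry) $[b\,{}_\Lambda\,a]=(-1)^{p(a)p(b)+n+1}[a\,{}_{-\nabla-\Lambda}\,b]$; (Jacobi) $[a\,{}_\Lambda[b\,{}_\Gamma\,c]]=(-1)^{(p(a)+1)n}[[a\,{}_\Lambda\,b]\,{}_{\Lambda+\Gamma}\,c]+(-1)^{(p(a)+n)(p(b)+n)}[b\,{}_\Gamma[a\,{}_\Lambda\,c]]$; the bracket (of parity $n$) supercommutes with the formal variables, e.g. $[a\,{}_\Lambda\,\eta^ib]=(-1)^{p(a)+n}\eta^i[a\,{}_\Lambda\,b]$. For $n=0$ (with sesquilinearity $[\partial a\,{}_\lambda\,b]=-\lambda[a\,{}_\lambda\,b]$, $[a\,{}_\lambda\,\partial b]=(\partial+\lambda)[a\,{}_\lambda\,b]$) this is the usual notion of Lie conformal algebra. $N=n$ SUSY vertex algebra: a tuple $(V,\nabla,[\,{}_\Lambda\,],|0\rangle,:\ :)$ where $(V,\nabla,[\,{}_\Lambda\,])$ is an $N=n$ SUSY Lie conformal algebra, $(V,\nabla,|0\rangle,:\ :)$ is a unital differential superalgebra ($\partial$ and all $D^i$ are derivations of the product), and (quasi-commutativity) $:ab:-(-1)^{p(a)p(b)}:ba:=\int_{-\nabla}^0[a\,{}_\Lambda\,b]\,d\Lambda$; (quasi-associativity) $::ab:c:-:a:bc::\;=\;:\big(\int_0^\nabla d\Lambda\,a\big)[b\,{}_\Lambda\,c]:+(-1)^{p(a)p(b)}:\big(\int_0^\nabla d\Lambda\,b\big)[a\,{}_\Lambda\,c]:$; (Wick)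 $[a\,{}_\Lambda:bc:]=:[a\,{}_\Lambda\,b]c:+(-1)^{(p(a)+n)p(b)}:b[a\,{}_\Lambda\,c]:+\int_0^\Lambda[[a\,{}_\Lambda\,b]\,{}_\Gamma\,c]\,d\Gamma$. Here $\int d\Lambda=\partial_{\chi^1}\cdots\partial_{\chi^n}\int d\lambda$ (similarly for $\Gamma$ with $\eta^i$, $\gamma$). With the underlying $\lambda$-bracket $[a\,{}_\lambda\,b]=\sum_m\frac{\lambda^m}{m!}a_{(m)}b:=\partial_{\chi^1}\cdots\partial_{\chi^n}[a\,{}_\Lambda\,b]$, the right side of quasi-commutativity is $\int_{-\partial}^0[a\,{}_\lambda\,b]d\lambda$ and $:\big(\int_0^\nabla d\Lambda\,a\big)[b\,{}_\Lambda\,c]:=\sum_{j\ge0}a_{(-j-2)}(b_{(j)}c)$ with $a_{(-m-1)}b=\frac1{m!}:(\partial^ma)b:$. For $n=0$ this is the usual notion of vertex algebra. Every $N=n'$ SUSY vertex algebra is an $N=n$ SUSY vertex algebra for $n<n'$, by keeping $\partial,D^1,\dots,D^n$ and using the bracket $\partial_{\chi^{n+1}}\cdots\partial_{\chi^{n'}}[a\,{}_\Lambda\,b]$. An $N=n$ SUSY vertex subalgebra is a subspace containing $|0\rangle$, closed under $\partial,D^1,\dots,D^n$, the normally ordered product, and the coefficients of this $N=n$ bracket, with the induced structure. Universal enveloping $N=n$ SUSY vertex algebra $V(R)$: the $N=n$ SUSY vertex algebra freely generated by $R$, i.e. $R\subset V(R)$ compatibly with $\nabla$ and $\Lambda$-brackets,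 and for an ordered homogeneous basis $\{r_i\}$ of $R$ the right-nested normally ordered monomials $r_{i_1}\cdots r_{i_l}$ ($l\ge0$, $i_1\le\cdots\le i_l$, strict after odd elements) form a basis of $V(R)$; the $\Lambda$-bracket on $V(R)$ is determined by that on $R$ and the Wick formula. *)

theory Defs
  imports Complex_Main "HOL-Library.Poly_Mapping"
begin

section \<open>Complex vector spaces and their tensor product\<close>

class complex_vector = ab_group_add +
  fixes scaleC :: "complex \<Rightarrow> 'a \<Rightarrow> 'a" (infixr \<open>*\<^sub>C\<close> 75)
  assumes scaleC_add_right: "c *\<^sub>C (x + y) = c *\<^sub>C x + c *\<^sub>C y"
    and scaleC_add_left: "(c + d) *\<^sub>C x = c *\<^sub>C x + d *\<^sub>C x"
    and scaleC_scaleC: "c *\<^sub>C d *\<^sub>C x = (c * d) *\<^sub>C x"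
    and scaleC_one: "1 *\<^sub>C x = x"

interpretation cvec: vector_space "scaleC :: complex \<Rightarrow> 'a \<Rightarrow> 'a::complex_vector"
  by unfold_locales
    (simp_all add: scaleC_add_right scaleC_add_left scaleC_scaleC scaleC_one)

abbreviation clinear :: "('a::complex_vector \<Rightarrow> 'b::complex_vector) \<Rightarrow> bool" where
  "clinear \<equiv> Vector_Spaces.linear scaleC scaleC"

instantiation complex :: complex_vector
begin

definition scaleC_complex :: "complex \<Rightarrow> complex \<Rightarrow> complex" where
  "scaleC_complex c x = c * x"

instance
  by standard (simp_all add: scaleC_complex_def algebra_simps)

end

instantiation poly_mapping :: (type, complex_vector) complex_vector
begin

definition scaleC_poly_mapping :: "complex \<Rightarrow> ('a \<Rightarrow>\<^sub>0 'b) \<Rightarrow> 'a \<Rightarrow>\<^sub>0 'b" where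
  "scaleC_poly_mapping c = Poly_Mapping.map (scaleC c)"

lemma lookup_scaleC:
  "Poly_Mapping.lookup (c *\<^sub>C (p :: 'a \<Rightarrow>\<^sub>0 'b)) k = c *\<^sub>C Poly_Mapping.lookup p k"
  by (simp add: scaleC_poly_mapping_def Poly_Mapping.map.rep_eq when_def)

instance
  by standard
    (auto intro!: poly_mapping_eqI
      simp: lookup_scaleC lookup_add scaleC_add_right scaleC_add_left scaleC_scaleC scaleC_one)

end

definition bilinearity_relations ::
  "((('a::complex_vector \<times> 'b::complex_vector) \<Rightarrow>\<^sub>0 complex)) set" where
  "bilinearity_relations =
     {Poly_Mapping.single (a + a', b) 1 - Poly_Mapping.single (a, b) 1
        - Poly_Mapping.single (a', b) 1 | a a' b. True} \<union>
     {Poly_Mapping.single (a, b + b') 1 - Poly_Mapping.single (a, b) 1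
        - Poly_Mapping.single (a, b') 1 | a b b'. True} \<union>
     {Poly_Mapping.single (c *\<^sub>C a, b) 1 - c *\<^sub>C Poly_Mapping.single (a, b) 1 | c a b. True} \<union>
     {Poly_Mapping.single (a, c *\<^sub>C b) 1 - c *\<^sub>C Poly_Mapping.single (a, b) 1 | c a b. True}"

definition tensor_eq ::
  "(('a::complex_vector \<times> 'b::complex_vector) \<Rightarrow>\<^sub>0 complex) \<Rightarrow> ('a \<times> 'b \<Rightarrow>\<^sub>0 complex) \<Rightarrow> bool" where
  "tensor_eq x y \<longleftrightarrow> x - y \<in> cvec.span bilinearity_relations"

lemma equivp_tensor_eq:
  "equivp (tensor_eq :: ('a::complex_vector \<times> 'b::complex_vector \<Rightarrow>\<^sub>0 complex) \<Rightarrow> _)"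
proof (rule equivpI)
  let ?R = "tensor_eq :: ('a \<times> 'b \<Rightarrow>\<^sub>0 complex) \<Rightarrow> _"
  show "reflp ?R"
    by (simp add: reflp_def tensor_eq_def cvec.span_zero)
  show "symp ?R"
  proof (rule sympI)
    fix x y :: "('a \<times> 'b) \<Rightarrow>\<^sub>0 complex"
    assume "tensor_eq x y"
    then have "- (x - y) \<in> cvec.span bilinearity_relations"
      unfolding tensor_eq_def by (rule cvec.span_neg)
    then show "tensor_eq y x"
      by (simp add: tensor_eq_def)
  qed
  show "transp ?R"
  proof (rule transpI)
    fix x y z :: "('a \<times> 'b) \<Rightarrow>\<^sub>0 complex"
    assume "tensor_eq x y" and "tensor_eq y z"
    then have "(x - y) + (y - z) \<in> cvec.span bilinearity_relations"
      unfolding tensor_eq_def by (rule cvec.span_add)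
    then show "tensor_eq x z"
      by (simp add: tensor_eq_def)
  qed
qed

quotient_type (overloaded) ('a, 'b) tensor =
  "('a::complex_vector \<times> 'b::complex_vector) \<Rightarrow>\<^sub>0 complex" / tensor_eq
  by (rule equivp_tensor_eq)

instantiation tensor :: (complex_vector, complex_vector) complex_vector
begin

lift_definition zero_tensor :: "('a, 'b) tensor" is 0 .

lift_definition plus_tensor :: "('a, 'b) tensor \<Rightarrow> ('a, 'b) tensor \<Rightarrow> ('a, 'b) tensor" is "(+)"
  unfolding tensor_eq_def by (simp only: add_diff_add cvec.span_add)

lift_definition uminus_tensor :: "('a, 'b) tensor \<Rightarrow> ('a, 'b) tensor" is uminus
  unfolding tensor_eq_def by (simp only: minus_diff_minus cvec.span_neg)

lift_definition minus_tensor :: "('a, 'b) tensor \<Rightarrow> ('a, 'b) tensor \<Rightarrow> ('a, 'b) tensor" is "(-)"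
proof -
  fix x x' y y' :: "('a \<times> 'b) \<Rightarrow>\<^sub>0 complex"
  assume "tensor_eq x x'" and "tensor_eq y y'"
  then have "(x - x') - (y - y') \<in> cvec.span bilinearity_relations"
    unfolding tensor_eq_def by (rule cvec.span_diff)
  also have "(x - x') - (y - y') = (x - y) - (x' - y')"
    by (simp add: algebra_simps)
  finally show "tensor_eq (x - y) (x' - y')"
    unfolding tensor_eq_def .
qed

lift_definition scaleC_tensor :: "complex \<Rightarrow> ('a, 'b) tensor \<Rightarrow> ('a, 'b) tensor" is scaleC
  unfolding tensor_eq_def by (simp only: cvec.scale_right_diff_distrib[symmetric] cvec.span_scale)

instance
  by standard
    (transfer, simp add: tensor_eq_def cvec.span_zero algebra_simps scaleC_add_right
      scaleC_add_left scaleC_scaleC scaleC_one)+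

end

lift_definition tens ::
  "'a::complex_vector \<Rightarrow> 'b::complex_vector \<Rightarrow> ('a, 'b) tensor" (infixr \<open>\<otimes>\<^sub>C\<close> 76)
  is "\<lambda>a b. Poly_Mapping.single (a, b) 1" .

lemma tens_add_left: "(a + a') \<otimes>\<^sub>C b = a \<otimes>\<^sub>C b + a' \<otimes>\<^sub>C b"
  by transfer (unfold tensor_eq_def diff_diff_eq[symmetric], rule cvec.span_base,
      unfold bilinearity_relations_def, blast)

lemma tens_add_right: "a \<otimes>\<^sub>C (b + b') = a \<otimes>\<^sub>C b + a \<otimes>\<^sub>C b'"
  by transfer (unfold tensor_eq_def diff_diff_eq[symmetric], rule cvec.span_base,
      unfold bilinearity_relations_def, blast)

lemma tens_scale_left: "(c *\<^sub>C a) \<otimes>\<^sub>C b = c *\<^sub>C (a \<otimes>\<^sub>C b)"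
  by transfer (unfold tensor_eq_def, rule cvec.span_base,
      unfold bilinearity_relations_def, blast)

lemma tens_scale_right: "a \<otimes>\<^sub>C (c *\<^sub>C b) = c *\<^sub>C (a \<otimes>\<^sub>C b)"
  by transfer (unfold tensor_eq_def, rule cvec.span_base,
      unfold bilinearity_relations_def, blast)


section \<open>Polynomials in the variables \<open>\<Lambda>\<close> with coefficients in a vector space\<close>

text \<open>
  An element of \<open>\<complex>[\<Lambda>] \<otimes> M\<close> is written uniquely as a finite sum of \<open>\<lambda>\<^sup>m \<chi>\<^sup>I v\<close> with \<open>v \<in> M\<close>, where
  \<open>\<chi>\<^sup>I\<close> is the product of the \<open>\<chi>\<^sup>i\<close>, \<open>i \<in> I\<close>, in increasing order; it is represented by its
  coefficients \<open>v\<close> at the keys \<open>(m, I)\<close>.  In \<open>'a lam lam\<close> the outer variables are \<open>\<Lambda>\<close>, the inner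
  ones \<open>\<Gamma>\<close>, and the monomials are \<open>\<Lambda>\<^sup>J \<Gamma>\<^sup>K v\<close>, \<open>\<Lambda>\<close> being to the left of \<open>\<Gamma>\<close>.
\<close>

type_synonym 'a lam = "nat \<times> nat set \<Rightarrow>\<^sub>0 'a"

abbreviation monom_lam :: "nat \<Rightarrow> nat set \<Rightarrow> 'a::zero \<Rightarrow> 'a lam" where
  "monom_lam m I v \<equiv> Poly_Mapping.single (m, I) v"

abbreviation const_lam :: "'a::zero \<Rightarrow> 'a lam" where
  "const_lam v \<equiv> monom_lam 0 {} v"

text \<open>The sum of \<open>F m I v\<close> over the terms \<open>\<lambda>\<^sup>m \<chi>\<^sup>I v\<close>.\<close>

definition sum_terms ::
  "(nat \<Rightarrow> nat set \<Rightarrow> 'a \<Rightarrow> 'b) \<Rightarrow> 'a::zero lam \<Rightarrow> 'b::comm_monoid_add" where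
  "sum_terms F p = (\<Sum>(m, I) \<in> Poly_Mapping.keys p. F m I (Poly_Mapping.lookup p (m, I)))"

text \<open>The sign of moving \<open>\<chi>\<^sup>i\<close> to its place in \<open>\<chi>\<^sup>I\<close>.\<close>

definition place_sign :: "nat \<Rightarrow> nat set \<Rightarrow> complex" where
  "place_sign i I = (- 1) ^ card {j \<in> I. j < i}"

definition lam_mult :: "'a::complex_vector lam \<Rightarrow> 'a lam" where
  "lam_mult = sum_terms (\<lambda>m I v. monom_lam (Suc m) I v)"

text \<open>Left multiplication by \<open>\<chi>\<^sup>i\<close>; note \<open>(\<chi>\<^sup>i)\<^sup>2 = - \<lambda>\<close>.\<close>

definition chi_mult :: "nat \<Rightarrow> 'a::complex_vector lam \<Rightarrow> 'a lam" where
  "chi_mult i = sum_terms (\<lambda>m I v. place_sign i I *\<^sub>C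
     (if i \<in> I then - monom_lam (Suc m) (I - {i}) v else monom_lam m (insert i I) v))"

definition chi_deriv :: "nat \<Rightarrow> 'a::complex_vector lam \<Rightarrow> 'a lam" where
  "chi_deriv i = sum_terms (\<lambda>m I v. if i \<in> I then place_sign i I *\<^sub>C monom_lam m (I - {i}) v else 0)"

text \<open>
  A map \<open>f\<close> of parity \<open>k\<close> applied to the coefficients, with the sign \<open>(-1)\<^sup>k\<^sup>|\<^sup>I\<^sup>|\<close> from passing \<open>\<chi>\<^sup>I\<close>.
\<close>

definition coeff_map ::
  "nat \<Rightarrow> ('a \<Rightarrow> 'b) \<Rightarrow> 'a::complex_vector lam \<Rightarrow> 'b::complex_vector lam" where
  "coeff_map k f = sum_terms (\<lambda>m I v. (- 1) ^ (k * card I) *\<^sub>C monom_lam m I (f v))"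

definition gamma_mult :: "'a::complex_vector lam lam \<Rightarrow> 'a lam lam" where
  "gamma_mult = coeff_map 0 lam_mult"

definition eta_mult :: "nat \<Rightarrow> 'a::complex_vector lam lam \<Rightarrow> 'a lam lam" where
  "eta_mult i = coeff_map 1 (chi_mult i)"

definition eta_deriv :: "nat \<Rightarrow> 'a::complex_vector lam lam \<Rightarrow> 'a lam lam" where
  "eta_deriv i = coeff_map 1 (chi_deriv i)"

text \<open>
  \<open>L\<^sup>m X\<^sup>I u\<close>, the operators \<open>X i\<close>, \<open>i \<in> I\<close>, being composed in increasing order of \<open>i\<close>
  (the largest index acts first).
\<close>

definition monomial_op :: "('b \<Rightarrow> 'b) \<Rightarrow> (nat \<Rightarrow> 'b \<Rightarrow> 'b) \<Rightarrow> nat \<Rightarrow> nat set \<Rightarrow> 'b \<Rightarrow> 'b" where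
  "monomial_op L X m I u = (L ^^ m) (foldr X (sorted_list_of_set I) u)"


section \<open>\<open>\<complex>[\<nabla>]\<close>-modules\<close>

record 'a nabla_module =
  even_part :: "'a set"
  odd_part :: "'a set"
  der :: "'a \<Rightarrow> 'a"
  oder :: "nat \<Rightarrow> 'a \<Rightarrow> 'a"

text \<open>Parities are natural numbers read modulo 2.\<close>

definition part :: "('a, 'z) nabla_module_scheme \<Rightarrow> nat \<Rightarrow> 'a set" where
  "part M k = (if even k then even_part M else odd_part M)"

definition is_nabla_module :: "nat \<Rightarrow> ('a::complex_vector, 'z) nabla_module_scheme \<Rightarrow> bool" where
  "is_nabla_module n M \<longleftrightarrow>
     (\<forall>k. cvec.subspace (part M k)) \<and>
     even_part M \<inter> odd_part M = {0} \<and>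
     (\<forall>v. \<exists>a \<in> even_part M. \<exists>b \<in> odd_part M. v = a + b) \<and>
     clinear (der M) \<and> (\<forall>k. \<forall>a \<in> part M k. der M a \<in> part M k) \<and>
     (\<forall>i \<in> {1..n}. clinear (oder M i) \<and> (\<forall>k. \<forall>a \<in> part M k. oder M i a \<in> part M (k + 1))) \<and>
     (\<forall>i \<in> {1..n}. \<forall>a. oder M i (der M a) = der M (oder M i a)) \<and>
     (\<forall>i \<in> {1..n}. \<forall>j \<in> {1..n}. \<forall>a.
        oder M i (oder M j a) + oder M j (oder M i a) = (if i = j then 2 *\<^sub>C der M a else 0))"

text \<open>
  The action of \<open>\<partial>\<close> and \<open>D\<^sup>i\<close> on \<open>\<complex>[\<Lambda>] \<otimes> M\<close>; since \<open>[D\<^sup>i, \<chi>\<^sup>j] = 2 \<delta>\<^sub>i\<^sub>j \<lambda>\<close>, moving \<open>D\<^sup>i\<close>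
  past \<open>\<chi>\<^sup>I\<close> produces the extra term \<open>2 \<lambda> \<partial>\<chi>\<^sup>I / \<partial>\<chi>\<^sup>i\<close>.
\<close>

definition lam_der :: "('a::complex_vector, 'z) nabla_module_scheme \<Rightarrow> 'a lam \<Rightarrow> 'a lam" where
  "lam_der M = coeff_map 0 (der M)"

definition lam_oder :: "('a::complex_vector, 'z) nabla_module_scheme \<Rightarrow> nat \<Rightarrow> 'a lam \<Rightarrow> 'a lam" where
  "lam_oder M i p = coeff_map 1 (oder M i) p + 2 *\<^sub>C lam_mult (chi_deriv i p)"


section \<open>SUSY Lie conformal algebras\<close>

record (overloaded) 'a susy_lca = "'a nabla_module" +
  lbr :: "'a \<Rightarrow> 'a \<Rightarrow> 'a lam"

text \<open>
  \<open>[a \<^sub>-\<^sub>\<nabla>\<^sub>-\<^sub>\<Lambda> b]\<close>: in \<open>[a \<^sub>\<Gamma> b]\<close>, with the variables \<open>\<Gamma>\<close> to the left of the coefficients, substitute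
  \<open>- \<nabla> - \<Lambda>\<close> for \<open>\<Gamma>\<close>.
\<close>

definition bracket_neg :: "('a::complex_vector, 'z) susy_lca_scheme \<Rightarrow> 'a \<Rightarrow> 'a \<Rightarrow> 'a lam" where
  "bracket_neg R a b = sum_terms (\<lambda>m I v.
      monomial_op (\<lambda>x. - lam_der R x - lam_mult x) (\<lambda>i x. - lam_oder R i x - chi_mult i x) m I
        (const_lam v)) (lbr R a b)"

text \<open>\<open>[a \<^sub>\<Lambda> [b \<^sub>\<Gamma> c]]\<close> for \<open>a\<close> of parity \<open>p\<close>, using \<open>[a \<^sub>\<Lambda> \<eta>\<^sup>i v] = (-1)\<^sup>p\<^sup>+\<^sup>n \<eta>\<^sup>i [a \<^sub>\<Lambda> v]\<close>.\<close>

definition bracket_right ::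
  "nat \<Rightarrow> ('a::complex_vector, 'z) susy_lca_scheme \<Rightarrow> nat \<Rightarrow> 'a \<Rightarrow> 'a \<Rightarrow> 'a \<Rightarrow> 'a lam lam" where
  "bracket_right n R p a b c = sum_terms (\<lambda>m K v. (- 1) ^ ((p + n) * card K) *\<^sub>C
      monomial_op gamma_mult eta_mult m K (coeff_map 0 const_lam (lbr R a v))) (lbr R b c)"

text \<open>\<open>[b \<^sub>\<Gamma> [a \<^sub>\<Lambda> c]]\<close> for \<open>b\<close> of parity \<open>q\<close>.\<close>

definition bracket_right_swap ::
  "nat \<Rightarrow> ('a::complex_vector, 'z) susy_lca_scheme \<Rightarrow> nat \<Rightarrow> 'a \<Rightarrow> 'a \<Rightarrow> 'a \<Rightarrow> 'a lam lam" where
  "bracket_right_swap n R q b a c = coeff_map (q + n) (lbr R b) (lbr R a c)"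

text \<open>\<open>[[a \<^sub>\<Lambda> b] \<^sub>\<Lambda>\<^sub>+\<^sub>\<Gamma> c]\<close>, using \<open>[\<chi>\<^sup>i v \<^sub>\<Gamma> c] = (-1)\<^sup>n \<chi>\<^sup>i [v \<^sub>\<Gamma> c]\<close>.\<close>

definition bracket_left_sum ::
  "nat \<Rightarrow> ('a::complex_vector, 'z) susy_lca_scheme \<Rightarrow> 'a \<Rightarrow> 'a \<Rightarrow> 'a \<Rightarrow> 'a lam lam" where
  "bracket_left_sum n R a b c = sum_terms (\<lambda>m J v. (- 1) ^ (n * card J) *\<^sub>C
      monomial_op lam_mult chi_mult m J
        (sum_terms (\<lambda>k K w.
            monomial_op (\<lambda>x. lam_mult x + gamma_mult x) (\<lambda>i x. chi_mult i x + eta_mult i x) k K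
              (const_lam (const_lam w))) (lbr R v c))) (lbr R a b)"

text \<open>
  Sesquilinearity with respect to \<open>\<partial>\<close> follows from that with respect to \<open>D\<^sup>1\<close> if \<open>n > 0\<close>; it is
  needed for \<open>n = 0\<close>.
\<close>

definition susy_lie_conformal_algebra ::
  "nat \<Rightarrow> ('a::complex_vector, 'z) susy_lca_scheme \<Rightarrow> bool" where
  "susy_lie_conformal_algebra n R \<longleftrightarrow>
     is_nabla_module n R \<and>
     (\<forall>a. clinear (lbr R a)) \<and> (\<forall>b. clinear (\<lambda>a. lbr R a b)) \<and>
     (\<forall>a b. Poly_Mapping.keys (lbr R a b) \<subseteq> UNIV \<times> Pow {1..n}) \<and>
     (\<forall>p q. \<forall>a \<in> part R p. \<forall>b \<in> part R q. \<forall>m I.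
        Poly_Mapping.lookup (lbr R a b) (m, I) \<in> part R (p + q + n + card I)) \<and>
     (\<forall>a b. lbr R (der R a) b = - lam_mult (lbr R a b)) \<and>
     (\<forall>a b. lbr R a (der R b) = lam_der R (lbr R a b) + lam_mult (lbr R a b)) \<and>
     (\<forall>i \<in> {1..n}. \<forall>a b. lbr R (oder R i a) b = (- 1) ^ (n + 1) *\<^sub>C chi_mult i (lbr R a b)) \<and>
     (\<forall>i \<in> {1..n}. \<forall>p. \<forall>a \<in> part R p. \<forall>b.
        lbr R a (oder R i b) =
          (- 1) ^ (p + n) *\<^sub>C (lam_oder R i (lbr R a b) + chi_mult i (lbr R a b))) \<and>
     (\<forall>p q. \<forall>a \<in> part R p. \<forall>b \<in> part R q.
        lbr R b a = (- 1) ^ (p * q + n + 1) *\<^sub>C bracket_neg R a b) \<and>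
     (\<forall>p q. \<forall>a \<in> part R p. \<forall>b \<in> part R q. \<forall>c.
        bracket_right n R p a b c =
          (- 1) ^ ((p + 1) * n) *\<^sub>C bracket_left_sum n R a b c
          + (- 1) ^ ((p + n) * (q + n)) *\<^sub>C bracket_right_swap n R q b a c)"


section \<open>Differential superalgebras\<close>

text \<open>Unital differential superalgebras; the product need not be associative.\<close>

definition unital_diff_superalgebra ::
  "nat \<Rightarrow> ('a::complex_vector, 'z) nabla_module_scheme \<Rightarrow> 'a \<Rightarrow> ('a \<Rightarrow> 'a \<Rightarrow> 'a) \<Rightarrow> bool" where
  "unital_diff_superalgebra n M u f \<longleftrightarrow>
     is_nabla_module n M \<and>
     (\<forall>a. clinear (f a)) \<and> (\<forall>b. clinear (\<lambda>a. f a b)) \<and>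
     (\<forall>p q. \<forall>a \<in> part M p. \<forall>b \<in> part M q. f a b \<in> part M (p + q)) \<and>
     u \<in> even_part M \<and> (\<forall>a. f u a = a \<and> f a u = a) \<and>
     (\<forall>a b. der M (f a b) = f (der M a) b + f a (der M b)) \<and>
     (\<forall>i \<in> {1..n}. \<forall>p. \<forall>a \<in> part M p. \<forall>b.
        oder M i (f a b) = f (oder M i a) b + (- 1) ^ p *\<^sub>C f a (oder M i b))"

record 'a diff_superalgebra = "'a nabla_module" +
  aone :: 'a
  amult :: "'a \<Rightarrow> 'a \<Rightarrow> 'a"

definition commutative_diff_superalgebra ::
  "nat \<Rightarrow> 'a::complex_vector diff_superalgebra \<Rightarrow> bool" where
  "commutative_diff_superalgebra n W \<longleftrightarrow>
     unital_diff_superalgebra n W (aone W) (amult W) \<and>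
     (\<forall>a b c. amult W (amult W a b) c = amult W a (amult W b c)) \<and>
     (\<forall>p q. \<forall>a \<in> part W p. \<forall>b \<in> part W q. amult W a b = (- 1) ^ (p * q) *\<^sub>C amult W b a)"


section \<open>SUSY vertex algebras\<close>

record (overloaded) 'a susy_va = "'a susy_lca" +
  vac :: 'a
  nop :: "'a \<Rightarrow> 'a \<Rightarrow> 'a"

text \<open>
  \<open>\<partial>\<^sub>\<chi>\<^sub>k\<^sub>+\<^sub>1 \<dots> \<partial>\<^sub>\<chi>\<^sub>n\<close>, the rightmost derivative acting first; for \<open>k = 0\<close> the result is a polynomial
  in \<open>\<lambda>\<close> alone.
\<close>

definition chi_derivs :: "nat \<Rightarrow> nat \<Rightarrow> 'a::complex_vector lam \<Rightarrow> 'a lam" where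
  "chi_derivs k n = foldr chi_deriv [Suc k..<Suc n]"

definition lambda_bracket ::
  "nat \<Rightarrow> ('a::complex_vector, 'z) susy_lca_scheme \<Rightarrow> 'a \<Rightarrow> 'a \<Rightarrow> 'a lam" where
  "lambda_bracket n R a b = chi_derivs 0 n (lbr R a b)"

text \<open>\<open>\<integral>\<^bsub>-\<nabla>\<^esub>\<^bsup>0\<^esup> [a \<^sub>\<Lambda> b] d\<Lambda>\<close>; here \<open>\<lambda>\<^sup>m v\<close> integrates to \<open>- (-\<partial>)\<^sup>m\<^sup>+\<^sup>1 v / (m + 1)\<close>.\<close>

definition integral_neg_nabla ::
  "nat \<Rightarrow> ('a::complex_vector, 'z) susy_lca_scheme \<Rightarrow> 'a \<Rightarrow> 'a \<Rightarrow> 'a" where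
  "integral_neg_nabla n R a b = sum_terms (\<lambda>m I v.
      - ((1 / of_nat (Suc m)) *\<^sub>C ((\<lambda>x. - der R x) ^^ Suc m) v)) (lambda_bracket n R a b)"

text \<open>
  \<open>:(\<integral>\<^sub>0\<^bsup>\<nabla>\<^esup> d\<Lambda> a)[b \<^sub>\<Lambda> c]:\<close>.  The coefficient of \<open>\<lambda>\<^sup>j\<close> in \<open>[b \<^sub>\<lambda> c]\<close> is \<open>b\<^sub>(\<^sub>j\<^sub>) c / j!\<close>, hence
  \<open>a\<^sub>(\<^sub>-\<^sub>j\<^sub>-\<^sub>2\<^sub>) (b\<^sub>(\<^sub>j\<^sub>) c)\<close> is \<open>:(\<partial>\<^sup>j\<^sup>+\<^sup>1 a) v: / (j + 1)\<close> for the term \<open>\<lambda>\<^sup>j v\<close>.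
\<close>

definition integral_nabla ::
  "nat \<Rightarrow> ('a::complex_vector, 'z) susy_va_scheme \<Rightarrow> 'a \<Rightarrow> 'a \<Rightarrow> 'a \<Rightarrow> 'a" where
  "integral_nabla n V a b c = sum_terms (\<lambda>j I v.
      (1 / of_nat (Suc j)) *\<^sub>C nop V ((der V ^^ Suc j) a) v) (lambda_bracket n V b c)"

text \<open>\<open>\<integral>\<^sub>0\<^bsup>\<Lambda>\<^esup> [[a \<^sub>\<Lambda> b] \<^sub>\<Gamma> c] d\<Gamma>\<close>\<close>

definition wick_integral ::
  "nat \<Rightarrow> ('a::complex_vector, 'z) susy_lca_scheme \<Rightarrow> 'a \<Rightarrow> 'a \<Rightarrow> 'a \<Rightarrow> 'a lam" where
  "wick_integral n R a b c =
     sum_terms (\<lambda>m J q. sum_terms (\<lambda>k K v. (1 / of_nat (Suc k)) *\<^sub>C monom_lam (m + Suc k) J v) q)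
       (foldr eta_deriv [1..<Suc n] (coeff_map n (\<lambda>v. lbr R v c) (lbr R a b)))"

definition susy_vertex_algebra :: "nat \<Rightarrow> 'a::complex_vector susy_va \<Rightarrow> bool" where
  "susy_vertex_algebra n V \<longleftrightarrow>
     susy_lie_conformal_algebra n V \<and>
     unital_diff_superalgebra n V (vac V) (nop V) \<and>
     (\<forall>p q. \<forall>a \<in> part V p. \<forall>b \<in> part V q.
        nop V a b - (- 1) ^ (p * q) *\<^sub>C nop V b a = integral_neg_nabla n V a b) \<and>
     (\<forall>p q. \<forall>a \<in> part V p. \<forall>b \<in> part V q. \<forall>c.
        nop V (nop V a b) c - nop V a (nop V b c) =
          integral_nabla n V a b c + (- 1) ^ (p * q) *\<^sub>C integral_nabla n V b a c) \<and>
     (\<forall>p q. \<forall>a \<in> part V p. \<forall>b \<in> part V q. \<forall>c.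
        lbr V a (nop V b c) =
          coeff_map 0 (\<lambda>v. nop V v c) (lbr V a b)
          + (- 1) ^ ((p + n) * q) *\<^sub>C coeff_map q (nop V b) (lbr V a c)
          + wick_integral n V a b c)"

text \<open>
  An \<open>N = n'\<close> SUSY vertex algebra regarded as an \<open>N = n\<close> one. The operators \<open>D\<^sup>i\<close>, \<open>i > n\<close>, remain
  in the record, but are ignored by the \<open>N = n\<close> notions.
\<close>

definition susy_reduct :: "nat \<Rightarrow> nat \<Rightarrow> 'a::complex_vector susy_va \<Rightarrow> 'a susy_va" where
  "susy_reduct n n' U = U\<lparr>lbr := \<lambda>a b. chi_derivs n n' (lbr U a b)\<rparr>"

definition susy_vertex_subalgebra :: "nat \<Rightarrow> 'a::complex_vector susy_va \<Rightarrow> 'a set \<Rightarrow> bool" where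
  "susy_vertex_subalgebra n U S \<longleftrightarrow>
     cvec.subspace S \<and> vac U \<in> S \<and>
     (\<forall>a \<in> S. der U a \<in> S) \<and> (\<forall>i \<in> {1..n}. \<forall>a \<in> S. oder U i a \<in> S) \<and>
     (\<forall>a \<in> S. \<forall>b \<in> S. nop U a b \<in> S) \<and>
     (\<forall>a \<in> S. \<forall>b \<in> S. \<forall>k. Poly_Mapping.lookup (lbr U a b) k \<in> S)"

definition lca_embedding ::
  "nat \<Rightarrow> ('a::complex_vector, 'y) susy_lca_scheme \<Rightarrow> ('b::complex_vector, 'z) susy_lca_scheme \<Rightarrow>
     ('a \<Rightarrow> 'b) \<Rightarrow> bool" where
  "lca_embedding n R S f \<longleftrightarrow>
     clinear f \<and> inj f \<and> (\<forall>k. \<forall>a \<in> part R k. f a \<in> part S k) \<and>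
     (\<forall>a. f (der R a) = der S (f a)) \<and>
     (\<forall>i \<in> {1..n}. \<forall>a. f (oder R i a) = oder S i (f a)) \<and>
     (\<forall>a b. lbr S (f a) (f b) = coeff_map 0 f (lbr R a b))"

text \<open>
  \<open>f\<close> identifies \<open>V\<close> with an \<open>N = n\<close> SUSY vertex subalgebra of \<open>U\<close>, with the induced structure.
\<close>

definition susy_vertex_subalgebra_via ::
  "nat \<Rightarrow> 'a::complex_vector susy_va \<Rightarrow> 'b::complex_vector susy_va \<Rightarrow> ('a \<Rightarrow> 'b) \<Rightarrow> bool" where
  "susy_vertex_subalgebra_via n V U f \<longleftrightarrow>
     susy_vertex_subalgebra n U (range f) \<and> lca_embedding n V U f \<and>
     f (vac V) = vac U \<and> (\<forall>a b. f (nop V a b) = nop U (f a) (f b))"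


section \<open>The universal enveloping SUSY vertex algebra\<close>

definition homogeneous_basis :: "('a::complex_vector, 'z) nabla_module_scheme \<Rightarrow> 'a set \<Rightarrow> bool" where
  "homogeneous_basis M B \<longleftrightarrow>
     B \<subseteq> even_part M \<union> odd_part M \<and> \<not> cvec.dependent B \<and> cvec.span B = UNIV"

definition pbw_words :: "('a, 'z) nabla_module_scheme \<Rightarrow> 'a set \<Rightarrow> ('a \<times> 'a) set \<Rightarrow> 'a list set" where
  "pbw_words M B r =
     {xs. set xs \<subseteq> B \<and> sorted_wrt (\<lambda>x y. (x, y) \<in> r \<and> (x \<in> odd_part M \<longrightarrow> x \<noteq> y)) xs}"

definition nop_word :: "'a susy_va \<Rightarrow> ('r \<Rightarrow> 'a) \<Rightarrow> 'r list \<Rightarrow> 'a" where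
  "nop_word V \<iota> xs = foldr (\<lambda>x. nop V (\<iota> x)) xs (vac V)"

definition universal_enveloping ::
  "nat \<Rightarrow> 'r::complex_vector susy_lca \<Rightarrow> 'v::complex_vector susy_va \<Rightarrow> ('r \<Rightarrow> 'v) \<Rightarrow> bool" where
  "universal_enveloping n R V \<iota> \<longleftrightarrow>
     susy_vertex_algebra n V \<and> lca_embedding n R V \<iota> \<and>
     (\<exists>B r. homogeneous_basis R B \<and> linear_order_on B r \<and>
        inj_on (nop_word V \<iota>) (pbw_words R B r) \<and>
        \<not> cvec.dependent (nop_word V \<iota> ` pbw_words R B r) \<and>
        cvec.span (nop_word V \<iota> ` pbw_words R B r) = UNIV)"


section \<open>SUSY structures on a tensor product\<close>

text \<open>
  The unital differential superalgebra underlying \<open>U\<close> (with respect to \<open>\<partial>, D\<^sup>1, \<dots>, D\<^sup>n\<close>) is the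
  tensor product of those underlying \<open>V\<close> and \<open>W\<close>; the signs are those of the Koszul rule.
\<close>

definition underlying_tensor_product ::
  "nat \<Rightarrow> 'v::complex_vector susy_va \<Rightarrow> 'w::complex_vector diff_superalgebra \<Rightarrow>
     ('v, 'w) tensor susy_va \<Rightarrow> bool" where
  "underlying_tensor_product n V W U \<longleftrightarrow>
     (\<forall>k. part U k =
        cvec.span {a \<otimes>\<^sub>C w | a w p q. a \<in> part V p \<and> w \<in> part W q \<and> even (p + q + k)}) \<and>
     (\<forall>a w. der U (a \<otimes>\<^sub>C w) = der V a \<otimes>\<^sub>C w + a \<otimes>\<^sub>C der W w) \<and>
     (\<forall>i \<in> {1..n}. \<forall>p. \<forall>a \<in> part V p. \<forall>w.
        oder U i (a \<otimes>\<^sub>C w) = oder V i a \<otimes>\<^sub>C w + (- 1) ^ p *\<^sub>C (a \<otimes>\<^sub>C oder W i w)) \<and>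
     vac U = vac V \<otimes>\<^sub>C aone W \<and>
     (\<forall>p q. \<forall>w \<in> part W p. \<forall>b \<in> part V q. \<forall>a x.
        nop U (a \<otimes>\<^sub>C w) (b \<otimes>\<^sub>C x) = (- 1) ^ (p * q) *\<^sub>C (nop V a b \<otimes>\<^sub>C amult W w x))"

end

theory Submission
  imports Defs "HOL-Library.Nat_Bijection"
begin

text \<open>
  Only the \<open>N = n\<close> SUSY vertex algebra structure of \<open>V = V(R)\<close> matters.  Let \<open>W\<close> be the Grassmann algebra
  on odd generators \<open>\<theta>\<^sup>i\<close>, on which \<open>\<partial>\<close> and \<open>D\<^sup>1, \<dots>, D\<^sup>n\<close> vanish.  Extending scalars makes \<open>V \<otimes> W\<close>
  an \<open>N = n\<close> SUSY vertex algebra, and for \<open>i > n\<close> the operator \<open>D\<^sup>i = \<partial>/\<partial>\<theta>\<^sup>i + \<theta>\<^sup>i \<partial>\<close> is an odd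
  derivation of the product and of the \<open>\<Lambda>\<close>-bracket, anticommutes with the other \<open>D\<^sup>j\<close> and squares to \<open>\<partial>\<close>.

  Such a derivation turns an \<open>N = k\<close> structure into an \<open>N = k + 1\<close> structure, the new bracket being
  \<open>\<chi>\<^sup>k\<^sup>+\<^sup>1 [a \<^sub>\<Lambda> b] + (-1)\<^sup>k [D\<^sup>k\<^sup>+\<^sup>1 a \<^sub>\<Lambda> b]\<close>; its derivative with respect to \<open>\<chi>\<^sup>k\<^sup>+\<^sup>1\<close> is the old one.
  Iterating from \<open>n\<close> to \<open>n'\<close> gives the extension.
\<close>

section \<open>Linear maps and the operators on polynomials\<close>

text \<open>Why \<open>D\<^sup>i\<close> with \<open>i > n\<close> is a derivation of the
  scalar-extended bracket: \<partial>/\<partial>\<theta> differentiates scalars only, and \<partial>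
  on \<open>V\<close> is an even derivation of the bracket because the two \<lambda> terms of
  sesquilinearity cancel; multiplying it by the odd scalar \<theta> gives an odd derivation. Since
  \<partial> vanishes on \<open>W\<close>, \<theta> is a constant and the square is \<partial>
  itself. The obstacle is skew-symmetry and the Jacobi identity for the new bracket, where
  noncommuting operators replace the variables. The adjoined variable always has the largest index:
  it stands last in an ordered monomial, the operator replacing it acts first, and anticommutation
  carries that operator to the front. Each nested new bracket then becomes a combination of old
  nested brackets in which \<open>D\<close> is applied to none, one or both of the first two
  arguments. The step can be repeated because the remaining derivations stay derivations of the new
  bracket. Countably many generators let one algebra \<open>W\<close> serve every \<open>n'\<close>;
  its basis is indexed by finite sets coded as natural numbers.\<close>

lemma clinearI:
  assumes "\<And>x y. f (x + y) = f x + f y" "\<And>c x. f (c *\<^sub>C x) = c *\<^sub>C f x"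
  shows "clinear f"
  by (intro Vector_Spaces.linear.intro module_hom.intro module_hom_axioms.intro cvec.vector_space_axioms cvec.module_axioms)
    (use assms in auto)

lemma clinear_add: "clinear f \<Longrightarrow> f (x + y) = f x + f y"
  by (auto simp: Vector_Spaces.linear_def module_hom_iff)

lemma clinear_scale: "clinear f \<Longrightarrow> f (c *\<^sub>C x) = c *\<^sub>C f x"
  by (auto simp: Vector_Spaces.linear_def module_hom_iff)

lemma clinear_zero: "clinear f \<Longrightarrow> f 0 = 0"
  using clinear_scale[of f 0 0] by simp

lemma clinear_neg: "clinear f \<Longrightarrow> f (- x) = - f x"
  using clinear_scale[of f "-1" x] by simp

lemma clinear_diff: "clinear f \<Longrightarrow> f (x - y) = f x - f y"
  using clinear_add[of f x "- y"] clinear_neg[of f y] by simp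

lemma clinear_sum: "clinear f \<Longrightarrow> f (sum g A) = (\<Sum>x\<in>A. f (g x))"
  by (induction A rule: infinite_finite_induct) (simp_all add: clinear_add clinear_zero)

lemma clinear_id: "clinear (\<lambda>x. x)"
  and clinear_0: "clinear (\<lambda>x. 0)"
  by (auto intro: clinearI)

lemma clinear_comp: "clinear f \<Longrightarrow> clinear g \<Longrightarrow> clinear (\<lambda>x. f (g x))"
  by (intro clinearI) (simp_all add: clinear_add clinear_scale)

lemma clinear_plus: "clinear f \<Longrightarrow> clinear g \<Longrightarrow> clinear (\<lambda>x. f x + g x)"
  by (intro clinearI) (simp_all add: clinear_add clinear_scale cvec.scale_right_distrib)

lemma clinear_minus: "clinear f \<Longrightarrow> clinear g \<Longrightarrow> clinear (\<lambda>x. f x - g x)"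
  by (intro clinearI) (simp_all add: clinear_add clinear_scale cvec.scale_right_diff_distrib)

lemma clinear_uminus: "clinear f \<Longrightarrow> clinear (\<lambda>x. - f x)"
  by (intro clinearI) (simp_all add: clinear_add clinear_scale)

lemma clinear_scaled: "clinear f \<Longrightarrow> clinear (\<lambda>x. c *\<^sub>C f x)"
  by (intro clinearI) (simp_all add: clinear_add clinear_scale cvec.scale_right_distrib mult.commute)

lemma clinear_summed: "(\<And>i. i \<in> A \<Longrightarrow> clinear (f i)) \<Longrightarrow> clinear (\<lambda>x. \<Sum>i\<in>A. f i x)"
  by (induction A rule: infinite_finite_induct) (auto intro: clinear_0 clinear_plus)

lemma clinear_single: "clinear (Poly_Mapping.single k)"
  by (auto intro!: clinearI poly_mapping_eqI simp: lookup_add lookup_single when_def lookup_scaleC)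

lemma clinear_lookup: "clinear (\<lambda>p. Poly_Mapping.lookup p k)"
  by (rule clinearI) (simp_all add: lookup_add lookup_scaleC)

lemma clinear_foldr: "(\<And>x. x \<in> set xs \<Longrightarrow> clinear (f x)) \<Longrightarrow> clinear (foldr f xs)"
proof (induction xs)
  case Nil
  show ?case
    unfolding foldr.simps id_def by (rule clinear_id)
next
  case (Cons x xs)
  then show ?case
    using clinear_comp[of "f x" "foldr f xs"] by (simp add: comp_def)
qed

lemma clinear_funpow:
  fixes f :: "'a::complex_vector \<Rightarrow> 'a"
  assumes "clinear f"
  shows "clinear (f ^^ m)"
  using assms
proof (induction m)
  case 0
  show ?case
    unfolding funpow.simps id_def by (rule clinear_id)
next
  case (Suc m)
  then show ?case
    using clinear_comp[of f "f ^^ m"] by (simp add: comp_def)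
qed

lemma clinear_if: "clinear f \<Longrightarrow> clinear g \<Longrightarrow> clinear (\<lambda>x. if b then f x else g x)"
  by (cases b) simp_all

lemmas clinear_intros = clinear_if clinear_id clinear_0 clinear_plus clinear_minus clinear_uminus clinear_scaled
  clinear_summed

section \<open>Polynomials as sums of their terms\<close>

lemma sum_single_lookup:
  fixes p :: "'a \<Rightarrow>\<^sub>0 'b::comm_monoid_add"
  shows "(\<Sum>k\<in>Poly_Mapping.keys p. Poly_Mapping.single k (Poly_Mapping.lookup p k)) = p"
  by (rule poly_mapping_eqI)
    (auto simp: lookup_sum lookup_single when_def not_in_keys_iff_lookup_eq_zero in_keys_iff sum.delta)

text \<open>Only the terms occurring in \<open>p\<close> are compared, so a restriction on the
  support of \<open>p\<close>, or on the parity of its coefficients, is available in the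
  comparison.\<close>

lemma clinear_eq_on_singles:
  assumes "clinear f" "clinear g"
    and "\<And>k. k \<in> Poly_Mapping.keys p \<Longrightarrow>
      f (Poly_Mapping.single k (Poly_Mapping.lookup p k)) = g (Poly_Mapping.single k (Poly_Mapping.lookup p k))"
  shows "f p = g p"
proof -
  have "f p = (\<Sum>k\<in>Poly_Mapping.keys p. f (Poly_Mapping.single k (Poly_Mapping.lookup p k)))"
    using clinear_sum[OF assms(1)] sum_single_lookup[of p] by metis
  also have "\<dots> = (\<Sum>k\<in>Poly_Mapping.keys p. g (Poly_Mapping.single k (Poly_Mapping.lookup p k)))"
    using assms(3) by simp
  also have "\<dots> = g p"
    using clinear_sum[OF assms(2)] sum_single_lookup[of p] by metis
  finally show ?thesis .
qed

lemma lam_eqI: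
  assumes "clinear f" "clinear g"
    and "\<And>m I v. (m, I) \<in> Poly_Mapping.keys p \<Longrightarrow> v = Poly_Mapping.lookup p (m, I) \<Longrightarrow>
      f (monom_lam m I v) = g (monom_lam m I v)"
  shows "f p = g p"
  by (rule clinear_eq_on_singles[OF assms(1,2)]) (use assms(3) in auto)

lemma lam_induct:
  fixes p :: "'a::comm_monoid_add lam"
  assumes "\<And>p q. P p \<Longrightarrow> P q \<Longrightarrow> P (p + q)" "P 0"
    and "\<And>m I v. (m, I) \<in> Poly_Mapping.keys p \<Longrightarrow> v = Poly_Mapping.lookup p (m, I) \<Longrightarrow> P (monom_lam m I v)"
  shows "P p"
proof -
  have "P (\<Sum>k\<in>A. Poly_Mapping.single k (Poly_Mapping.lookup p k))"
    if "finite A" "A \<subseteq> Poly_Mapping.keys p" for A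
    using that by (induction A) (auto intro: assms)
  from this[of "Poly_Mapping.keys p"] show ?thesis
    by (simp add: sum_single_lookup)
qed

text \<open>The summation range of \<open>sum_terms\<close> varies with the argument; a common
  finite range for \<open>x\<close>, \<open>y\<close> and \<open>x + y\<close> makes additivity a
  termwise statement.\<close>

lemma sum_terms_superset:
  assumes "finite A" "Poly_Mapping.keys p \<subseteq> A" "\<And>m I. F m I 0 = 0"
  shows "sum_terms F p = (\<Sum>(m, I)\<in>A. F m I (Poly_Mapping.lookup p (m, I)))"
  unfolding sum_terms_def
  by (rule sum.mono_neutral_left) (use assms in \<open>auto simp: in_keys_iff\<close>)

lemma clinear_sum_terms:
  assumes F: "\<And>m I. clinear (F m I)"
  shows "clinear (sum_terms F)"
proof -
  have F0: "F m I 0 = 0" for m I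
    using F by (rule clinear_zero)
  show ?thesis
  proof (rule clinearI)
    fix x y :: "'a lam"
    let ?A = "Poly_Mapping.keys x \<union> Poly_Mapping.keys y"
    have "sum_terms F z = (\<Sum>(m, I)\<in>?A. F m I (Poly_Mapping.lookup z (m, I)))"
      if "z \<in> {x, y, x + y}" for z
      by (rule sum_terms_superset) (use that F0 Poly_Mapping.keys_add[of x y] in auto)
    then show "sum_terms F (x + y) = sum_terms F x + sum_terms F y"
      by (simp add: sum.distrib[symmetric] lookup_add case_prod_unfold clinear_add[OF F])
  next
    fix c and x :: "'a lam"
    have "sum_terms F (c *\<^sub>C x) = (\<Sum>(m, I)\<in>Poly_Mapping.keys x. F m I (Poly_Mapping.lookup (c *\<^sub>C x) (m, I)))"
      by (rule sum_terms_superset) (use F0 in \<open>auto simp: in_keys_iff lookup_scaleC\<close>)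
    then show "sum_terms F (c *\<^sub>C x) = c *\<^sub>C sum_terms F x"
      by (simp add: sum_terms_def cvec.scale_sum_right lookup_scaleC case_prod_unfold clinear_scale[OF F])
  qed
qed

lemma sum_terms_monom:
  assumes "F m I 0 = 0"
  shows "sum_terms F (monom_lam m I v) = F m I v"
  using assms by (simp add: sum_terms_def)

lemma sum_terms_cong:
  assumes "\<And>m I. (m, I) \<in> Poly_Mapping.keys p \<Longrightarrow>
    F m I (Poly_Mapping.lookup p (m, I)) = G m I (Poly_Mapping.lookup p (m, I))"
  shows "sum_terms F p = sum_terms G p"
  unfolding sum_terms_def by (rule sum.cong) (use assms in auto)

lemma clinear_sum_terms_param:
  assumes "\<And>m I v. clinear (\<lambda>a. F a m I v)"
  shows "clinear (\<lambda>a. sum_terms (F a) p)"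
  unfolding sum_terms_def by (intro clinear_summed) (use assms in auto)

lemma sum_terms_comp:
  assumes "clinear h"
  shows "h (sum_terms F p) = sum_terms (\<lambda>m I v. h (F m I v)) p"
  by (simp add: sum_terms_def clinear_sum[OF assms] case_prod_unfold)

lemma clinear_lam_mult: "clinear lam_mult"
  unfolding lam_mult_def by (intro clinear_sum_terms clinear_single)

lemma lam_mult_monom [simp]: "lam_mult (monom_lam m I v) = monom_lam (Suc m) I v"
  by (simp add: lam_mult_def sum_terms_monom)

lemma clinear_chi_mult: "clinear (chi_mult i)"
  unfolding chi_mult_def
  by (intro clinear_sum_terms clinear_intros clinear_single)

lemma chi_mult_monom:
  "chi_mult i (monom_lam m I v) = place_sign i I *\<^sub>C
     (if i \<in> I then - monom_lam (Suc m) (I - {i}) v else monom_lam m (insert i I) v)"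
  by (simp add: chi_mult_def sum_terms_monom)

lemma clinear_chi_deriv: "clinear (chi_deriv i)"
  unfolding chi_deriv_def
  by (intro clinear_sum_terms clinear_intros clinear_single)

lemma chi_deriv_monom:
  "chi_deriv i (monom_lam m I v) = (if i \<in> I then place_sign i I *\<^sub>C monom_lam m (I - {i}) v else 0)"
  by (simp add: chi_deriv_def sum_terms_monom)

lemma clinear_coeff_map: "clinear f \<Longrightarrow> clinear (coeff_map k f)"
  unfolding coeff_map_def
  by (intro clinear_sum_terms clinear_intros clinear_comp[OF clinear_single])

lemma coeff_map_monom:
  "f 0 = 0 \<Longrightarrow> coeff_map k f (monom_lam m I v) = (- 1) ^ (k * card I) *\<^sub>C monom_lam m I (f v)"
  unfolding coeff_map_def by (rule sum_terms_monom) simp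

lemma lookup_coeff_map:
  assumes "f 0 = 0"
  shows "Poly_Mapping.lookup (coeff_map k f p) (m, I) = (- 1) ^ (k * card I) *\<^sub>C f (Poly_Mapping.lookup p (m, I))"
proof -
  have "Poly_Mapping.lookup (coeff_map k f p) (m, I) = (\<Sum>x\<in>Poly_Mapping.keys p.
      if x = (m, I) then (- 1) ^ (k * card I) *\<^sub>C f (Poly_Mapping.lookup p (m, I)) else 0)"
    unfolding coeff_map_def sum_terms_def lookup_sum
    by (rule sum.cong[OF refl]) (simp add: lookup_scaleC lookup_single when_def split: prod.split)
  then show ?thesis
    by (auto simp: sum.delta not_in_keys_iff_lookup_eq_zero assms)
qed

lemma coeff_map_coeff_map:
  assumes "f 0 = 0" "g 0 = 0" "clinear f"
  shows "coeff_map k f (coeff_map l g p) = coeff_map (k + l) (\<lambda>v. f (g v)) p"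
  by (rule poly_mapping_eqI)
    (auto simp: lookup_coeff_map assms clinear_scale[OF assms(3)] distrib_right power_add split: prod.splits)

text \<open>Parities are numbers read modulo 2, and the same parity arises in different forms, for
  instance as \<open>1 + Suc k\<close> and as \<open>k\<close>.\<close>

lemma coeff_map_parity:
  assumes "even k \<longleftrightarrow> even l"
  shows "coeff_map k f = coeff_map l f"
  unfolding coeff_map_def using assms by (simp add: minus_one_power_iff)

lemma coeff_map_add:
  assumes "clinear f" "clinear g"
  shows "coeff_map k (\<lambda>v. f v + g v) p = coeff_map k f p + coeff_map k g p"
  by (rule poly_mapping_eqI)
    (auto simp: lookup_coeff_map assms clinear_zero lookup_add cvec.scale_right_distrib)

lemma coeff_map_scale:
  assumes "clinear f"
  shows "coeff_map k (\<lambda>v. c *\<^sub>C f v) p = c *\<^sub>C coeff_map k f p"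
  by (rule poly_mapping_eqI)
    (auto simp: lookup_coeff_map assms clinear_zero lookup_scaleC mult.commute)

lemma coeff_map_neg:
  assumes "clinear f"
  shows "coeff_map k (\<lambda>v. - f v) p = - coeff_map k f p"
  using coeff_map_scale[OF assms, of k "-1" p] by simp

lemma sum_terms_coeff_map:
  assumes "\<And>m I. clinear (F m I)" "clinear f"
  shows "sum_terms F (coeff_map k f p) = sum_terms (\<lambda>m I v. (- 1) ^ (k * card I) *\<^sub>C F m I (f v)) p"
proof (rule lam_eqI[where p = p])
  show "clinear (\<lambda>p. sum_terms F (coeff_map k f p))"
    by (intro clinear_comp[OF clinear_sum_terms] clinear_coeff_map assms)
  show "clinear (sum_terms (\<lambda>m I v. (- 1) ^ (k * card I) *\<^sub>C F m I (f v)))"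
    by (intro clinear_sum_terms clinear_intros clinear_comp[OF assms(1)] assms(2))
  show "sum_terms F (coeff_map k f (monom_lam m I v)) =
      sum_terms (\<lambda>m I v. (- 1) ^ (k * card I) *\<^sub>C F m I (f v)) (monom_lam m I v)" for m I v
    using assms by (simp add: coeff_map_monom clinear_zero sum_terms_monom
        clinear_scale[OF clinear_sum_terms[OF assms(1)]])
qed

section \<open>Clifford relations between the odd variables and their derivatives\<close>

lemma place_sign_sq [simp]: "place_sign i I * place_sign i I = 1"
  unfolding place_sign_def by (metis power_mult_distrib mult_minus1 minus_minus power_one)

text \<open>The sign counts the indices below \<open>i\<close>, a finite set of natural numbers even
  when \<open>I\<close> is infinite. Hence the Clifford relations derived from it hold on monomials
  with arbitrary index sets.\<close>

lemma place_sign_insert: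
  assumes "j \<notin> I" "i \<noteq> j"
  shows "place_sign i (insert j I) = (if j < i then - place_sign i I else place_sign i I)"
proof -
  have "{l \<in> insert j I. l < i} = (if j < i then insert j {l \<in> I. l < i} else {l \<in> I. l < i})"
    by auto
  then show ?thesis
    using assms by (simp add: place_sign_def)
qed

lemma place_sign_remove:
  assumes "j \<in> I" "i \<noteq> j"
  shows "place_sign i (I - {j}) = (if j < i then - place_sign i I else place_sign i I)"
  using place_sign_insert[of j "I - {j}" i] assms by (auto simp: insert_absorb)

lemma place_sign_insert_self [simp]: "place_sign i (insert i I) = place_sign i I"
  unfolding place_sign_def by (rule arg_cong[where f = "\<lambda>A. (-1) ^ card A"]) auto

lemma place_sign_remove_self [simp]: "place_sign i (I - {i}) = place_sign i I"
  unfolding place_sign_def by (rule arg_cong[where f = "\<lambda>A. (-1) ^ card A"]) auto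

lemma insert_remove_swap: "i \<noteq> j \<Longrightarrow> insert i (I - {j}) = insert i I - {j}"
  by auto

lemma set_diff_swap: "A - B - C = A - C - (B :: 'a set)"
  by auto

lemmas clifford_simps = chi_mult_monom chi_deriv_monom
  clinear_scale[OF clinear_chi_mult] clinear_neg[OF clinear_chi_mult] clinear_zero[OF clinear_chi_mult]
  clinear_scale[OF clinear_lam_mult] clinear_neg[OF clinear_lam_mult] clinear_zero[OF clinear_lam_mult]
  clinear_scale[OF clinear_chi_deriv] clinear_neg[OF clinear_chi_deriv] clinear_zero[OF clinear_chi_deriv]
  place_sign_insert place_sign_remove insert_remove_swap insert_commute insert_absorb

lemmas op_linears = clinear_chi_mult clinear_lam_mult clinear_chi_deriv

lemma lam_mult_chi_mult: "lam_mult (chi_mult i p) = chi_mult i (lam_mult p)"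
  by (rule lam_eqI[where p = p]; (intro clinear_comp[OF op_linears(1)] clinear_comp[OF op_linears(2)] op_linears)?)
    (auto simp: clifford_simps)

lemma chi_deriv_lam_mult: "chi_deriv i (lam_mult p) = lam_mult (chi_deriv i p)"
  by (rule lam_eqI[where p = p]; (intro clinear_comp[OF op_linears(2)] clinear_comp[OF op_linears(3)] op_linears)?)
    (auto simp: clifford_simps)

lemma chi_mult_sq: "chi_mult i (chi_mult i p) = - lam_mult p"
  by (rule lam_eqI[where p = p]; (intro clinear_comp[OF op_linears(1)] clinear_uminus op_linears)?)
    (auto simp: clifford_simps)

lemma chi_mult_anticomm: "i \<noteq> j \<Longrightarrow> chi_mult i (chi_mult j p) = - chi_mult j (chi_mult i p)"
  by (rule lam_eqI[where p = p]; (intro clinear_comp[OF op_linears(1)] clinear_uminus op_linears)?)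
    (auto simp: clifford_simps set_diff_swap mult.commute)

lemma chi_deriv_chi_mult: "i \<noteq> j \<Longrightarrow> chi_deriv i (chi_mult j p) = - chi_mult j (chi_deriv i p)"
  by (rule lam_eqI[where p = p]; (intro clinear_comp[OF op_linears(1)] clinear_comp[OF op_linears(3)] clinear_uminus op_linears)?)
    (auto simp: clifford_simps set_diff_swap mult.commute)

lemma chi_deriv_anticomm: "i \<noteq> j \<Longrightarrow> chi_deriv i (chi_deriv j p) = - chi_deriv j (chi_deriv i p)"
  by (rule lam_eqI[where p = p]; (intro clinear_comp[OF op_linears(3)] clinear_uminus op_linears)?)
    (auto simp: clifford_simps set_diff_swap mult.commute)

text \<open>The keys of a polynomial may contain infinite index sets, whose \<open>card\<close> is
  0; there the sign of moving a map past the odd variables loses its meaning.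
  \<open>finite_lam\<close> excludes them, and \<open>lam_below k\<close> records which variables
  can really occur.\<close>

definition lam_supp :: "nat set set \<Rightarrow> 'a::zero lam \<Rightarrow> bool" where
  "lam_supp \<A> p \<longleftrightarrow> Poly_Mapping.keys p \<subseteq> UNIV \<times> \<A>"

abbreviation finite_lam :: "'a::zero lam \<Rightarrow> bool" where
  "finite_lam \<equiv> lam_supp (Collect finite)"

abbreviation lam_below :: "nat \<Rightarrow> 'a::zero lam \<Rightarrow> bool" where
  "lam_below k \<equiv> lam_supp (Pow {1..k})"

lemma lam_suppD: "lam_supp \<A> p \<Longrightarrow> (m, I) \<in> Poly_Mapping.keys p \<Longrightarrow> I \<in> \<A>"
  by (auto simp: lam_supp_def)

lemma lam_supp_mono: "lam_supp \<A> p \<Longrightarrow> \<A> \<subseteq> \<B> \<Longrightarrow> lam_supp \<B> p"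
  by (auto simp: lam_supp_def)

lemma lam_below_finite: "lam_below k p \<Longrightarrow> finite_lam p"
  by (erule lam_supp_mono) (auto intro: finite_subset)

lemma lam_supp_zero [simp]: "lam_supp \<A> 0"
  by (simp add: lam_supp_def)

lemma lam_supp_add: "lam_supp \<A> p \<Longrightarrow> lam_supp \<A> q \<Longrightarrow> lam_supp \<A> (p + q)"
  unfolding lam_supp_def using Poly_Mapping.keys_add[of p q] by blast

lemma lam_supp_scale: "lam_supp \<A> p \<Longrightarrow> lam_supp \<A> (c *\<^sub>C p)"
  by (auto simp: lam_supp_def in_keys_iff lookup_scaleC subset_iff)

lemma lam_supp_uminus:
  fixes p :: "'a::complex_vector lam"
  shows "lam_supp \<A> p \<Longrightarrow> lam_supp \<A> (- p)"
  using lam_supp_scale[of \<A> p "-1"] by simp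

lemma lam_supp_diff:
  fixes p :: "'a::complex_vector lam"
  shows "lam_supp \<A> p \<Longrightarrow> lam_supp \<A> q \<Longrightarrow> lam_supp \<A> (p - q)"
  using lam_supp_add[of \<A> p "- q"] lam_supp_uminus[of \<A> q] by simp

lemma lam_supp_monom: "I \<in> \<A> \<Longrightarrow> lam_supp \<A> (monom_lam m I v)"
  by (simp add: lam_supp_def)

lemma lam_supp_sum: "(\<And>x. x \<in> A \<Longrightarrow> lam_supp \<A> (f x)) \<Longrightarrow> lam_supp \<A> (sum f A)"
  by (induction A rule: infinite_finite_induct) (auto intro: lam_supp_add)

lemma lam_supp_sum_terms:
  assumes "lam_supp \<A> p" "\<And>m I v. I \<in> \<A> \<Longrightarrow> lam_supp \<B> (F m I v)"
  shows "lam_supp \<B> (sum_terms F p)"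
  unfolding sum_terms_def
  by (rule lam_supp_sum) (use assms in \<open>auto dest: lam_suppD\<close>)

lemma lam_supp_lam_mult: "lam_supp \<A> p \<Longrightarrow> lam_supp \<A> (lam_mult p)"
  unfolding lam_mult_def by (erule lam_supp_sum_terms) (rule lam_supp_monom)

lemma lam_supp_coeff_map: "lam_supp \<A> p \<Longrightarrow> lam_supp \<A> (coeff_map k f p)"
  unfolding coeff_map_def by (erule lam_supp_sum_terms) (intro lam_supp_scale lam_supp_monom)

lemma lam_supp_chi_mult:
  assumes "lam_supp \<A> p" "\<And>I. I \<in> \<A> \<Longrightarrow> insert i I \<in> \<A> \<and> I - {i} \<in> \<A>"
  shows "lam_supp \<A> (chi_mult i p)"
  unfolding chi_mult_def using assms(1)
  by (rule lam_supp_sum_terms)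
    (auto intro!: lam_supp_scale lam_supp_uminus lam_supp_monom simp: assms(2))

lemma lam_supp_chi_deriv:
  assumes "lam_supp \<A> p" "\<And>I. I \<in> \<A> \<Longrightarrow> I - {i} \<in> \<A>"
  shows "lam_supp \<A> (chi_deriv i p)"
  unfolding chi_deriv_def using assms(1)
  by (rule lam_supp_sum_terms) (auto intro!: lam_supp_scale lam_supp_monom simp: assms(2))

lemma finite_lam_chi_mult: "finite_lam p \<Longrightarrow> finite_lam (chi_mult i p)"
  by (rule lam_supp_chi_mult) auto

lemma finite_lam_chi_deriv: "finite_lam p \<Longrightarrow> finite_lam (chi_deriv i p)"
  by (rule lam_supp_chi_deriv) auto

lemma lam_below_chi_mult: "lam_below k p \<Longrightarrow> i \<in> {1..k} \<Longrightarrow> lam_below k (chi_mult i p)"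
  by (rule lam_supp_chi_mult) auto

lemma finite_lam_gamma_mult: "lam_supp \<A> p \<Longrightarrow> lam_supp \<A> (gamma_mult p)"
  and finite_lam_eta_mult: "lam_supp \<A> p \<Longrightarrow> lam_supp \<A> (eta_mult i p)"
  and finite_lam_eta_deriv: "lam_supp \<A> p \<Longrightarrow> lam_supp \<A> (eta_deriv i p)"
  unfolding gamma_mult_def eta_mult_def eta_deriv_def by (rule lam_supp_coeff_map, assumption)+

lemmas finite_lam_intros = lam_supp_zero lam_supp_add lam_supp_scale lam_supp_uminus lam_supp_diff
  lam_supp_lam_mult lam_supp_coeff_map finite_lam_chi_mult finite_lam_chi_deriv
  finite_lam_gamma_mult finite_lam_eta_mult finite_lam_eta_deriv

lemma coeff_map_lam_mult:
  assumes f: "clinear f"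
  shows "coeff_map k f (lam_mult p) = lam_mult (coeff_map k f p)"
  by (rule lam_eqI[where p = p]; (intro clinear_comp[OF clinear_coeff_map[OF f]]
      clinear_comp[OF clinear_lam_mult] op_linears clinear_coeff_map f)?)
    (simp add: coeff_map_monom clinear_zero[OF f] clifford_simps)

text \<open>Multiplication by \<chi> changes the size of a finite index set by one, in either
  direction, so a map of parity \<open>k\<close> picks up one further \<open>(-1)^k\<close>. On an
  infinite index set \<open>card\<close> stays 0 and this sign would be missing.\<close>

lemma coeff_map_chi_mult:
  assumes f: "clinear f" and p: "finite_lam p"
  shows "coeff_map k f (chi_mult i p) = (- 1) ^ k *\<^sub>C chi_mult i (coeff_map k f p)"
proof (rule lam_eqI[where p = p])
  show "clinear (\<lambda>p. coeff_map k f (chi_mult i p))"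
    by (intro clinear_comp[OF clinear_coeff_map[OF f]] op_linears)
  show "clinear (\<lambda>p. (- 1) ^ k *\<^sub>C chi_mult i (coeff_map k f p))"
    by (intro clinear_scaled clinear_comp[OF clinear_chi_mult] clinear_coeff_map f)
next
  fix m I v
  assume "(m, I) \<in> Poly_Mapping.keys p"
  then have "finite I"
    using lam_suppD[OF p] by simp
  moreover have "(- 1) ^ (k * card (I - {i})) = (- 1 :: complex) ^ k * (- 1) ^ (k * card I)" if "i \<in> I"
    unfolding card.remove[OF \<open>finite I\<close> that] by (simp add: minus_one_power_iff)
  moreover have "(- 1 :: complex) ^ (k + k * card I) = (- 1) ^ k * (- 1) ^ (k * card I)"
    by (rule power_add)
  ultimately show "coeff_map k f (chi_mult i (monom_lam m I v)) =
      (- 1) ^ k *\<^sub>C chi_mult i (coeff_map k f (monom_lam m I v))"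
    by (simp add: coeff_map_monom clinear_zero[OF f] clifford_simps mult.commute
        clinear_scale[OF clinear_coeff_map[OF f]] clinear_neg[OF clinear_coeff_map[OF f]])
qed

lemma coeff_map_chi_deriv:
  assumes f: "clinear f" and p: "finite_lam p"
  shows "coeff_map k f (chi_deriv i p) = (- 1) ^ k *\<^sub>C chi_deriv i (coeff_map k f p)"
proof (rule lam_eqI[where p = p])
  show "clinear (\<lambda>p. coeff_map k f (chi_deriv i p))"
    by (intro clinear_comp[OF clinear_coeff_map[OF f]] op_linears)
  show "clinear (\<lambda>p. (- 1) ^ k *\<^sub>C chi_deriv i (coeff_map k f p))"
    by (intro clinear_scaled clinear_comp[OF clinear_chi_deriv] clinear_coeff_map f)
next
  fix m I v
  assume "(m, I) \<in> Poly_Mapping.keys p"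
  then have "finite I"
    using lam_suppD[OF p] by simp
  moreover have "(- 1) ^ (k * card (I - {i})) = (- 1 :: complex) ^ k * (- 1) ^ (k * card I)" if "i \<in> I"
    unfolding card.remove[OF \<open>finite I\<close> that] by (simp add: minus_one_power_iff)
  ultimately show "coeff_map k f (chi_deriv i (monom_lam m I v)) =
      (- 1) ^ k *\<^sub>C chi_deriv i (coeff_map k f (monom_lam m I v))"
    by (simp add: coeff_map_monom clinear_zero[OF f] clifford_simps mult.commute
        clinear_scale[OF clinear_coeff_map[OF f]] clinear_zero[OF clinear_coeff_map[OF f]])
qed

lemma chi_deriv_zero:
  assumes "lam_supp \<A> p" "\<And>I. I \<in> \<A> \<Longrightarrow> i \<notin> I"
  shows "chi_deriv i p = 0"
  unfolding chi_deriv_def sum_terms_def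
  by (rule sum.neutral) (use assms in \<open>auto dest: lam_suppD\<close>)

lemma chi_deriv_chi_mult_self:
  assumes "lam_supp \<A> p" "\<And>I. I \<in> \<A> \<Longrightarrow> i \<notin> I"
  shows "chi_deriv i (chi_mult i p) = p"
proof (rule lam_eqI[where p = p])
  show "clinear (\<lambda>p. chi_deriv i (chi_mult i p))" "clinear (\<lambda>p. p :: 'a lam)"
    by (intro clinear_comp[OF clinear_chi_deriv] op_linears clinear_id)+
next
  fix m I v
  assume "(m, I) \<in> Poly_Mapping.keys p"
  then have "i \<notin> I"
    using lam_suppD[OF assms(1)] assms(2) by simp
  then show "chi_deriv i (chi_mult i (monom_lam m I v)) = monom_lam m I v"
    by (simp add: clifford_simps)
qed

section \<open>The operators of the second set of variables\<close>

lemma clinear_gamma_mult: "clinear gamma_mult"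
  and clinear_eta_mult: "clinear (eta_mult i)"
  and clinear_eta_deriv: "clinear (eta_deriv i)"
  unfolding gamma_mult_def eta_mult_def eta_deriv_def by (intro clinear_coeff_map op_linears)+

lemmas ops_linear = op_linears clinear_gamma_mult clinear_eta_mult clinear_eta_deriv

lemma eta_mult_lam_mult: "eta_mult i (lam_mult Q) = lam_mult (eta_mult i Q)"
  unfolding eta_mult_def by (intro coeff_map_lam_mult op_linears)

lemma gamma_mult_chi_mult: "finite_lam Q \<Longrightarrow> gamma_mult (chi_mult j Q) = chi_mult j (gamma_mult Q)"
  unfolding gamma_mult_def by (simp add: coeff_map_chi_mult op_linears)

lemma eta_mult_chi_mult: "finite_lam Q \<Longrightarrow> eta_mult i (chi_mult j Q) = - chi_mult j (eta_mult i Q)"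
  unfolding eta_mult_def by (simp add: coeff_map_chi_mult op_linears)

lemma eta_deriv_chi_mult: "finite_lam Q \<Longrightarrow> eta_deriv i (chi_mult j Q) = - chi_mult j (eta_deriv i Q)"
  unfolding eta_deriv_def by (simp add: coeff_map_chi_mult op_linears)

lemma gamma_mult_eta_mult: "gamma_mult (eta_mult i Q) = eta_mult i (gamma_mult Q)"
  unfolding gamma_mult_def eta_mult_def
  by (simp add: coeff_map_coeff_map op_linears clinear_zero lam_mult_chi_mult)

lemma eta_mult_anticomm:
  assumes "i \<noteq> j"
  shows "eta_mult i (eta_mult j Q) = - eta_mult j (eta_mult i Q)"
proof -
  have "eta_mult i (eta_mult j Q) = coeff_map 2 (\<lambda>v. - chi_mult j (chi_mult i v)) Q"
    unfolding eta_mult_def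
    by (simp add: coeff_map_coeff_map op_linears clinear_zero chi_mult_anticomm[OF assms, symmetric] numeral_2_eq_2)
  also have "\<dots> = - coeff_map 2 (\<lambda>v. chi_mult j (chi_mult i v)) Q"
    by (intro coeff_map_neg clinear_comp[OF clinear_chi_mult] op_linears)
  also have "coeff_map 2 (\<lambda>v. chi_mult j (chi_mult i v)) Q = eta_mult j (eta_mult i Q)"
    unfolding eta_mult_def
    by (simp add: coeff_map_coeff_map op_linears clinear_zero numeral_2_eq_2)
  finally show ?thesis .
qed

section \<open>Substitution of operators for the variables\<close>

lemma clinear_monomial_op:
  assumes "clinear L" "\<And>i. clinear (X i)"
  shows "clinear (monomial_op L X m I)"
  unfolding monomial_op_def
  by (rule clinear_comp[OF clinear_funpow[OF assms(1)] clinear_foldr]) (rule assms(2))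

lemma monomial_op_Suc: "monomial_op L X (Suc m) I u = L (monomial_op L X m I u)"
  by (simp add: monomial_op_def)

lemma set_sorted_list_subset: "set (sorted_list_of_set I) \<subseteq> I"
  by (cases "finite I") auto

lemma foldr_closed:
  assumes "P u" "\<And>i x. i \<in> set xs \<Longrightarrow> P x \<Longrightarrow> P (X i x)"
  shows "P (foldr X xs u)"
  using assms(2) by (induction xs) (auto simp: assms(1))

lemma funpow_closed:
  assumes "P u" "\<And>x. P x \<Longrightarrow> P (L x)"
  shows "P ((L ^^ m) u)"
  by (induction m) (auto simp: assms)

lemma monomial_op_closed:
  assumes "P u" "\<And>x. P x \<Longrightarrow> P (L x)" "\<And>i x. i \<in> I \<Longrightarrow> P x \<Longrightarrow> P (X i x)"
  shows "P (monomial_op L X m I u)"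
  unfolding monomial_op_def
proof (rule funpow_closed)
  show "P (foldr X (sorted_list_of_set I) u)"
    by (rule foldr_closed) (use assms set_sorted_list_subset in blast)+
qed (rule assms(2))

text \<open>Moving \<open>T\<close> out past one odd operator costs a factor \<open>d\<close>, hence
  \<open>d ^ card I\<close> in all. The commutation rules are asked only on a set \<open>P\<close>
  closed under the primed operators, because some of the relations to be used hold only for
  polynomials with finite index sets.\<close>

lemma monomial_op_intertwine:
  assumes lin: "clinear L" "\<And>i. clinear (X i)" "clinear T"
    and P: "P u" "\<And>x. P x \<Longrightarrow> P (L' x)" "\<And>i x. i \<in> I \<Longrightarrow> P x \<Longrightarrow> P (X' i x)"
    and L: "\<And>x. P x \<Longrightarrow> L (T x) = T (L' x)"
    and X: "\<And>i x. i \<in> I \<Longrightarrow> P x \<Longrightarrow> X i (T x) = d *\<^sub>C T (X' i x)"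
  shows "monomial_op L X m I (T u) = d ^ card I *\<^sub>C T (monomial_op L' X' m I u)"
proof -
  have 1: "foldr X xs (T u) = d ^ length xs *\<^sub>C T (foldr X' xs u) \<and> P (foldr X' xs u)"
    if "set xs \<subseteq> I" for xs
    using that
  proof (induction xs)
    case (Cons x xs)
    then show ?case
      by (simp add: clinear_scale[OF lin(2)] X P(3) mult.commute)
  qed (simp add: P)
  have 2: "(L ^^ m) (T y) = T ((L' ^^ m) y) \<and> P ((L' ^^ m) y)" if "P y" for y
    by (induction m) (use that L P(2) in auto)
  \<comment> \<open>An infinite \<open>I\<close> has an empty sorted list and \<open>card\<close> 0,
    so the count agrees there too.\<close>
  have len: "length (sorted_list_of_set I) = card I"
    by (cases "finite I") auto
  show ?thesis
    unfolding monomial_op_def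
    using 1[OF set_sorted_list_subset] 2 len
    by (simp add: clinear_scale[OF clinear_funpow[OF lin(1)]])
qed

lemma sorted_list_of_set_insert_top:
  assumes "finite I" "\<And>j. j \<in> I \<Longrightarrow> j < (i :: nat)"
  shows "sorted_list_of_set (insert i I) = sorted_list_of_set I @ [i]"
  by (rule sorted_distinct_set_unique)
    (use assms in \<open>auto simp: sorted_append intro: less_imp_le simp del: sorted_list_of_set_insert_remove\<close>)

text \<open>The largest index acts first, so a new top index changes only the vector to which the
  monomial is applied.\<close>

lemma monomial_op_insert_top:
  assumes "finite I" "\<And>j. j \<in> I \<Longrightarrow> j < i"
  shows "monomial_op L X m (insert i I) u = monomial_op L X m I (X i u)"
  by (simp add: monomial_op_def sorted_list_of_set_insert_top assms del: sorted_list_of_set_insert_remove)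

text \<open>
  All substitutions in the definitions of the iterated brackets have this shape; \<open>c = \<plusminus>1\<close> is the sign
  of moving one odd variable out of the bracket.
\<close>

definition lam_eval ::
  "complex \<Rightarrow> ('b \<Rightarrow> 'b) \<Rightarrow> (nat \<Rightarrow> 'b \<Rightarrow> 'b) \<Rightarrow> ('a \<Rightarrow> 'b) \<Rightarrow> 'a::complex_vector lam \<Rightarrow> 'b::complex_vector" where
  "lam_eval c L X g = sum_terms (\<lambda>m I v. c ^ card I *\<^sub>C monomial_op L X m I (g v))"

lemma lam_supp_lam_eval:
  assumes p: "lam_supp \<A> p" and g: "\<And>v. lam_supp \<B> (g v)"
    and L: "\<And>x. lam_supp \<B> x \<Longrightarrow> lam_supp \<B> (L x)"
    and X: "\<And>i x. i \<in> \<Union>\<A> \<Longrightarrow> lam_supp \<B> x \<Longrightarrow> lam_supp \<B> (X i x)"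
  shows "lam_supp \<B> (lam_eval c L X g p)"
  unfolding lam_eval_def using p
  by (rule lam_supp_sum_terms)
    (rule lam_supp_scale, rule monomial_op_closed[where P = "lam_supp \<B>"], auto intro: g L X)

locale substitution =
  fixes L :: "'b::complex_vector \<Rightarrow> 'b" and X :: "nat \<Rightarrow> 'b \<Rightarrow> 'b"
  assumes clinear_L: "clinear L" and clinear_X: "clinear (X i)"
begin

lemma clinear_term: "clinear g \<Longrightarrow> clinear (\<lambda>v. c ^ card I *\<^sub>C monomial_op L X m I (g v))"
  by (intro clinear_scaled clinear_comp[OF clinear_monomial_op] clinear_L clinear_X)

lemma clinear_lam_eval: "clinear g \<Longrightarrow> clinear (lam_eval c L X g)"
  unfolding lam_eval_def by (intro clinear_sum_terms clinear_term)

lemma lam_eval_monom: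
  "clinear g \<Longrightarrow> lam_eval c L X g (monom_lam m I v) = c ^ card I *\<^sub>C monomial_op L X m I (g v)"
  unfolding lam_eval_def by (rule sum_terms_monom) (rule clinear_zero[OF clinear_term])

lemma lam_eval_plus: "lam_eval c L X (\<lambda>v. g v + h v) p = lam_eval c L X g p + lam_eval c L X h p"
  unfolding lam_eval_def sum_terms_def
  by (simp add: clinear_add[OF clinear_monomial_op[OF clinear_L clinear_X]] cvec.scale_right_distrib
      case_prod_unfold sum.distrib)

lemma lam_eval_scaled: "lam_eval c L X (\<lambda>v. a *\<^sub>C g v) p = a *\<^sub>C lam_eval c L X g p"
  unfolding lam_eval_def sum_terms_def
  by (simp add: clinear_scale[OF clinear_monomial_op[OF clinear_L clinear_X]]
      case_prod_unfold cvec.scale_sum_right mult.commute)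

lemma lam_eval_lam_mult:
  assumes "clinear g"
  shows "lam_eval c L X g (lam_mult p) = L (lam_eval c L X g p)"
  by (rule lam_eqI[where p = p]; (intro clinear_comp[OF clinear_lam_eval] op_linears assms
      clinear_comp[OF clinear_L] clinear_lam_eval)?)
    (simp add: lam_eval_monom assms monomial_op_Suc clinear_scale[OF clinear_L])

lemma lam_eval_coeff_map:
  assumes "clinear g" "clinear f"
  shows "lam_eval c L X g (coeff_map k f p) = lam_eval ((- 1) ^ k * c) L X (\<lambda>v. g (f v)) p"
  unfolding lam_eval_def
  by (subst sum_terms_coeff_map[OF clinear_term[OF assms(1)] assms(2)])
    (simp add: power_mult power_mult_distrib)

text \<open>Naturality of substitution. The factor \<open>d\<close> from each odd operator and the
  sign \<open>c\<close> are both raised to the number of odd variables, so they merge into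
  \<open>c * d\<close>. The case \<open>d = -1\<close> pulls out an odd variable, the case
  \<open>d = 1\<close> multiplication by a scalar.\<close>

lemma lam_eval_intertwine:
  assumes lin: "clinear T" and p: "lam_supp \<A> p"
    and P: "\<And>m I. (m, I) \<in> Poly_Mapping.keys p \<Longrightarrow> P (g (Poly_Mapping.lookup p (m, I)))"
      "\<And>x. P x \<Longrightarrow> P (L' x)" "\<And>i x. i \<in> \<Union>\<A> \<Longrightarrow> P x \<Longrightarrow> P (X' i x)"
    and L: "\<And>x. P x \<Longrightarrow> L (T x) = T (L' x)"
    and X: "\<And>i x. i \<in> \<Union>\<A> \<Longrightarrow> P x \<Longrightarrow> X i (T x) = d *\<^sub>C T (X' i x)"
  shows "lam_eval c L X (\<lambda>v. T (g v)) p = T (lam_eval (c * d) L' X' g p)"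
  unfolding lam_eval_def sum_terms_comp[OF lin]
proof (rule sum_terms_cong)
  fix m I
  assume mI: "(m, I) \<in> Poly_Mapping.keys p"
  let ?v = "Poly_Mapping.lookup p (m, I)"
  have I: "i \<in> \<Union>\<A>" if "i \<in> I" for i
    using lam_suppD[OF p mI] that by blast
  have "monomial_op L X m I (T (g ?v)) = d ^ card I *\<^sub>C T (monomial_op L' X' m I (g ?v))"
    by (rule monomial_op_intertwine[where P = P]) (use lin clinear_L clinear_X P L X I mI in auto)
  then show "c ^ card I *\<^sub>C monomial_op L X m I (T (g ?v)) =
      T ((c * d) ^ card I *\<^sub>C monomial_op L' X' m I (g ?v))"
    by (simp add: clinear_scale[OF lin] power_mult_distrib)
qed

text \<open>Two signs \<open>(-1)^(card I)\<close> cancel: one from moving the new variable to its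
  place at the end of the monomial, one from carrying the operator that replaces it through the
  other odd operators to the front. What is left is \<open>c\<close>, for one extra
  variable.\<close>

lemma lam_eval_chi_mult_top:
  assumes g: "clinear g" and p: "lam_below k p"
    and P: "\<And>v. P (g v)" "\<And>x. P x \<Longrightarrow> P (L x)" "\<And>i x. i \<in> {1..k} \<Longrightarrow> P x \<Longrightarrow> P (X i x)"
    and L: "\<And>x. P x \<Longrightarrow> L (X (Suc k) x) = X (Suc k) (L x)"
    and X: "\<And>i x. i \<in> {1..k} \<Longrightarrow> P x \<Longrightarrow> X i (X (Suc k) x) = - X (Suc k) (X i x)"
  shows "lam_eval c L X g (chi_mult (Suc k) p) = c *\<^sub>C X (Suc k) (lam_eval c L X g p)"
proof (rule lam_eqI[where p = p])
  show "clinear (\<lambda>p. lam_eval c L X g (chi_mult (Suc k) p))"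
    by (intro clinear_comp[OF clinear_lam_eval] g op_linears)
  show "clinear (\<lambda>p. c *\<^sub>C X (Suc k) (lam_eval c L X g p))"
    by (intro clinear_scaled clinear_comp[OF clinear_X] clinear_lam_eval g)
next
  fix m I v
  assume "(m, I) \<in> Poly_Mapping.keys p"
  then have "I \<subseteq> {1..k}"
    using lam_suppD[OF p] by simp
  then have I: "finite I" "\<And>j. j \<in> I \<Longrightarrow> j < Suc k" "Suc k \<notin> I"
    using finite_subset[of I "{1..k}"] by (simp, fastforce, fastforce)
  have "{j \<in> I. j < Suc k} = I"
    using I(2) by (intro equalityI subsetI CollectI conjI) simp_all
  then have sign: "place_sign (Suc k) I = (- 1) ^ card I"
    by (simp only: place_sign_def)
  have *: "monomial_op L X m I (X (Suc k) (g v)) = (- 1) ^ card I *\<^sub>C X (Suc k) (monomial_op L X m I (g v))"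
    by (rule monomial_op_intertwine[where P = P]) (use P L X clinear_L clinear_X \<open>I \<subseteq> {1..k}\<close> in auto)
  have "lam_eval c L X g (chi_mult (Suc k) (monom_lam m I v)) =
      (- 1) ^ card I *\<^sub>C c ^ Suc (card I) *\<^sub>C monomial_op L X m (insert (Suc k) I) (g v)"
    using I(1,3) by (simp add: chi_mult_monom clinear_scale[OF clinear_lam_eval[OF g]] lam_eval_monom[OF g] sign)
  also have "\<dots> = c ^ Suc (card I) *\<^sub>C X (Suc k) (monomial_op L X m I (g v))"
  proof -
    have "(- 1) ^ card I * (c ^ Suc (card I) * (- 1) ^ card I) = c ^ Suc (card I)"
      by (simp add: minus_one_power_iff)
    moreover have "monomial_op L X m (insert (Suc k) I) (g v) = monomial_op L X m I (X (Suc k) (g v))"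
      by (rule monomial_op_insert_top[OF I(1)]) (rule I(2))
    ultimately show ?thesis
      by (simp only: * scaleC_scaleC)
  qed
  finally show "lam_eval c L X g (chi_mult (Suc k) (monom_lam m I v)) =
      c *\<^sub>C X (Suc k) (lam_eval c L X g (monom_lam m I v))"
    by (simp add: lam_eval_monom g clinear_scale[OF clinear_X])
qed

end

section \<open>The iterated brackets as substitutions, and the axioms as separate rules\<close>

lemma bracket_neg_eval:
  "bracket_neg R a b = lam_eval 1 (\<lambda>x. - lam_der R x - lam_mult x)
     (\<lambda>i x. - lam_oder R i x - chi_mult i x) const_lam (lbr R a b)"
  by (simp add: bracket_neg_def lam_eval_def)

lemma bracket_right_eval:
  "bracket_right n R p a b c = lam_eval ((- 1) ^ (p + n)) gamma_mult eta_mult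
     (\<lambda>v. coeff_map 0 const_lam (lbr R a v)) (lbr R b c)"
  by (simp add: bracket_right_def lam_eval_def power_mult)

lemma bracket_left_sum_eval:
  "bracket_left_sum n R a b c = lam_eval ((- 1) ^ n) lam_mult chi_mult
     (\<lambda>v. lam_eval 1 (\<lambda>x. lam_mult x + gamma_mult x) (\<lambda>i x. chi_mult i x + eta_mult i x)
        (\<lambda>w. const_lam (const_lam w)) (lbr R v c)) (lbr R a b)"
  by (simp add: bracket_left_sum_def lam_eval_def power_mult)

context
  fixes n :: nat and R :: "('a::complex_vector, 'z) susy_lca_scheme"
  assumes lca: "susy_lie_conformal_algebra n R"
begin

lemma lbr_linear_right: "clinear (lbr R a)"
  using lca unfolding susy_lie_conformal_algebra_def by simp

lemma lbr_linear_left: "clinear (\<lambda>a. lbr R a b)"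
  using lca unfolding susy_lie_conformal_algebra_def by simp

lemma lbr_below: "lam_below n (lbr R a b)"
  using lca unfolding susy_lie_conformal_algebra_def lam_supp_def by simp

lemma lbr_part:
  assumes "a \<in> part R p" "b \<in> part R q"
  shows "Poly_Mapping.lookup (lbr R a b) (m, I) \<in> part R (p + q + n + card I)"
proof -
  have "\<forall>p q. \<forall>a \<in> part R p. \<forall>b \<in> part R q. \<forall>m I.
      Poly_Mapping.lookup (lbr R a b) (m, I) \<in> part R (p + q + n + card I)"
    using lca unfolding susy_lie_conformal_algebra_def by (elim conjE)
  then show ?thesis
    using assms by blast
qed

lemma lbr_der_left: "lbr R (der R a) b = - lam_mult (lbr R a b)"
  using lca unfolding susy_lie_conformal_algebra_def by simp

lemma lbr_der_right: "lbr R a (der R b) = lam_der R (lbr R a b) + lam_mult (lbr R a b)"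
  using lca unfolding susy_lie_conformal_algebra_def by simp

lemma lbr_oder_left:
  "i \<in> {1..n} \<Longrightarrow> lbr R (oder R i a) b = (- 1) ^ (n + 1) *\<^sub>C chi_mult i (lbr R a b)"
  using lca unfolding susy_lie_conformal_algebra_def by simp

lemma lbr_oder_right:
  "i \<in> {1..n} \<Longrightarrow> a \<in> part R p \<Longrightarrow>
    lbr R a (oder R i b) = (- 1) ^ (p + n) *\<^sub>C (lam_oder R i (lbr R a b) + chi_mult i (lbr R a b))"
  using lca unfolding susy_lie_conformal_algebra_def by simp

lemma lbr_skew:
  "a \<in> part R p \<Longrightarrow> b \<in> part R q \<Longrightarrow> lbr R b a = (- 1) ^ (p * q + n + 1) *\<^sub>C bracket_neg R a b"
  using lca unfolding susy_lie_conformal_algebra_def by blast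

lemma lbr_jacobi:
  "a \<in> part R p \<Longrightarrow> b \<in> part R q \<Longrightarrow>
    bracket_right n R p a b c =
      (- 1) ^ ((p + 1) * n) *\<^sub>C bracket_left_sum n R a b c
      + (- 1) ^ ((p + n) * (q + n)) *\<^sub>C bracket_right_swap n R q b a c"
  using lca unfolding susy_lie_conformal_algebra_def by blast

lemmas lbr_finite = lam_below_finite[OF lbr_below]

lemma lbr_simps:
  "lbr R (a + a') b = lbr R a b + lbr R a' b" "lbr R a (b + b') = lbr R a b + lbr R a b'"
  "lbr R (- a) b = - lbr R a b" "lbr R a (- b) = - lbr R a b"
  "lbr R (c *\<^sub>C a) b = c *\<^sub>C lbr R a b" "lbr R a (c *\<^sub>C b) = c *\<^sub>C lbr R a b"
  by (fact clinear_add[OF lbr_linear_left] clinear_add[OF lbr_linear_right]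
      clinear_neg[OF lbr_linear_left] clinear_neg[OF lbr_linear_right]
      clinear_scale[OF lbr_linear_left] clinear_scale[OF lbr_linear_right])+

end

lemma substitution_neg:
  assumes "clinear (der R)" "\<And>i. clinear (oder R i)"
  shows "substitution (\<lambda>x. - lam_der R x - lam_mult x) (\<lambda>i x. - lam_oder R i x - chi_mult i x)"
  unfolding lam_der_def lam_oder_def
  by (intro substitution.intro clinear_intros clinear_comp[OF clinear_lam_mult] ops_linear
      clinear_coeff_map assms)

lemma substitution_gamma: "substitution gamma_mult eta_mult"
  by (intro substitution.intro ops_linear)

lemma substitution_lam: "substitution lam_mult chi_mult"
  by (intro substitution.intro ops_linear)

lemma substitution_sum:
  "substitution (\<lambda>x. lam_mult x + gamma_mult x) (\<lambda>i x. chi_mult i x + eta_mult i x)"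
  by (intro substitution.intro clinear_intros ops_linear)

lemmas ops_linear_simps =
  clinear_add[OF clinear_lam_mult] clinear_diff[OF clinear_lam_mult] clinear_neg[OF clinear_lam_mult]
  clinear_scale[OF clinear_lam_mult] clinear_zero[OF clinear_lam_mult]
  clinear_add[OF clinear_chi_mult] clinear_diff[OF clinear_chi_mult] clinear_neg[OF clinear_chi_mult]
  clinear_scale[OF clinear_chi_mult] clinear_zero[OF clinear_chi_mult]
  clinear_add[OF clinear_chi_deriv] clinear_diff[OF clinear_chi_deriv] clinear_neg[OF clinear_chi_deriv]
  clinear_scale[OF clinear_chi_deriv] clinear_zero[OF clinear_chi_deriv]
  clinear_add[OF clinear_gamma_mult] clinear_diff[OF clinear_gamma_mult] clinear_neg[OF clinear_gamma_mult]
  clinear_scale[OF clinear_gamma_mult] clinear_zero[OF clinear_gamma_mult]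
  clinear_add[OF clinear_eta_mult] clinear_diff[OF clinear_eta_mult] clinear_neg[OF clinear_eta_mult]
  clinear_scale[OF clinear_eta_mult] clinear_zero[OF clinear_eta_mult]
  clinear_add[OF clinear_eta_deriv] clinear_diff[OF clinear_eta_deriv] clinear_neg[OF clinear_eta_deriv]
  clinear_scale[OF clinear_eta_deriv] clinear_zero[OF clinear_eta_deriv]

lemma coeff_map_linear_simps:
  assumes "clinear f"
  shows "coeff_map k f (p + q) = coeff_map k f p + coeff_map k f q"
    "coeff_map k f (p - q) = coeff_map k f p - coeff_map k f q"
    "coeff_map k f (- p) = - coeff_map k f p"
    "coeff_map k f (c *\<^sub>C p) = c *\<^sub>C coeff_map k f p"
    "coeff_map k f 0 = 0"
  using clinear_coeff_map[OF assms, of k]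
  by (simp_all add: clinear_add clinear_diff clinear_neg clinear_scale clinear_zero)

section \<open>The action of the odd derivations on polynomials\<close>

lemma clinear_lam_oder: "clinear (oder M i) \<Longrightarrow> clinear (lam_oder M i)"
  unfolding lam_oder_def
  by (intro clinear_intros clinear_comp[OF clinear_lam_mult] ops_linear clinear_coeff_map)

lemma lam_oder_lam_mult:
  assumes "clinear (oder M i)"
  shows "lam_oder M i (lam_mult x) = lam_mult (lam_oder M i x)"
  by (simp add: lam_oder_def coeff_map_lam_mult assms ops_linear_simps chi_deriv_lam_mult)

lemma lam_oder_lam_der:
  assumes "clinear (oder M i)" "clinear (der M)" "\<And>a. oder M i (der M a) = der M (oder M i a)" "finite_lam x"
  shows "lam_oder M i (lam_der M x) = lam_der M (lam_oder M i x)"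
  by (simp add: lam_oder_def lam_der_def coeff_map_coeff_map assms clinear_zero coeff_map_linear_simps
      coeff_map_lam_mult coeff_map_chi_deriv)

lemma lam_oder_chi_mult:
  assumes "clinear (oder M i)" "i \<noteq> j" "finite_lam x"
  shows "lam_oder M i (chi_mult j x) = - chi_mult j (lam_oder M i x)"
  by (simp add: lam_oder_def coeff_map_chi_mult assms ops_linear_simps chi_deriv_chi_mult lam_mult_chi_mult)

text \<open>In the sum of both orders the mixed terms cancel in pairs, since a map of parity 1 on
  the coefficients anticommutes with \<partial>/\<partial>\<chi>; the two kinds of pure terms
  anticommute separately.\<close>

lemma lam_oder_anticomm:
  assumes lin: "clinear (oder M i)" "clinear (oder M j)" and ij: "i \<noteq> j" and x: "finite_lam x"
    and anti: "\<And>a. oder M i (oder M j a) = - oder M j (oder M i a)"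
  shows "lam_oder M i (lam_oder M j x) = - lam_oder M j (lam_oder M i x)"
proof -
  have "coeff_map 1 (oder M i) (coeff_map 1 (oder M j) x) =
      - coeff_map 1 (oder M j) (coeff_map 1 (oder M i) x)"
    by (simp add: coeff_map_coeff_map lin clinear_zero anti coeff_map_neg clinear_comp)
  then show ?thesis
    by (simp add: lam_oder_def lin coeff_map_linear_simps coeff_map_lam_mult coeff_map_chi_deriv x
        ops_linear_simps chi_deriv_lam_mult chi_deriv_anticomm[OF ij] cvec.scale_right_distrib cvec.scale_right_diff_distrib)
qed

lemma chi_deriv_above: "lam_below k x \<Longrightarrow> i \<notin> {1..k} \<Longrightarrow> chi_deriv i x = 0"
  by (erule chi_deriv_zero) auto

lemma chi_deriv_chi_mult_above: "lam_below k x \<Longrightarrow> i \<notin> {1..k} \<Longrightarrow> chi_deriv i (chi_mult i x) = x"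
  by (erule chi_deriv_chi_mult_self) auto

lemma lam_oder_above:
  "lam_below k x \<Longrightarrow> i \<notin> {1..k} \<Longrightarrow> lam_oder M i x = coeff_map (Suc 0) (oder M i) x"
  by (simp add: lam_oder_def chi_deriv_above ops_linear_simps)

lemma lam_oder_chi_mult_above:
  assumes "lam_below k x" "i \<notin> {1..k}" "clinear (oder M i)"
  shows "lam_oder M i (chi_mult i x) = - chi_mult i (coeff_map (Suc 0) (oder M i) x) + 2 *\<^sub>C lam_mult x"
  using assms by (simp add: lam_oder_def chi_deriv_chi_mult_above coeff_map_chi_mult lam_below_finite)

section \<open>Adjoining one odd derivation\<close>

text \<open>The bracket has parity \<open>k\<close>, whence the sign of moving the odd operator past
  it. The left side acts on coefficients alone: for the indices \<open>i > k\<close> at which this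
  is used, \<chi>^i is not a variable of the bracket, so the correction term in
  \<open>lam_oder\<close> has nothing to act on.\<close>

definition odd_bracket_derivation :: "nat \<Rightarrow> ('a::complex_vector, 'z) susy_lca_scheme \<Rightarrow> nat \<Rightarrow> bool" where
  "odd_bracket_derivation k U i \<longleftrightarrow> (\<forall>p. \<forall>a\<in>part U p. \<forall>b.
     coeff_map 1 (oder U i) (lbr U a b) =
       (- 1) ^ k *\<^sub>C (lbr U (oder U i a) b + (- 1) ^ p *\<^sub>C lbr U a (oder U i b)))"

text \<open>
  The coefficient of \<open>\<chi>\<^sup>k\<^sup>+\<^sup>1\<close> has to be the old bracket, and sesquilinearity for \<open>D\<^sup>k\<^sup>+\<^sup>1\<close> then forces
  the remaining term.
\<close>

definition extended_bracket :: "nat \<Rightarrow> ('a::complex_vector, 'z) susy_lca_scheme \<Rightarrow> 'a \<Rightarrow> 'a \<Rightarrow> 'a lam" where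
  "extended_bracket k U a b = chi_mult (Suc k) (lbr U a b) + (- 1) ^ k *\<^sub>C lbr U (oder U (Suc k) a) b"

definition extend_bracket :: "nat \<Rightarrow> 'a::complex_vector susy_va \<Rightarrow> 'a susy_va" where
  "extend_bracket k U = U\<lparr>lbr := extended_bracket k U\<rparr>"

lemma extend_bracket_simps [simp]:
  "even_part (extend_bracket k U) = even_part U"
  "odd_part (extend_bracket k U) = odd_part U"
  "part (extend_bracket k U) = part U"
  "der (extend_bracket k U) = der U"
  "oder (extend_bracket k U) = oder U"
  "lbr (extend_bracket k U) = extended_bracket k U"
  "vac (extend_bracket k U) = vac U"
  "nop (extend_bracket k U) = nop U"
  "lam_der (extend_bracket k U) = lam_der U"
  "lam_oder (extend_bracket k U) = lam_oder U"
  by (simp_all add: extend_bracket_def part_def fun_eq_iff lam_der_def lam_oder_def)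

lemma part_cong: "even p \<longleftrightarrow> even q \<Longrightarrow> part M p = part M q"
  by (simp add: part_def)

lemma part_Suc_Suc [simp]: "part M (Suc (Suc p)) = part M p"
  by (rule part_cong) simp

text \<open>The bracket lives at level \<open>k\<close>, whereas \<open>ud\<close> is at level
  \<open>Suc k\<close>: the operator \<open>D\<close> to be adjoined already satisfies the relations
  and differentiates the product. Linearity is asked of every \<open>oder U i\<close> because the
  operators substituted in \<open>bracket_neg\<close> are indexed by all natural numbers.\<close>

locale susy_step =
  fixes k :: nat and U :: "'a::complex_vector susy_va"
  assumes va: "susy_vertex_algebra k U"
    and ud: "unital_diff_superalgebra (Suc k) U (vac U) (nop U)"
    and oder_linear: "clinear (oder U i)"
    and bracket_deriv: "odd_bracket_derivation k U (Suc k)"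
begin

abbreviation "D \<equiv> oder U (Suc k)"
abbreviation "E x \<equiv> coeff_map (Suc 0) D x"

lemma lca: "susy_lie_conformal_algebra k U"
  using va by (simp add: susy_vertex_algebra_def)

lemma nm: "is_nabla_module (Suc k) U"
  using ud by (simp add: unital_diff_superalgebra_def)

lemma der_linear: "clinear (der U)"
  and subspace_part: "cvec.subspace (part U p)"
  using nm by (auto simp: is_nabla_module_def)

lemma D_part: "a \<in> part U p \<Longrightarrow> D a \<in> part U (Suc p)"
  using nm by (auto simp: is_nabla_module_def)

lemma oder_sq: "i \<in> {1..Suc k} \<Longrightarrow> oder U i (oder U i a) = der U a"
proof -
  assume "i \<in> {1..Suc k}"
  then have "oder U i (oder U i a) + oder U i (oder U i a) = 2 *\<^sub>C der U a"
    using nm by (auto simp: is_nabla_module_def)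
  then have "2 *\<^sub>C oder U i (oder U i a) = 2 *\<^sub>C der U a"
    by (metis one_add_one scaleC_add_left scaleC_one)
  then show ?thesis
    by simp
qed

lemma oder_anticomm:
  "i \<in> {1..Suc k} \<Longrightarrow> j \<in> {1..Suc k} \<Longrightarrow> i \<noteq> j \<Longrightarrow> oder U i (oder U j a) = - oder U j (oder U i a)"
  using nm by (auto simp: is_nabla_module_def eq_neg_iff_add_eq_0)

lemma oder_der: "i \<in> {1..Suc k} \<Longrightarrow> oder U i (der U a) = der U (oder U i a)"
  using nm by (auto simp: is_nabla_module_def)

lemmas br_linear_right = lbr_linear_right[OF lca]
  and br_linear_left = lbr_linear_left[OF lca]
  and br_below = lbr_below[OF lca]
  and br_finite = lbr_finite[OF lca]
  and br_part = lbr_part[OF lca]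
  and br_der_left = lbr_der_left[OF lca]
  and br_der_right = lbr_der_right[OF lca]
  and br_oder_left = lbr_oder_left[OF lca]
  and br_oder_right = lbr_oder_right[OF lca]
  and br_skew = lbr_skew[OF lca]
  and br_jacobi = lbr_jacobi[OF lca]
  and br_simps = lbr_simps[OF lca]

lemma E_br:
  "a \<in> part U p \<Longrightarrow> E (lbr U a b) = (- 1) ^ k *\<^sub>C (lbr U (D a) b + (- 1) ^ p *\<^sub>C lbr U a (D b))"
  using bracket_deriv by (simp add: odd_bracket_derivation_def)

lemma br_D_right:
  assumes "a \<in> part U p"
  shows "lbr U a (D b) = (- 1) ^ p *\<^sub>C ((- 1) ^ k *\<^sub>C E (lbr U a b) - lbr U (D a) b)"
  by (simp add: E_br[OF assms] minus_one_power_iff)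

lemma D_D: "D (D a) = der U a"
  by (rule oder_sq) simp

section \<open>Support, parity and sesquilinearity of the extended bracket\<close>

lemma clinear_extended_left: "clinear (\<lambda>a. extended_bracket k U a b)"
  unfolding extended_bracket_def
  by (intro clinear_intros clinear_comp[OF clinear_chi_mult] br_linear_left
      clinear_comp[OF br_linear_left] oder_linear)

lemma clinear_extended_right: "clinear (extended_bracket k U a)"
proof -
  have "clinear (\<lambda>b. chi_mult (Suc k) (lbr U a b) + (- 1) ^ k *\<^sub>C lbr U (D a) b)"
    by (intro clinear_intros clinear_comp[OF clinear_chi_mult] br_linear_right)
  then show ?thesis
    by (simp add: extended_bracket_def[abs_def])
qed

lemma extended_below: "lam_below (Suc k) (extended_bracket k U a b)"
proof -
  have "lam_below (Suc k) (lbr U a b)" for a b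
    using br_below by (rule lam_supp_mono) auto
  then show ?thesis
    unfolding extended_bracket_def
    by (intro lam_supp_add lam_supp_scale lam_below_chi_mult) auto
qed

lemma lookup_chi_mult_part:
  assumes "lam_below k x" "\<And>m I. Poly_Mapping.lookup x (m, I) \<in> part U (r + card I)"
  shows "Poly_Mapping.lookup (chi_mult (Suc k) x) (m, I) \<in> part U (Suc r + card I)"
proof (rule lam_induct[where p = x])
  note sub = cvec.subspace_add[OF subspace_part] cvec.subspace_0[OF subspace_part]
    cvec.subspace_scale[OF subspace_part]
  show "Poly_Mapping.lookup (chi_mult (Suc k) (p + q)) (m, I) \<in> part U (Suc r + card I)"
    if "Poly_Mapping.lookup (chi_mult (Suc k) p) (m, I) \<in> part U (Suc r + card I)"
      "Poly_Mapping.lookup (chi_mult (Suc k) q) (m, I) \<in> part U (Suc r + card I)" for p q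
    using that by (simp add: ops_linear_simps lookup_add sub)
  show "Poly_Mapping.lookup (chi_mult (Suc k) 0) (m, I) \<in> part U (Suc r + card I)"
    by (simp add: ops_linear_simps sub)
  fix m' J v
  assume mJ: "(m', J) \<in> Poly_Mapping.keys x" "v = Poly_Mapping.lookup x (m', J)"
  then have "J \<subseteq> {1..k}"
    using lam_suppD[OF assms(1)] by simp
  then have J: "finite J" "Suc k \<notin> J"
    using finite_subset[of J "{1..k}"] by auto
  have "v \<in> part U (Suc r + card (insert (Suc k) J))"
    using assms(2)[of m' J] mJ J by simp
  then show "Poly_Mapping.lookup (chi_mult (Suc k) (monom_lam m' J v)) (m, I) \<in> part U (Suc r + card I)"
    using J by (auto simp: chi_mult_monom lookup_scaleC lookup_single when_def sub)
qed

lemma extended_part: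
  assumes a: "a \<in> part U p" and b: "b \<in> part U q"
  shows "Poly_Mapping.lookup (extended_bracket k U a b) (m, I) \<in> part U (p + q + Suc k + card I)"
proof -
  have "Poly_Mapping.lookup (chi_mult (Suc k) (lbr U a b)) (m, I) \<in> part U (Suc (p + q + k) + card I)"
    using br_part[OF a b] by (intro lookup_chi_mult_part br_below) simp
  moreover have "Poly_Mapping.lookup (lbr U (D a) b) (m, I) \<in> part U (Suc p + q + k + card I)"
    by (rule br_part[OF D_part[OF a] b])
  ultimately show ?thesis
    by (simp add: extended_bracket_def lookup_add lookup_scaleC cvec.subspace_add[OF subspace_part]
        cvec.subspace_scale[OF subspace_part])
qed

lemma extended_der_left: "extended_bracket k U (der U a) b = - lam_mult (extended_bracket k U a b)"
  by (simp add: extended_bracket_def oder_der br_der_left ops_linear_simps lam_mult_chi_mult)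

lemma extended_der_right:
  "extended_bracket k U a (der U b) = lam_der U (extended_bracket k U a b) + lam_mult (extended_bracket k U a b)"
  by (simp add: extended_bracket_def br_der_right ops_linear_simps lam_mult_chi_mult lam_der_def
      coeff_map_linear_simps der_linear coeff_map_chi_mult br_finite cvec.scale_right_distrib)

text \<open>For the new index, \<open>D\<close> exchanges the two summands up to multiplication by
  \<chi>: the second becomes \<open>[D(Da), b] = [\<partial>a, b] = -\<lambda>[a, b]\<close>, which
  is \<chi>\<chi>\<open>[a, b]\<close>. For an old index the extra sign comes from the anticommuting
  pairs \<chi> and \<chi>^i, \<open>D\<close> and \<open>oder U i\<close>.\<close>

lemma extended_oder_left:
  assumes "i \<in> {1..Suc k}"
  shows "extended_bracket k U (oder U i a) b = (- 1) ^ (Suc k + 1) *\<^sub>C chi_mult i (extended_bracket k U a b)"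
proof (cases "i = Suc k")
  case True
  then show ?thesis
    by (simp add: extended_bracket_def D_D br_der_left ops_linear_simps chi_mult_sq
        cvec.scale_right_diff_distrib)
next
  case False
  then have i: "i \<in> {1..k}"
    using assms by auto
  have "D (oder U i a) = - oder U i (D a)"
    using i by (intro oder_anticomm) auto
  then show ?thesis
    using False by (simp add: extended_bracket_def br_simps br_oder_left[OF i] ops_linear_simps
        chi_mult_anticomm[of i "Suc k"] minus_one_power_iff)
qed

text \<open>For the new index, moving \<open>D\<close> past \<chi> gives 2\<lambda> and the square
  of \<chi> gives -\<lambda>. The remaining \<lambda> is matched on the other side by
  \<open>[D(Da), b] = -\<lambda>[a, b]\<close>, which appears when \<open>[Da, Db]\<close> is
  expanded by the derivation rule.\<close>

lemma extended_oder_right: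
  assumes i: "i \<in> {1..Suc k}" and a: "a \<in> part U p"
  shows "extended_bracket k U a (oder U i b) = (- 1) ^ (p + Suc k) *\<^sub>C
     (lam_oder U i (extended_bracket k U a b) + chi_mult i (extended_bracket k U a b))"
proof (cases "i = Suc k")
  case True
  have "lam_oder U (Suc k) (chi_mult (Suc k) (lbr U a b)) =
      - chi_mult (Suc k) (E (lbr U a b)) + 2 *\<^sub>C lam_mult (lbr U a b)"
    by (rule lam_oder_chi_mult_above[OF br_below]) (simp_all add: oder_linear)
  moreover have "lam_oder U (Suc k) (lbr U (D a) b) = E (lbr U (D a) b)"
    by (rule lam_oder_above[OF br_below]) simp
  moreover have "2 *\<^sub>C lam_mult (lbr U a b) = lam_mult (lbr U a b) + lam_mult (lbr U a b)"
    by (metis one_add_one scaleC_add_left scaleC_one)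
  ultimately show ?thesis
    unfolding True extended_bracket_def
    by (simp add: br_D_right[OF a] br_D_right[OF D_part[OF a]] D_D br_der_left ops_linear_simps chi_mult_sq
      clinear_add[OF clinear_lam_oder[OF oder_linear]] clinear_scale[OF clinear_lam_oder[OF oder_linear]]
      minus_one_power_iff)
next
  case False
  then have i': "i \<in> {1..k}"
    using i by auto
  show ?thesis
    using False
    by (simp add: extended_bracket_def br_oder_right[OF i' a] br_oder_right[OF i' D_part[OF a]] ops_linear_simps
      clinear_add[OF clinear_lam_oder[OF oder_linear]] clinear_scale[OF clinear_lam_oder[OF oder_linear]]
      lam_oder_chi_mult oder_linear br_finite chi_mult_anticomm[of i "Suc k"] minus_one_power_iff)
qed

text \<open>The top variable is replaced by -\<open>D\<close> - \<chi>, which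
  \<open>lam_eval_chi_mult_top\<close> brings to the front. There \<open>D\<close> acts on
  coefficients alone, as \<open>E\<close>, because the substituted polynomial does not contain the
  new variable.\<close>

lemma bracket_neg_extended:
  "bracket_neg (extend_bracket k U) a b =
    - E (bracket_neg U a b) - chi_mult (Suc k) (bracket_neg U a b) + (- 1) ^ k *\<^sub>C bracket_neg U (D a) b"
proof -
  let ?L = "\<lambda>x. - lam_der U x - lam_mult x" and ?X = "\<lambda>i x. - lam_oder U i x - chi_mult i x"
  interpret substitution ?L ?X
    by (intro substitution_neg der_linear oder_linear)
  have closed: "finite_lam (?L x)" "finite_lam (?X i x)" if "finite_lam x" for i x
    using that by (auto simp: lam_der_def lam_oder_def intro!: finite_lam_intros)
  \<comment> \<open>For distinct indices all the pairs formed from \<open>D\<close> and \<chi>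
    anticommute; the commutator of \<open>D\<close> with \<chi> contributes only when the indices
    are equal.\<close>
  have anti: "?X i (?X (Suc k) x) = - ?X (Suc k) (?X i x)" if "i \<in> {1..k}" "finite_lam x" for i x
  proof -
    have "lam_oder U i (lam_oder U (Suc k) x) = - lam_oder U (Suc k) (lam_oder U i x)"
      using that by (intro lam_oder_anticomm oder_linear oder_anticomm) auto
    then show ?thesis
      using that by (simp add: clinear_diff[OF clinear_lam_oder[OF oder_linear]]
          clinear_neg[OF clinear_lam_oder[OF oder_linear]] ops_linear_simps
          lam_oder_chi_mult oder_linear chi_mult_anticomm[of i "Suc k"])
  qed
  have comm: "?L (?X (Suc k) x) = ?X (Suc k) (?L x)" if "finite_lam x" for x
  proof -
    have "lam_oder U (Suc k) (lam_der U x) = lam_der U (lam_oder U (Suc k) x)"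
      using that by (intro lam_oder_lam_der oder_linear der_linear oder_der) auto
    then show ?thesis
      using that by (simp add: clinear_diff[OF clinear_lam_oder[OF oder_linear]]
          clinear_neg[OF clinear_lam_oder[OF oder_linear]] ops_linear_simps lam_der_def
          coeff_map_linear_simps der_linear coeff_map_chi_mult lam_mult_chi_mult
          lam_oder_lam_mult oder_linear)
  qed
  have below: "lam_below k (lam_eval 1 ?L ?X const_lam (lbr U a b))"
    by (rule lam_supp_lam_eval[OF br_below])
      (auto simp: lam_der_def lam_oder_def intro!: lam_supp_monom lam_supp_diff lam_supp_uminus lam_supp_add
        lam_supp_scale lam_supp_coeff_map lam_supp_lam_mult lam_supp_chi_mult lam_supp_chi_deriv)
  have "bracket_neg (extend_bracket k U) a b =
      lam_eval 1 ?L ?X const_lam (chi_mult (Suc k) (lbr U a b) + (- 1) ^ k *\<^sub>C lbr U (D a) b)"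
    by (simp add: bracket_neg_eval extended_bracket_def)
  also have "\<dots> = lam_eval 1 ?L ?X const_lam (chi_mult (Suc k) (lbr U a b)) + (- 1) ^ k *\<^sub>C bracket_neg U (D a) b"
    by (simp add: bracket_neg_eval clinear_add[OF clinear_lam_eval[OF clinear_single]]
        clinear_scale[OF clinear_lam_eval[OF clinear_single]])
  also have "lam_eval 1 ?L ?X const_lam (chi_mult (Suc k) (lbr U a b)) =
      1 *\<^sub>C ?X (Suc k) (lam_eval 1 ?L ?X const_lam (lbr U a b))"
    by (rule lam_eval_chi_mult_top[where P = finite_lam, OF clinear_single br_below])
      (use closed comm anti in \<open>auto intro: lam_supp_monom\<close>)
  also have "\<dots> = - E (bracket_neg U a b) - chi_mult (Suc k) (bracket_neg U a b)"
    by (simp add: bracket_neg_eval lam_oder_above[OF below])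
  finally show ?thesis .
qed

text \<open>Skew-symmetry of the old bracket at \<open>(a, b)\<close> and \<open>(Da, b)\<close>
  yields \<open>[b, a]\<close> and \<open>[b, Da]\<close>. The derivation rule turns the latter into
  \<open>E[b, a]\<close> and \<open>[Db, a]\<close>, and the \<open>E\<close> terms cancel.\<close>

lemma extended_skew:
  assumes a: "a \<in> part U p" and b: "b \<in> part U q"
  shows "extended_bracket k U b a = (- 1) ^ (p * q + Suc k + 1) *\<^sub>C bracket_neg (extend_bracket k U) a b"
proof -
  have ab: "bracket_neg U a b = (- 1) ^ (p * q + k + 1) *\<^sub>C lbr U b a"
    using br_skew[OF a b] by (simp flip: power_add mult_2)
  have Dab: "bracket_neg U (D a) b = (- 1) ^ (Suc p * q + k + 1) *\<^sub>C lbr U b (D a)"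
    using br_skew[OF D_part[OF a] b] by (simp flip: power_add mult_2)
  show ?thesis
    unfolding bracket_neg_extended ab Dab extended_bracket_def br_D_right[OF b]
    by (simp add: ops_linear_simps coeff_map_linear_simps oder_linear minus_one_power_iff)
qed

section \<open>The Jacobi identity of the extended bracket\<close>

abbreviation "J x \<equiv> coeff_map 0 const_lam x"
abbreviation "chi Q \<equiv> chi_mult (Suc k) Q"
abbreviation "eta Q \<equiv> eta_mult (Suc k) Q"

lemma clinear_J: "clinear (\<lambda>v. J (lbr U a v))"
  by (intro clinear_comp[OF clinear_coeff_map] clinear_single br_linear_right)

text \<open>Each of the three nested brackets in the Jacobi identity is written through old nested
  brackets of \<open>a\<close> or \<open>Da\<close> with \<open>b\<close> or \<open>Db\<close>, so
  that the new identity becomes a combination of four old ones. Here \<open>chi\<close> comes from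
  the outer bracket and \<open>eta\<close> from the inner one.\<close>

lemma bracket_right_extended:
  "bracket_right (Suc k) (extend_bracket k U) p a b c =
     (- 1) ^ (p + Suc k) *\<^sub>C eta (chi (bracket_right k U p a b c)
       + (- 1) ^ k *\<^sub>C bracket_right k U (Suc p) (D a) b c)
     + (- 1) ^ k *\<^sub>C (chi (bracket_right k U p a (D b) c)
       + (- 1) ^ k *\<^sub>C bracket_right k U (Suc p) (D a) (D b) c)"
proof -
  interpret substitution gamma_mult eta_mult
    by (rule substitution_gamma)
  let ?g = "\<lambda>v. chi (J (lbr U a v)) + (- 1) ^ k *\<^sub>C J (lbr U (D a) v)"
  let ?A = "lam_eval ((- 1) ^ (p + Suc k)) gamma_mult eta_mult ?g"
  have g: "clinear ?g"
    by (intro clinear_intros clinear_comp[OF clinear_chi_mult] clinear_J)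
  have "J (extended_bracket k U a v) = ?g v" for v
    by (simp add: extended_bracket_def coeff_map_linear_simps clinear_single coeff_map_chi_mult br_finite)
  then have "bracket_right (Suc k) (extend_bracket k U) p a b c = ?A (extended_bracket k U b c)"
    by (simp add: bracket_right_eval)
  also have "\<dots> = ?A (chi (lbr U b c)) + (- 1) ^ k *\<^sub>C ?A (lbr U (D b) c)"
    by (simp only: extended_bracket_def clinear_add[OF clinear_lam_eval[OF g]]
        clinear_scale[OF clinear_lam_eval[OF g]])
  also have "?A (chi (lbr U b c)) = (- 1) ^ (p + Suc k) *\<^sub>C eta (?A (lbr U b c))"
    by (rule lam_eval_chi_mult_top[where P = "\<lambda>_. True", OF g br_below])
      (auto simp: gamma_mult_eta_mult intro: eta_mult_anticomm)
  finally have eq: "bracket_right (Suc k) (extend_bracket k U) p a b c =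
      (- 1) ^ (p + Suc k) *\<^sub>C eta (?A (lbr U b c)) + (- 1) ^ k *\<^sub>C ?A (lbr U (D b) c)" .
  \<comment> \<open>Pulling \<open>chi\<close> out changes the sign per odd variable back to
    \<open>(-1)^(p + k)\<close>; for the second summand \<open>(-1)^(p + Suc k)\<close> is already
    the sign that belongs to \<open>Da\<close>.\<close>
  have A: "?A (lbr U b c) = chi (bracket_right k U p a b c) + (- 1) ^ k *\<^sub>C bracket_right k U (Suc p) (D a) b c"
    for b
  proof -
    have "lam_eval ((- 1) ^ (p + Suc k)) gamma_mult eta_mult (\<lambda>v. chi (J (lbr U a v))) (lbr U b c) =
        chi (lam_eval ((- 1) ^ (p + Suc k) * - 1) gamma_mult eta_mult (\<lambda>v. J (lbr U a v)) (lbr U b c))"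
      by (rule lam_eval_intertwine[where P = finite_lam, OF clinear_chi_mult br_below])
        (auto simp: gamma_mult_chi_mult eta_mult_chi_mult intro: finite_lam_intros br_finite)
    then show ?thesis
      by (simp add: lam_eval_plus lam_eval_scaled bracket_right_eval)
  qed
  show ?thesis
    unfolding eq A ..
qed

lemma coeff_map_extended:
  "coeff_map (q + Suc k) (extended_bracket k U b) x =
     eta (coeff_map (q + k) (lbr U b) x) + (- 1) ^ k *\<^sub>C coeff_map (Suc q + k) (lbr U (D b)) x"
proof -
  have "coeff_map (q + Suc k) (extended_bracket k U b) x =
      coeff_map (q + Suc k) (\<lambda>v. chi_mult (Suc k) (lbr U b v)) x
      + coeff_map (q + Suc k) (\<lambda>v. (- 1) ^ k *\<^sub>C lbr U (D b) v) x"
    unfolding extended_bracket_def[abs_def]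
    by (intro coeff_map_add clinear_intros clinear_comp[OF clinear_chi_mult] br_linear_right)
  then show ?thesis
    by (simp add: eta_mult_def coeff_map_coeff_map clinear_zero ops_linear br_linear_right coeff_map_scale)
qed

text \<open>The outer variables come here from the inner bracket of \<open>a\<close> and
  \<open>c\<close>, so \<open>chi\<close> has to pass the bracket with \<open>b\<close> and takes
  the sign \<open>(-1)^(q + Suc k)\<close>.\<close>

lemma bracket_right_swap_extended:
  "bracket_right_swap (Suc k) (extend_bracket k U) q b a c =
     (- 1) ^ (q + Suc k) *\<^sub>C chi (eta (bracket_right_swap k U q b a c)
       + (- 1) ^ k *\<^sub>C bracket_right_swap k U (Suc q) (D b) a c)
     + (- 1) ^ k *\<^sub>C (eta (bracket_right_swap k U q b (D a) c)
       + (- 1) ^ k *\<^sub>C bracket_right_swap k U (Suc q) (D b) (D a) c)"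
proof -
  have "bracket_right_swap (Suc k) (extend_bracket k U) q b a c =
      coeff_map (q + Suc k) (extended_bracket k U b) (chi_mult (Suc k) (lbr U a c) + (- 1) ^ k *\<^sub>C lbr U (D a) c)"
    by (simp add: bracket_right_swap_def extended_bracket_def)
  also have "\<dots> = (- 1) ^ (q + Suc k) *\<^sub>C chi (coeff_map (q + Suc k) (extended_bracket k U b) (lbr U a c))
      + (- 1) ^ k *\<^sub>C coeff_map (q + Suc k) (extended_bracket k U b) (lbr U (D a) c)"
    by (simp only: coeff_map_linear_simps[OF clinear_extended_right]
        coeff_map_chi_mult[OF clinear_extended_right br_finite])
  finally show ?thesis
    by (simp only: coeff_map_extended bracket_right_swap_def)
qed

abbreviation "sum_eval c v \<equiv> lam_eval 1 (\<lambda>x. lam_mult x + gamma_mult x) (\<lambda>i x. chi_mult i x + eta_mult i x)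
  (\<lambda>w. const_lam (const_lam w)) (lbr U v c)"
abbreviation "left_eval c x \<equiv> lam_eval ((- 1) ^ k) lam_mult chi_mult (sum_eval c) x"

lemma clinear_const_const: "clinear (\<lambda>w. const_lam (const_lam w))"
  by (intro clinear_comp[OF clinear_single] clinear_single)

lemma clinear_sum_eval: "clinear (sum_eval c)"
  by (rule clinear_comp[OF substitution.clinear_lam_eval[OF substitution_sum clinear_const_const] br_linear_left])

lemma clinear_left_eval: "clinear (left_eval c)"
  by (rule substitution.clinear_lam_eval[OF substitution_lam clinear_sum_eval])

lemma left_eval_lam_mult: "left_eval c (lam_mult x) = lam_mult (left_eval c x)"
  by (rule substitution.lam_eval_lam_mult[OF substitution_lam clinear_sum_eval])

lemma finite_sum_eval: "finite_lam (sum_eval c v)"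
  by (rule lam_supp_lam_eval[OF br_below]) (auto intro: finite_lam_intros lam_supp_monom)

text \<open>Evaluated at \<Lambda> + \<Gamma>, the new variable becomes
  \<open>chi + eta\<close>.\<close>

lemma sum_eval_extended:
  "lam_eval 1 (\<lambda>x. lam_mult x + gamma_mult x) (\<lambda>i x. chi_mult i x + eta_mult i x)
    (\<lambda>w. const_lam (const_lam w)) (extended_bracket k U v c) =
   chi (sum_eval c v) + eta (sum_eval c v) + (- 1) ^ k *\<^sub>C sum_eval c (D v)"
proof -
  let ?L = "\<lambda>x::'a lam lam. lam_mult x + gamma_mult x"
    and ?X = "\<lambda>i (x::'a lam lam). chi_mult i x + eta_mult i x"
  interpret substitution ?L ?X
    by (rule substitution_sum)
  have "lam_eval 1 ?L ?X (\<lambda>w. const_lam (const_lam w)) (chi_mult (Suc k) (lbr U v c)) =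
      1 *\<^sub>C ?X (Suc k) (sum_eval c v)"
    by (rule lam_eval_chi_mult_top[where P = finite_lam, OF clinear_const_const br_below])
      (auto intro: finite_lam_intros lam_supp_monom simp: ops_linear_simps lam_mult_chi_mult
        eta_mult_lam_mult gamma_mult_chi_mult gamma_mult_eta_mult eta_mult_chi_mult
        chi_mult_anticomm[of _ "Suc k"] eta_mult_anticomm[of _ "Suc k"])
  then show ?thesis
    by (simp add: extended_bracket_def clinear_add[OF clinear_lam_eval[OF clinear_const_const]]
        clinear_scale[OF clinear_lam_eval[OF clinear_const_const]])
qed

text \<open>\<open>D\<close> acting on the inner bracket is expanded by the derivation rule, so that
  only \<open>Da\<close> and \<open>Db\<close> remain. The terms with \<open>chi\<close> in front of
  \<open>[[Da, b], c]\<close> cancel, and so do the \<lambda> from the square of \<open>chi\<close>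
  and the \<lambda> from \<open>D(Da) = \<partial>a\<close>.\<close>

lemma bracket_left_sum_extended:
  assumes a: "a \<in> part U p"
  shows "bracket_left_sum (Suc k) (extend_bracket k U) a b c =
     (- 1) ^ k *\<^sub>C (- chi (eta (bracket_left_sum k U a b c))
       - (- 1) ^ p *\<^sub>C chi (bracket_left_sum k U a (D b) c)
       + eta (bracket_left_sum k U (D a) b c)
       - (- 1) ^ p *\<^sub>C bracket_left_sum k U (D a) (D b) c)"
proof -
  interpret substitution "lam_mult :: 'a lam lam \<Rightarrow> _" chi_mult
    by (rule substitution_lam)
  let ?T = "\<lambda>x. chi x + eta x"
  let ?g = "\<lambda>v. ?T (sum_eval c v) + (- 1) ^ k *\<^sub>C sum_eval c (D v)"
  let ?C = "lam_eval ((- 1) ^ Suc k) lam_mult chi_mult ?g"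
  have g: "clinear ?g"
    by (intro clinear_intros clinear_comp[OF clinear_chi_mult] clinear_comp[OF clinear_eta_mult]
        clinear_comp[OF clinear_sum_eval] clinear_sum_eval oder_linear)
  have T: "clinear ?T"
    by (intro clinear_intros ops_linear)
  have "bracket_left_sum (Suc k) (extend_bracket k U) a b c = ?C (extended_bracket k U a b)"
    by (simp only: bracket_left_sum_eval extend_bracket_simps sum_eval_extended)
  also have "\<dots> = ?C (chi_mult (Suc k) (lbr U a b)) + (- 1) ^ k *\<^sub>C ?C (lbr U (D a) b)"
    by (simp only: extended_bracket_def clinear_add[OF clinear_lam_eval[OF g]]
        clinear_scale[OF clinear_lam_eval[OF g]])
  also have "?C (chi_mult (Suc k) (lbr U a b)) = (- 1) ^ Suc k *\<^sub>C chi (?C (lbr U a b))"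
    by (rule lam_eval_chi_mult_top[where P = "\<lambda>_. True", OF g br_below])
      (auto simp: lam_mult_chi_mult intro: chi_mult_anticomm)
  finally have eq: "bracket_left_sum (Suc k) (extend_bracket k U) a b c =
      (- 1) ^ Suc k *\<^sub>C chi (?C (lbr U a b)) + (- 1) ^ k *\<^sub>C ?C (lbr U (D a) b)" .
  have C: "?C x = ?T (left_eval c x) + (- 1) ^ k *\<^sub>C left_eval c (E x)" if x: "lam_below k x" for x
  proof -
    have "lam_eval ((- 1) ^ Suc k) lam_mult chi_mult (\<lambda>v. ?T (sum_eval c v)) x =
        ?T (lam_eval ((- 1) ^ Suc k * - 1) lam_mult chi_mult (sum_eval c) x)"
      by (rule lam_eval_intertwine[where P = finite_lam, OF T x])
        (auto simp: ops_linear_simps lam_mult_chi_mult eta_mult_lam_mult eta_mult_chi_mult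
          chi_mult_anticomm[of _ "Suc k"] intro: finite_lam_intros finite_sum_eval)
    moreover have "left_eval c (E x) = lam_eval ((- 1) ^ Suc k) lam_mult chi_mult (\<lambda>v. sum_eval c (D v)) x"
      by (simp add: lam_eval_coeff_map[OF clinear_sum_eval oder_linear])
    ultimately show ?thesis
      by (simp add: lam_eval_plus lam_eval_scaled)
  qed
  have left: "left_eval c (lbr U a b) = bracket_left_sum k U a b c" for a b
    by (simp add: bracket_left_sum_eval)
  show ?thesis
    unfolding eq C[OF br_below] E_br[OF a] E_br[OF D_part[OF a]] D_D br_der_left
      clinear_add[OF clinear_left_eval] clinear_scale[OF clinear_left_eval]
      clinear_neg[OF clinear_left_eval] left_eval_lam_mult left
    by (simp add: ops_linear_simps chi_mult_sq minus_one_power_iff)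
qed

text \<open>After the old identities for \<open>(a, b)\<close>, \<open>(Da, b)\<close>,
  \<open>(a, Db)\<close> and \<open>(Da, Db)\<close> are inserted, the only reordering left is that
  \<open>chi\<close> and \<open>eta\<close> anticommute; the finiteness of index sets which this
  requires is supplied first.\<close>

lemma extended_jacobi:
  assumes a: "a \<in> part U p" and b: "b \<in> part U q"
  shows "bracket_right (Suc k) (extend_bracket k U) p a b c =
    (- 1) ^ ((p + 1) * Suc k) *\<^sub>C bracket_left_sum (Suc k) (extend_bracket k U) a b c
    + (- 1) ^ ((p + Suc k) * (q + Suc k)) *\<^sub>C bracket_right_swap (Suc k) (extend_bracket k U) q b a c"
proof -
  have fin: "finite_lam (bracket_left_sum k U a b c)" "finite_lam (bracket_right_swap k U q b a c)" for a b q
  proof -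
    show "finite_lam (bracket_left_sum k U a b c)"
      unfolding bracket_left_sum_eval
      by (rule lam_supp_lam_eval[OF br_below]) (auto intro: finite_lam_intros finite_sum_eval)
    show "finite_lam (bracket_right_swap k U q b a c)"
      unfolding bracket_right_swap_def by (intro lam_supp_coeff_map br_finite)
  qed
  note D = D_part[OF a] D_part[OF b]
  show ?thesis
    unfolding bracket_right_extended bracket_right_swap_extended bracket_left_sum_extended[OF a]
      br_jacobi[OF a b] br_jacobi[OF D(1) b] br_jacobi[OF a D(2)] br_jacobi[OF D]
    by (simp add: ops_linear_simps eta_mult_chi_mult fin minus_one_power_iff)
qed

section \<open>The remaining vertex algebra axioms for the extended bracket\<close>

lemma chi_deriv_extended: "chi_deriv (Suc k) (extended_bracket k U a b) = lbr U a b"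
  by (simp add: extended_bracket_def ops_linear_simps chi_deriv_chi_mult_above[OF br_below]
      chi_deriv_above[OF br_below])

text \<open>The derivative in the new variable acts first and returns the old bracket. The integrals
  in quasi-commutativity and quasi-associativity see only the \<lambda>-bracket, hence do not
  change.\<close>

lemma lambda_bracket_extended: "lambda_bracket (Suc k) (extend_bracket k U) a b = lambda_bracket k U a b"
  by (simp add: lambda_bracket_def chi_derivs_def chi_deriv_extended)

lemma integral_neg_nabla_extended: "integral_neg_nabla (Suc k) (extend_bracket k U) a b = integral_neg_nabla k U a b"
  by (simp add: integral_neg_nabla_def lambda_bracket_extended)

lemma integral_nabla_extended: "integral_nabla (Suc k) (extend_bracket k U) a b c = integral_nabla k U a b c"
  by (simp add: integral_nabla_def lambda_bracket_extended)

end

lemma eta_derivs_chi_mult: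
  assumes "finite_lam Q"
  shows "foldr eta_deriv xs (chi_mult j Q) = (- 1) ^ length xs *\<^sub>C chi_mult j (foldr eta_deriv xs Q)"
proof (induction xs)
  case (Cons i xs)
  have "finite_lam (foldr eta_deriv xs Q)"
    by (rule foldr_closed) (auto intro: assms finite_lam_intros)
  then show ?case
    by (simp add: Cons ops_linear_simps eta_deriv_chi_mult)
qed simp

text \<open>The even part of the integral in \<open>wick_integral\<close>, separated from the odd
  derivatives because only the latter produce signs when moved past \<chi>.\<close>

definition gamma_integral :: "'a::complex_vector lam lam \<Rightarrow> 'a lam" where
  "gamma_integral = sum_terms (\<lambda>m J. sum_terms (\<lambda>k K v. (1 / of_nat (Suc k)) *\<^sub>C monom_lam (m + Suc k) J v))"

lemma wick_integral_eq:
  "wick_integral n R a b c =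
    gamma_integral (foldr eta_deriv [1..<Suc n] (coeff_map n (\<lambda>v. lbr R v c) (lbr R a b)))"
  by (simp add: wick_integral_def gamma_integral_def)

lemma clinear_inner_integral: "clinear (sum_terms (\<lambda>k K v. (1 / of_nat (Suc k)) *\<^sub>C monom_lam (m + Suc k) J v))"
  by (intro clinear_sum_terms clinear_scaled clinear_single)

lemma clinear_gamma_integral: "clinear gamma_integral"
  unfolding gamma_integral_def by (intro clinear_sum_terms clinear_inner_integral)

lemma chi_mult_inner_integral:
  "chi_mult i (sum_terms (\<lambda>k K v. (1 / of_nat (Suc k)) *\<^sub>C monom_lam (m + Suc k) I v) q) =
    place_sign i I *\<^sub>C (if i \<in> I
      then - sum_terms (\<lambda>k K v. (1 / of_nat (Suc k)) *\<^sub>C monom_lam (Suc m + Suc k) (I - {i}) v) q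
      else sum_terms (\<lambda>k K v. (1 / of_nat (Suc k)) *\<^sub>C monom_lam (m + Suc k) (insert i I) v) q)"
  by (rule lam_eqI[where p = q]; (intro clinear_intros clinear_comp[OF clinear_chi_mult] clinear_inner_integral)?)
    (simp add: sum_terms_monom clifford_simps mult.commute)

lemma gamma_integral_monom:
  "gamma_integral (monom_lam m I q) = sum_terms (\<lambda>k K v. (1 / of_nat (Suc k)) *\<^sub>C monom_lam (m + Suc k) I v) q"
  unfolding gamma_integral_def by (rule sum_terms_monom) (rule clinear_zero[OF clinear_inner_integral])

lemma gamma_integral_chi_mult: "gamma_integral (chi_mult i Q) = chi_mult i (gamma_integral Q)"
proof (rule lam_eqI[where p = Q])
  fix m I and q :: "'a lam"
  show "gamma_integral (chi_mult i (monom_lam m I q)) = chi_mult i (gamma_integral (monom_lam m I q))"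
    unfolding gamma_integral_monom chi_mult_inner_integral chi_mult_monom clinear_scale[OF clinear_gamma_integral]
    by (simp only: gamma_integral_monom clinear_neg[OF clinear_gamma_integral] split: if_split) simp
qed (intro clinear_comp[OF clinear_gamma_integral] clinear_comp[OF clinear_chi_mult] ops_linear
    clinear_gamma_integral)+

context susy_step
begin

text \<open>The derivative in the newest \<eta>, acting first, turns the outer new bracket into the
  old one. Carrying the newest \<chi> out costs \<open>(-1)^(k + 1)\<close> at the bracket,
  \<open>-1\<close> at this derivative and \<open>(-1)^k\<close> at the other \<open>k\<close>
  derivatives, altogether no sign.\<close>

lemma wick_integral_extended:
  "wick_integral (Suc k) (extend_bracket k U) a b c =
    chi_mult (Suc k) (wick_integral k U a b c) + (- 1) ^ k *\<^sub>C wick_integral k U (D a) b c"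
proof -
  let ?M = "coeff_map (Suc k) (\<lambda>v. extended_bracket k U v c)" and ?N = "coeff_map k (\<lambda>v. lbr U v c)"
  let ?F = "foldr eta_deriv [1..<Suc k]"
  have F: "clinear ?F"
    by (intro clinear_foldr clinear_eta_deriv)
  have M: "eta_deriv (Suc k) (?M x) = ?N x" for x
  proof -
    have "eta_deriv (Suc k) (?M x) = coeff_map (1 + Suc k) (\<lambda>v. lbr U v c) x"
      unfolding eta_deriv_def
      by (subst coeff_map_coeff_map)
        (simp_all add: clinear_zero[OF clinear_extended_left] clinear_zero[OF clinear_chi_deriv]
          clinear_chi_deriv chi_deriv_extended)
    also have "\<dots> = ?N x"
      by (rule arg_cong[where f = "\<lambda>g. g x"], rule coeff_map_parity) simp
    finally show ?thesis .
  qed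
  have fin: "finite_lam (?N (lbr U a b))" "finite_lam (?M (lbr U a b))" for a b
    by (intro lam_supp_coeff_map br_finite)+
  have "?M (extended_bracket k U a b) =
      (- 1) ^ Suc k *\<^sub>C chi_mult (Suc k) (?M (lbr U a b)) + (- 1) ^ k *\<^sub>C ?M (lbr U (D a) b)"
    by (subst (2) extended_bracket_def) (simp only: coeff_map_linear_simps[OF clinear_extended_left]
        coeff_map_chi_mult[OF clinear_extended_left br_finite])
  then have "eta_deriv (Suc k) (?M (extended_bracket k U a b)) =
      (- 1) ^ k *\<^sub>C chi_mult (Suc k) (?N (lbr U a b)) + (- 1) ^ k *\<^sub>C ?N (lbr U (D a) b)"
    by (simp add: ops_linear_simps eta_deriv_chi_mult fin M)
  moreover have "?F (chi_mult (Suc k) (?N (lbr U a b))) = (- 1) ^ k *\<^sub>C chi_mult (Suc k) (?F (?N (lbr U a b)))"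
    by (subst eta_derivs_chi_mult[OF fin(1)]) (simp del: upt_Suc)
  ultimately have "?F (eta_deriv (Suc k) (?M (extended_bracket k U a b))) =
      chi_mult (Suc k) (?F (?N (lbr U a b))) + (- 1) ^ k *\<^sub>C ?F (?N (lbr U (D a) b))"
    by (simp only: clinear_add[OF F] clinear_scale[OF F]) simp
  then show ?thesis
    by (simp add: wick_integral_eq clinear_add[OF clinear_gamma_integral]
        clinear_scale[OF clinear_gamma_integral] gamma_integral_chi_mult)
qed

text \<open>Once \<chi> is moved to the front, every term is \<chi> times its old value at
  \<open>a\<close> plus \<open>(-1)^k\<close> times its old value at \<open>Da\<close>, so the rule
  combines the old ones for \<open>a\<close> and \<open>Da\<close>.\<close>

lemma extended_wick:
  assumes a: "a \<in> part U p" and b: "b \<in> part U q"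
  shows "extended_bracket k U a (nop U b c) =
    coeff_map 0 (\<lambda>v. nop U v c) (extended_bracket k U a b)
    + (- 1) ^ ((p + Suc k) * q) *\<^sub>C coeff_map q (nop U b) (extended_bracket k U a c)
    + wick_integral (Suc k) (extend_bracket k U) a b c"
proof -
  have wick: "lbr U a (nop U b c) =
      coeff_map 0 (\<lambda>v. nop U v c) (lbr U a b)
      + (- 1) ^ ((p + k) * q) *\<^sub>C coeff_map q (nop U b) (lbr U a c) + wick_integral k U a b c"
    if "a \<in> part U p" for a p
    using va that b unfolding susy_vertex_algebra_def by blast
  have lin: "clinear (\<lambda>v. nop U v c)" "clinear (nop U b)"
    using ud by (simp_all add: unital_diff_superalgebra_def)
  show ?thesis
    unfolding extended_bracket_def wick_integral_extended wick[OF a] wick[OF D_part[OF a]]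
    by (simp add: ops_linear_simps coeff_map_linear_simps lin coeff_map_chi_mult br_finite minus_one_power_iff)
qed

theorem susy_vertex_algebra_extend_bracket: "susy_vertex_algebra (Suc k) (extend_bracket k U)"
proof -
  have "susy_lie_conformal_algebra (Suc k) (extend_bracket k U)"
    unfolding susy_lie_conformal_algebra_def extend_bracket_simps
  proof (intro conjI allI ballI)
    show "is_nabla_module (Suc k) (extend_bracket k U)"
      using nm by (simp add: is_nabla_module_def)
    show "Poly_Mapping.keys (extended_bracket k U a b) \<subseteq> UNIV \<times> Pow {1..Suc k}" for a b
      using extended_below by (simp add: lam_supp_def)
  qed (fact clinear_extended_left clinear_extended_right extended_der_left extended_der_right
      | (rule extended_part extended_oder_left extended_oder_right extended_skew extended_jacobi, assumption+))+
  moreover have "unital_diff_superalgebra (Suc k) (extend_bracket k U) (vac U) (nop U)"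
    using ud by (simp add: unital_diff_superalgebra_def is_nabla_module_def)
  ultimately show ?thesis
    using va extended_wick
    unfolding susy_vertex_algebra_def integral_neg_nabla_extended integral_nabla_extended extend_bracket_simps
    by simp
qed

text \<open>This keeps the induction going: \<open>oder U i\<close> anticommutes with
  \<open>D\<close> and passes the new \<chi> with a sign, so the derivation rules of the old bracket
  at \<open>a\<close> and at \<open>Da\<close> give the one for the new bracket.\<close>

lemma odd_bracket_derivation_extend_bracket:
  assumes i: "odd_bracket_derivation k U i" and "Suc k < i"
    and part: "\<And>p a. a \<in> part U p \<Longrightarrow> oder U i a \<in> part U (Suc p)"
    and anti: "\<And>a. D (oder U i a) = - oder U i (D a)"
  shows "odd_bracket_derivation (Suc k) (extend_bracket k U) i"
  unfolding odd_bracket_derivation_def extend_bracket_simps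
proof (intro allI ballI)
  fix p a b
  assume a: "a \<in> part U p"
  have i: "coeff_map (Suc 0) (oder U i) (lbr U a b) =
       (- 1) ^ k *\<^sub>C (lbr U (oder U i a) b + (- 1) ^ p *\<^sub>C lbr U a (oder U i b))"
    if "a \<in> part U p" for a p
    using i that by (simp add: odd_bracket_derivation_def)
  show "coeff_map 1 (oder U i) (extended_bracket k U a b) =
      (- 1) ^ Suc k *\<^sub>C (extended_bracket k U (oder U i a) b
        + (- 1) ^ p *\<^sub>C extended_bracket k U a (oder U i b))"
    unfolding extended_bracket_def anti
    by (simp add: ops_linear_simps coeff_map_linear_simps oder_linear coeff_map_chi_mult br_finite
        i[OF a] i[OF D_part[OF a]] br_simps minus_one_power_iff)
qed

end

section \<open>Multilinear maps on tensor products\<close>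

definition bilinear :: "('a::complex_vector \<Rightarrow> 'b::complex_vector \<Rightarrow> 'c::complex_vector) \<Rightarrow> bool" where
  "bilinear f \<longleftrightarrow> (\<forall>a. clinear (f a)) \<and> (\<forall>b. clinear (\<lambda>a. f a b))"

definition trilinear ::
  "('a::complex_vector \<Rightarrow> 'b::complex_vector \<Rightarrow> 'c::complex_vector \<Rightarrow> 'd::complex_vector) \<Rightarrow> bool" where
  "trilinear f \<longleftrightarrow> (\<forall>a. bilinear (f a)) \<and> (\<forall>b c. clinear (\<lambda>a. f a b c))"

lemma bilinearI: "(\<And>a. clinear (f a)) \<Longrightarrow> (\<And>b. clinear (\<lambda>a. f a b)) \<Longrightarrow> bilinear f"
  by (simp add: bilinear_def)

lemma bilinear_right: "bilinear f \<Longrightarrow> clinear (f a)"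
  and bilinear_left: "bilinear f \<Longrightarrow> clinear (\<lambda>a. f a b)"
  by (simp_all add: bilinear_def)

lemma trilinearI:
  "(\<And>a b. clinear (f a b)) \<Longrightarrow> (\<And>a c. clinear (\<lambda>b. f a b c)) \<Longrightarrow> (\<And>b c. clinear (\<lambda>a. f a b c)) \<Longrightarrow>
    trilinear f"
  by (simp add: trilinear_def bilinear_def)

lemma trilinear_1: "trilinear f \<Longrightarrow> clinear (\<lambda>a. f a b c)"
  and trilinear_2: "trilinear f \<Longrightarrow> clinear (\<lambda>b. f a b c)"
  and trilinear_3: "trilinear f \<Longrightarrow> clinear (f a b)"
  by (simp_all add: trilinear_def bilinear_def)

lemma bilinear_plus: "bilinear f \<Longrightarrow> bilinear g \<Longrightarrow> bilinear (\<lambda>a b. f a b + g a b)"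
  and bilinear_minus: "bilinear f \<Longrightarrow> bilinear g \<Longrightarrow> bilinear (\<lambda>a b. f a b - g a b)"
  and bilinear_scaled: "bilinear f \<Longrightarrow> bilinear (\<lambda>a b. c *\<^sub>C f a b)"
  and bilinear_swap: "bilinear f \<Longrightarrow> bilinear (\<lambda>a b. f b a)"
  by (auto simp: bilinear_def intro!: clinear_intros)

lemma bilinear_comp:
  "clinear h \<Longrightarrow> bilinear f \<Longrightarrow> bilinear (\<lambda>a b. h (f a b))"
  by (auto simp: bilinear_def intro!: clinear_comp[of h])

lemma bilinear_comp_left: "bilinear f \<Longrightarrow> clinear h \<Longrightarrow> bilinear (\<lambda>a b. f (h a) b)"
  by (auto simp: bilinear_def intro!: clinear_comp[of "\<lambda>a. f a b" h for b])

lemma bilinear_comp_right: "bilinear f \<Longrightarrow> clinear h \<Longrightarrow> bilinear (\<lambda>a b. f a (h b))"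
  by (auto simp: bilinear_def intro!: clinear_comp[of "f a" h for a])

lemma trilinear_plus: "trilinear f \<Longrightarrow> trilinear g \<Longrightarrow> trilinear (\<lambda>a b c. f a b c + g a b c)"
  and trilinear_minus: "trilinear f \<Longrightarrow> trilinear g \<Longrightarrow> trilinear (\<lambda>a b c. f a b c - g a b c)"
  and trilinear_scaled: "trilinear f \<Longrightarrow> trilinear (\<lambda>a b c. d *\<^sub>C f a b c)"
  and trilinear_swap: "trilinear f \<Longrightarrow> trilinear (\<lambda>a b c. f b a c)"
  by (auto simp: trilinear_def bilinear_def intro!: clinear_intros)

lemma trilinear_comp_left:
  assumes f: "bilinear f" and g: "bilinear g"
  shows "trilinear (\<lambda>a b c. f (g a b) c)"
proof (rule trilinearI)
  show "clinear (\<lambda>b. f (g a b) c)" for a c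
    by (rule clinear_comp[OF bilinear_left[OF f] bilinear_right[OF g]])
  show "clinear (\<lambda>a. f (g a b) c)" for b c
    by (rule clinear_comp[OF bilinear_left[OF f] bilinear_left[OF g]])
qed (rule bilinear_right[OF f])

lemma trilinear_comp_right:
  assumes f: "bilinear f" and g: "bilinear g"
  shows "trilinear (\<lambda>a b c. f a (g b c))"
proof (rule trilinearI)
  show "clinear (\<lambda>c. f a (g b c))" for a b
    by (rule clinear_comp[OF bilinear_right[OF f] bilinear_right[OF g]])
  show "clinear (\<lambda>b. f a (g b c))" for a c
    by (rule clinear_comp[OF bilinear_right[OF f] bilinear_left[OF g]])
qed (rule bilinear_left[OF f])

lemma clinear_tens_left: "clinear (\<lambda>a. a \<otimes>\<^sub>C w)"
  and clinear_tens_right: "clinear (\<lambda>w. a \<otimes>\<^sub>C w)"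
  by (auto intro!: clinearI simp: tens_add_left tens_add_right tens_scale_left tens_scale_right)

section \<open>The universal property of the tensor product\<close>

definition linear_extension :: "('k \<Rightarrow> 'c::complex_vector) \<Rightarrow> ('k \<Rightarrow>\<^sub>0 complex) \<Rightarrow> 'c" where
  "linear_extension f x = (\<Sum>k\<in>Poly_Mapping.keys x. Poly_Mapping.lookup x k *\<^sub>C f k)"

lemma clinear_linear_extension: "clinear (linear_extension f)"
proof -
  have eq: "linear_extension f x = (\<Sum>k\<in>A. Poly_Mapping.lookup x k *\<^sub>C f k)"
    if "finite A" "Poly_Mapping.keys x \<subseteq> A" for A x
    unfolding linear_extension_def
    by (rule sum.mono_neutral_left) (use that in \<open>auto simp: in_keys_iff\<close>)
  show ?thesis
  proof (rule clinearI)
    fix x y :: "'a \<Rightarrow>\<^sub>0 complex" and c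
    let ?A = "Poly_Mapping.keys x \<union> Poly_Mapping.keys y"
    show "linear_extension f (x + y) = linear_extension f x + linear_extension f y"
      using Poly_Mapping.keys_add[of x y]
      by (simp add: eq[of ?A] lookup_add scaleC_add_left sum.distrib)
    have "Poly_Mapping.keys (c *\<^sub>C x) \<subseteq> Poly_Mapping.keys x"
      by (auto simp: in_keys_iff lookup_scaleC)
    then show "linear_extension f (c *\<^sub>C x) = c *\<^sub>C linear_extension f x"
      by (simp add: eq[of "Poly_Mapping.keys x"] lookup_scaleC cvec.scale_sum_right scaleC_complex_def)
  qed
qed

lemma linear_extension_single: "linear_extension f (Poly_Mapping.single k c) = c *\<^sub>C f k"
  by (simp add: linear_extension_def)

abbreviation free_lift :: "('a \<Rightarrow> 'b \<Rightarrow> 'c::complex_vector) \<Rightarrow> ('a \<times> 'b \<Rightarrow>\<^sub>0 complex) \<Rightarrow> 'c" where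
  "free_lift f \<equiv> linear_extension (\<lambda>k. f (fst k) (snd k))"

lemma free_lift_single: "free_lift f (Poly_Mapping.single (a, b) c) = c *\<^sub>C f a b"
  by (simp add: linear_extension_single)

lemma clinear_eq_subspace: "clinear f \<Longrightarrow> clinear g \<Longrightarrow> cvec.subspace {x. f x = g x}"
  by (simp add: cvec.subspace_def clinear_add clinear_scale clinear_zero)

lemma free_lift_tensor_eq:
  assumes f: "bilinear f" and xy: "tensor_eq x y"
  shows "free_lift f x = free_lift f y"
proof -
  note lin = clinear_linear_extension[of "\<lambda>k. f (fst k) (snd k)"]
  have "free_lift f r = 0" if "r \<in> bilinearity_relations" for r
    using that unfolding bilinearity_relations_def
    by (auto simp: clinear_diff[OF lin] clinear_scale[OF lin] free_lift_single
        clinear_add[OF bilinear_left[OF f]] clinear_add[OF bilinear_right[OF f]]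
        clinear_scale[OF bilinear_left[OF f]] clinear_scale[OF bilinear_right[OF f]])
  then have "cvec.span bilinearity_relations \<subseteq> {x. free_lift f x = 0}"
    by (intro cvec.span_minimal clinear_eq_subspace lin clinear_0) auto
  then show ?thesis
    using xy clinear_diff[OF lin, of x y] by (auto simp: tensor_eq_def)
qed

text \<open>Without bilinearity \<open>free_lift f\<close> need not respect the classes; the default
  0 gives a function for every \<open>f\<close>, linear in the tensor in all cases.\<close>

lift_definition tensor_lift ::
  "('a::complex_vector \<Rightarrow> 'b::complex_vector \<Rightarrow> 'c::complex_vector) \<Rightarrow> ('a, 'b) tensor \<Rightarrow> 'c"
  is "\<lambda>f x. if bilinear f then free_lift f x else 0"
  using free_lift_tensor_eq by auto

lemma clinear_tensor_lift: "clinear (tensor_lift f)"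
proof (rule clinearI)
  show "tensor_lift f (x + y) = tensor_lift f x + tensor_lift f y" for x y
    by transfer (simp add: clinear_add[OF clinear_linear_extension])
  show "tensor_lift f (c *\<^sub>C x) = c *\<^sub>C tensor_lift f x" for c x
    by transfer (simp add: clinear_scale[OF clinear_linear_extension])
qed

lemma tensor_lift_tens: "bilinear f \<Longrightarrow> tensor_lift f (a \<otimes>\<^sub>C b) = f a b"
  by transfer (simp add: free_lift_single)

text \<open>Expands a class in pure tensors, which therefore span the tensor product.\<close>

lemma abs_tensor_eq: "abs_tensor x = free_lift (\<otimes>\<^sub>C) x"
proof (rule clinear_eq_on_singles)
  show "clinear abs_tensor"
    by (rule clinearI) (simp_all add: plus_tensor.abs_eq scaleC_tensor.abs_eq)
  show "abs_tensor (Poly_Mapping.single k (Poly_Mapping.lookup x k)) =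
      free_lift (\<otimes>\<^sub>C) (Poly_Mapping.single k (Poly_Mapping.lookup x k))" for k
  proof -
    obtain a b where k: "k = (a, b)"
      by fastforce
    let ?c = "Poly_Mapping.lookup x k"
    have "Poly_Mapping.single (a, b) ?c = ?c *\<^sub>C Poly_Mapping.single (a, b) 1"
      using clinear_scale[OF clinear_single, of "(a, b)" ?c "1 :: complex"] by (simp add: scaleC_complex_def)
    then have "abs_tensor (Poly_Mapping.single (a, b) ?c) = ?c *\<^sub>C (a \<otimes>\<^sub>C b)"
      by (simp only: tens.abs_eq scaleC_tensor.abs_eq)
    then show ?thesis
      by (simp add: k free_lift_single)
  qed
qed (rule clinear_linear_extension)

lemma tensor_in_subspace:
  assumes "cvec.subspace S" "\<And>a b. a \<otimes>\<^sub>C b \<in> S"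
  shows "t \<in> S"
proof -
  have "free_lift (\<otimes>\<^sub>C) x \<in> S" for x
    unfolding linear_extension_def by (intro cvec.subspace_sum cvec.subspace_scale assms)
  then show ?thesis
    by (induction t rule: tensor.abs_induct) (simp add: abs_tensor_eq)
qed

lemma clinear_vimage_subspace: "clinear f \<Longrightarrow> cvec.subspace S \<Longrightarrow> cvec.subspace {x. f x \<in> S}"
  by (simp add: cvec.subspace_def clinear_add clinear_scale clinear_zero)

lemma tensor_eqI:
  assumes "clinear f" "clinear g" "\<And>a b. f (a \<otimes>\<^sub>C b) = g (a \<otimes>\<^sub>C b)"
  shows "f t = g t"
  using tensor_in_subspace[OF clinear_eq_subspace[OF assms(1,2)]] assms(3) by blast

section \<open>Parity\<close>

lemma part_subspace: "is_nabla_module n M \<Longrightarrow> cvec.subspace (part M k)"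
  by (simp add: is_nabla_module_def)

lemma homogeneous_decomposition:
  assumes "is_nabla_module n M"
  obtains a b where "a \<in> part M 0" "b \<in> part M 1" "v = a + b"
proof -
  have "\<exists>a \<in> even_part M. \<exists>b \<in> odd_part M. v = a + b"
    using assms unfolding is_nabla_module_def by simp
  then show thesis
    using that by (auto simp: part_def)
qed

lemma part_disjoint:
  assumes "is_nabla_module n M" "a \<in> part M 0" "a \<in> part M 1"
  shows "a = 0"
proof -
  have "even_part M \<inter> odd_part M = {0}"
    using assms(1) unfolding is_nabla_module_def by simp
  then show ?thesis
    using assms(2,3) by (auto simp: part_def)
qed

text \<open>The parity involution. As a total linear map it expresses the sign \<open>(-1)^p\<close>
  for elements that need not be homogeneous; the description is unique because the decomposition
  into even and odd part is.\<close>

definition parity_map :: "('a::complex_vector, 'z) nabla_module_scheme \<Rightarrow> 'a \<Rightarrow> 'a" where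
  "parity_map M v = (THE x. \<exists>a\<in>part M 0. \<exists>b\<in>part M 1. v = a + b \<and> x = a - b)"

lemma parity_map_add:
  assumes M: "is_nabla_module n M" and ab: "a \<in> part M 0" "b \<in> part M 1"
  shows "parity_map M (a + b) = a - b"
  unfolding parity_map_def
proof (rule the_equality)
  fix x
  assume "\<exists>a'\<in>part M 0. \<exists>b'\<in>part M 1. a + b = a' + b' \<and> x = a' - b'"
  then obtain a' b' where *: "a' \<in> part M 0" "b' \<in> part M 1" "a + b = a' + b'" "x = a' - b'"
    by blast
  \<comment> \<open>This common difference of the two decompositions is both even and odd, hence
    zero.\<close>
  then have "a - a' = b' - b"
    by (simp add: algebra_simps)
  moreover have "a - a' \<in> part M 0" "b' - b \<in> part M 1"
    using * ab by (auto intro: cvec.subspace_diff part_subspace[OF M])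
  ultimately have "a - a' = 0"
    using part_disjoint[OF M] by metis
  with \<open>a - a' = b' - b\<close> show "x = a - b"
    using *(4) by simp
qed (use ab in blast)

lemma parity_map_part:
  assumes M: "is_nabla_module n M" and a: "a \<in> part M p"
  shows "parity_map M a = (- 1) ^ p *\<^sub>C a"
proof (cases "even p")
  case True
  then have "a \<in> part M 0"
    using a by (simp add: part_def)
  then show ?thesis
    using parity_map_add[OF M _ cvec.subspace_0[OF part_subspace[OF M]], of a] True by simp
next
  case False
  then have "a \<in> part M 1"
    using a by (simp add: part_def)
  then show ?thesis
    using parity_map_add[OF M cvec.subspace_0[OF part_subspace[OF M]], of a] False by simp
qed

lemma clinear_parity_map:
  assumes M: "is_nabla_module n M"
  shows "clinear (parity_map M)"
proof (rule clinearI)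
  fix x y :: 'a and c
  obtain a b where x: "a \<in> part M 0" "b \<in> part M 1" "x = a + b"
    using homogeneous_decomposition[OF M] .
  obtain a' b' where y: "a' \<in> part M 0" "b' \<in> part M 1" "y = a' + b'"
    using homogeneous_decomposition[OF M] .
  have "parity_map M ((a + a') + (b + b')) = (a + a') - (b + b')"
    using x y by (intro parity_map_add[OF M]) (auto intro: cvec.subspace_add part_subspace[OF M])
  then show "parity_map M (x + y) = parity_map M x + parity_map M y"
    using x y by (simp add: parity_map_add[OF M] algebra_simps)
  have "parity_map M (c *\<^sub>C a + c *\<^sub>C b) = c *\<^sub>C a - c *\<^sub>C b"
    using x by (intro parity_map_add[OF M]) (auto intro: cvec.subspace_scale part_subspace[OF M])
  then show "parity_map M (c *\<^sub>C x) = c *\<^sub>C parity_map M x"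
    using x by (simp add: parity_map_add[OF M] cvec.scale_right_distrib cvec.scale_right_diff_distrib)
qed

lemma part_in_subspace:
  assumes M: "is_nabla_module n M" and "cvec.subspace S" "\<And>p a. a \<in> part M p \<Longrightarrow> a \<in> S"
  shows "v \<in> S"
  using homogeneous_decomposition[OF M, of v] assms(2,3) cvec.subspace_add by metis

section \<open>Multilinearity and naturality of the iterated brackets\<close>

lemma (in substitution) clinear_lam_eval_param:
  "(\<And>v. clinear (\<lambda>a. g a v)) \<Longrightarrow> clinear (\<lambda>a. lam_eval c L X (g a) p)"
  unfolding lam_eval_def
  by (intro clinear_sum_terms_param clinear_term[of "\<lambda>x. x"] clinear_scaled
      clinear_comp[OF clinear_monomial_op] clinear_L clinear_X)

lemma clinear_coeff_map_param:
  "(\<And>v. clinear (\<lambda>a. f a v)) \<Longrightarrow> clinear (\<lambda>a. coeff_map k (f a) p)"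
  unfolding coeff_map_def
  by (intro clinear_sum_terms_param clinear_scaled clinear_comp[OF clinear_single])

context
  fixes R :: "('a::complex_vector, 'z) susy_lca_scheme"
  assumes br: "bilinear (lbr R)"
begin

lemma bilinear_bracket_neg:
  assumes "clinear (der R)" "\<And>i. clinear (oder R i)"
  shows "bilinear (bracket_neg R)"
  unfolding bracket_neg_eval[abs_def]
  by (intro bilinear_comp[OF _ br] substitution.clinear_lam_eval[OF substitution_neg[OF assms]] clinear_single)

lemma clinear_J_lbr: "clinear (\<lambda>v. coeff_map 0 const_lam (lbr R a v))"
  and clinear_J_lbr': "clinear (\<lambda>a. coeff_map 0 const_lam (lbr R a v))"
  by (intro clinear_comp[OF clinear_coeff_map] clinear_single bilinear_right[OF br] bilinear_left[OF br])+

lemma trilinear_bracket_right: "trilinear (bracket_right n R p)"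
  unfolding bracket_right_eval[abs_def]
proof (rule trilinearI)
  interpret substitution "gamma_mult :: 'a lam lam \<Rightarrow> _" eta_mult
    by (rule substitution_gamma)
  note 1 = clinear_lam_eval[OF clinear_J_lbr]
  show "clinear (\<lambda>c. lam_eval ((- 1) ^ (p + n)) gamma_mult eta_mult (\<lambda>v. coeff_map 0 const_lam (lbr R a v)) (lbr R b c))" for a b
    by (rule clinear_comp[OF 1 bilinear_right[OF br]])
  show "clinear (\<lambda>b. lam_eval ((- 1) ^ (p + n)) gamma_mult eta_mult (\<lambda>v. coeff_map 0 const_lam (lbr R a v)) (lbr R b c))" for a c
    by (rule clinear_comp[OF 1 bilinear_left[OF br]])
  show "clinear (\<lambda>a. lam_eval ((- 1) ^ (p + n)) gamma_mult eta_mult (\<lambda>v. coeff_map 0 const_lam (lbr R a v)) (lbr R b c))" for b c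
    by (intro clinear_lam_eval_param clinear_J_lbr')
qed

lemma trilinear_bracket_left_sum: "trilinear (bracket_left_sum n R)"
  unfolding bracket_left_sum_eval[abs_def]
proof (rule trilinearI)
  let ?g = "\<lambda>v c. lam_eval 1 (\<lambda>x. lam_mult x + gamma_mult x) (\<lambda>i x. chi_mult i x + eta_mult i x)
      (\<lambda>w. const_lam (const_lam w)) (lbr R v c)"
  interpret substitution "lam_mult :: 'a lam lam \<Rightarrow> _" chi_mult
    by (rule substitution_lam)
  have g: "bilinear ?g"
    by (intro bilinear_comp[OF _ br] substitution.clinear_lam_eval[OF substitution_sum]
        clinear_comp[OF clinear_single] clinear_single)
  note 1 = clinear_lam_eval[OF bilinear_left[OF g]]
  show "clinear (\<lambda>c. lam_eval ((- 1) ^ n) lam_mult chi_mult (\<lambda>v. ?g v c) (lbr R a b))" for a b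
    by (intro clinear_lam_eval_param bilinear_right[OF g])
  show "clinear (\<lambda>b. lam_eval ((- 1) ^ n) lam_mult chi_mult (\<lambda>v. ?g v c) (lbr R a b))" for a c
    by (rule clinear_comp[OF 1 bilinear_right[OF br]])
  show "clinear (\<lambda>a. lam_eval ((- 1) ^ n) lam_mult chi_mult (\<lambda>v. ?g v c) (lbr R a b))" for b c
    by (rule clinear_comp[OF 1 bilinear_left[OF br]])
qed

lemma trilinear_bracket_right_swap: "trilinear (bracket_right_swap n R q)"
  unfolding bracket_right_swap_def[abs_def]
  by (intro trilinearI clinear_coeff_map_param bilinear_left[OF br]
      clinear_comp[OF clinear_coeff_map[OF bilinear_right[OF br]]] bilinear_right[OF br])

lemma trilinear_wick_integral: "trilinear (wick_integral n R)"
  unfolding wick_integral_eq[abs_def]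
  by (intro trilinearI clinear_comp[OF clinear_gamma_integral] clinear_comp[OF clinear_foldr]
      clinear_eta_deriv clinear_coeff_map_param bilinear_right[OF br]
      clinear_comp[OF clinear_coeff_map[OF bilinear_left[OF br]]] bilinear_left[OF br])

lemma bilinear_lambda_bracket: "bilinear (lambda_bracket n R)"
  unfolding lambda_bracket_def[abs_def] chi_derivs_def
  by (intro bilinear_comp[OF _ br] clinear_foldr clinear_chi_deriv)

lemma bilinear_integral_neg_nabla:
  assumes "clinear (der R)"
  shows "bilinear (integral_neg_nabla n R)"
  unfolding integral_neg_nabla_def[abs_def]
  by (intro bilinear_comp[OF _ bilinear_lambda_bracket] clinear_sum_terms clinear_uminus clinear_scaled
      clinear_funpow assms)

end

lemma trilinear_integral_nabla:
  assumes br: "bilinear (lbr U)" and nop: "bilinear (nop U)" and der: "clinear (der U)"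
  shows "trilinear (integral_nabla n U)"
  unfolding integral_nabla_def[abs_def]
proof (rule trilinearI)
  let ?F = "\<lambda>a j I v. (1 / of_nat (Suc j)) *\<^sub>C nop U ((der U ^^ Suc j) a) v"
  have F: "clinear (sum_terms (?F a))" for a
    by (intro clinear_sum_terms clinear_scaled bilinear_right[OF nop])
  show "clinear (\<lambda>c. sum_terms (?F a) (lambda_bracket n U b c))" for a b
    by (rule clinear_comp[OF F bilinear_right[OF bilinear_lambda_bracket[OF br]]])
  show "clinear (\<lambda>b. sum_terms (?F a) (lambda_bracket n U b c))" for a c
    by (rule clinear_comp[OF F bilinear_left[OF bilinear_lambda_bracket[OF br]]])
  show "clinear (\<lambda>a. sum_terms (?F a) (lambda_bracket n U b c))" for b c
    by (intro clinear_sum_terms_param clinear_scaled clinear_comp[OF bilinear_left[OF nop]] clinear_funpow der)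
qed

text \<open>An even map produces no sign, which makes the identity valid for every polynomial;
  multiplication by a scalar can thus be moved through substitutions without tracking
  supports.\<close>

lemma coeff_map_0_chi_mult:
  assumes f: "clinear f"
  shows "coeff_map 0 f (chi_mult i p) = chi_mult i (coeff_map 0 f p)"
  by (rule lam_eqI[where p = p]; (intro clinear_comp[OF clinear_coeff_map[OF f]]
      clinear_comp[OF clinear_chi_mult] op_linears clinear_coeff_map f)?)
    (simp add: coeff_map_monom clinear_zero[OF f] clifford_simps clinear_scale[OF clinear_coeff_map[OF f]]
      clinear_neg[OF clinear_coeff_map[OF f]])

lemma coeff_map_0_chi_deriv:
  assumes f: "clinear f"
  shows "coeff_map 0 f (chi_deriv i p) = chi_deriv i (coeff_map 0 f p)"
  by (rule lam_eqI[where p = p]; (intro clinear_comp[OF clinear_coeff_map[OF f]]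
      clinear_comp[OF clinear_chi_deriv] op_linears clinear_coeff_map f)?)
    (simp add: coeff_map_monom clinear_zero[OF f] clifford_simps clinear_scale[OF clinear_coeff_map[OF f]]
      clinear_zero[OF clinear_coeff_map[OF f]])

text \<open>The sign of moving a scalar past a coefficient depends on the parity of that
  coefficient, which for a bracket involves the number of odd variables in its term. So the sign has
  the form \<open>e * d ^ card I\<close>: \<open>e\<close> comes out and \<open>d\<close> merges
  with \<open>c\<close>.\<close>

lemma (in substitution) lam_eval_cong_sign:
  assumes "\<And>m I. (m, I) \<in> Poly_Mapping.keys p \<Longrightarrow>
    g (Poly_Mapping.lookup p (m, I)) = (e * d ^ card I) *\<^sub>C h (Poly_Mapping.lookup p (m, I))"
  shows "lam_eval c L X g p = e *\<^sub>C lam_eval (c * d) L X h p"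
  unfolding lam_eval_def sum_terms_comp[OF clinear_scaled[OF clinear_id]]
  by (rule sum_terms_cong)
    (simp only: assms clinear_scale[OF clinear_monomial_op[OF clinear_L clinear_X]] scaleC_scaleC
      power_mult_distrib mult_ac)

lemma coeff_map_cong_sign:
  assumes "\<And>m I. (m, I) \<in> Poly_Mapping.keys p \<Longrightarrow>
    f (Poly_Mapping.lookup p (m, I)) = (e * (- 1) ^ (l * card I)) *\<^sub>C g (Poly_Mapping.lookup p (m, I))"
  shows "coeff_map k f p = e *\<^sub>C coeff_map (k + l) g p"
  unfolding coeff_map_def sum_terms_comp[OF clinear_scaled[OF clinear_id]]
  by (rule sum_terms_cong)
    (simp only: assms clinear_scale[OF clinear_single] scaleC_scaleC distrib_left distrib_right power_add mult_ac)

text \<open>For nested lifts: the inner lift has to depend linearly on the data of the outer one.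
  Bilinearity is required at every parameter, since otherwise the default value would enter.\<close>

lemma clinear_tensor_lift_param:
  assumes "\<And>c. bilinear (f c)" "\<And>a b. clinear (\<lambda>c. f c a b)"
  shows "clinear (\<lambda>c. tensor_lift (f c) t)"
proof (rule clinearI)
  show "tensor_lift (f (c + c')) t = tensor_lift (f c) t + tensor_lift (f c') t" for c c'
    by (rule tensor_eqI[where t = t]; (intro clinear_plus clinear_tensor_lift)?)
      (simp add: tensor_lift_tens assms(1) clinear_add[OF assms(2)] bilinear_plus)
  show "tensor_lift (f (k *\<^sub>C c)) t = k *\<^sub>C tensor_lift (f c) t" for k c
    by (rule tensor_eqI[where t = t]; (intro clinear_scaled clinear_tensor_lift)?)
      (simp add: tensor_lift_tens assms(1) clinear_scale[OF assms(2)] bilinear_scaled)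
qed

lemma minus_one_power_eqI: "even a = even b \<Longrightarrow> (- 1) ^ a = (- 1 :: complex) ^ b"
  by (simp add: minus_one_power_iff)

text \<open>A Grassmann algebra with its odd partial derivatives, given by relations. The operators
  \<open>d i\<close> are kept apart from \<open>oder W\<close> because \<open>D^i\<close> for
  \<open>i > n\<close> is not a sum of operators on the two factors: it couples \<partial> on
  \<open>V\<close> with multiplication by \<theta>^i on \<open>W\<close>. At \<open>i = j\<close>,
  \<open>d_anticomm\<close> says that \<open>d i\<close> squares to zero.\<close>

locale scalar_extension =
  fixes n :: nat
    and V :: "'v::complex_vector susy_va"
    and W :: "'w::complex_vector diff_superalgebra"
    and \<theta> :: "nat \<Rightarrow> 'w"
    and d :: "nat \<Rightarrow> 'w \<Rightarrow> 'w"
  assumes va: "susy_vertex_algebra n V"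
    and W: "commutative_diff_superalgebra n W"
    and der_W: "der W w = 0"
    and oder_W: "i \<in> {1..n} \<Longrightarrow> oder W i w = 0"
    and \<theta>_odd: "\<theta> i \<in> part W 1"
    and d_linear: "clinear (d i)"
    and d_part: "w \<in> part W s \<Longrightarrow> d i w \<in> part W (Suc s)"
    and d_mult: "w \<in> part W s \<Longrightarrow>
      d i (amult W w x) = amult W (d i w) x + (- 1) ^ s *\<^sub>C amult W w (d i x)"
    and d_\<theta>: "d i (\<theta> j) = (if i = j then aone W else 0)"
    and d_anticomm: "d i (d j w) + d j (d i w) = 0"
begin

abbreviation "M \<equiv> amult W"
abbreviation "\<sigma> \<equiv> parity_map V"

definition "even_comp w = (1 / 2) *\<^sub>C (w + parity_map W w)"
definition "odd_comp w = (1 / 2) *\<^sub>C (w - parity_map W w)"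

lemma lca: "susy_lie_conformal_algebra n V"
  and udV: "unital_diff_superalgebra n V (vac V) (nop V)"
  using va by (simp_all add: susy_vertex_algebra_def)

lemma nmV: "is_nabla_module n V"
  using udV by (simp add: unital_diff_superalgebra_def)

lemma udW: "unital_diff_superalgebra n W (aone W) M"
  using W by (simp add: commutative_diff_superalgebra_def)

lemma nmW: "is_nabla_module n W"
  using udW by (simp add: unital_diff_superalgebra_def)

lemma M_bilinear: "bilinear M"
  and M_part: "w \<in> part W s \<Longrightarrow> x \<in> part W t \<Longrightarrow> M w x \<in> part W (s + t)"
  and M_one: "M (aone W) w = w" "M w (aone W) = w"
  using udW by (simp_all add: unital_diff_superalgebra_def bilinear_def)

lemma aone_even: "aone W \<in> part W 0"
  using udW by (simp add: unital_diff_superalgebra_def part_def)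

lemma M_assoc: "M (M w x) y = M w (M x y)"
  using W by (simp add: commutative_diff_superalgebra_def)

lemma M_comm: "w \<in> part W s \<Longrightarrow> x \<in> part W t \<Longrightarrow> M w x = (- 1) ^ (s * t) *\<^sub>C M x w"
  using W unfolding commutative_diff_superalgebra_def by blast

lemma nopV_bilinear: "bilinear (nop V)"
  and nopV_part: "a \<in> part V p \<Longrightarrow> b \<in> part V q \<Longrightarrow> nop V a b \<in> part V (p + q)"
  and nopV_vac: "nop V (vac V) a = a" "nop V a (vac V) = a"
  and nopV_der: "der V (nop V a b) = nop V (der V a) b + nop V a (der V b)"
  and nopV_oder: "i \<in> {1..n} \<Longrightarrow> a \<in> part V p \<Longrightarrow>
    oder V i (nop V a b) = nop V (oder V i a) b + (- 1) ^ p *\<^sub>C nop V a (oder V i b)"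
  using udV by (simp_all add: unital_diff_superalgebra_def bilinear_def)

lemma vac_even: "vac V \<in> part V 0"
  using udV by (simp add: unital_diff_superalgebra_def part_def)

lemma derV_linear: "clinear (der V)"
  and derV_part: "a \<in> part V p \<Longrightarrow> der V a \<in> part V p"
  and oderV_linear: "i \<in> {1..n} \<Longrightarrow> clinear (oder V i)"
  and oderV_part: "i \<in> {1..n} \<Longrightarrow> a \<in> part V p \<Longrightarrow> oder V i a \<in> part V (Suc p)"
  and oderV_der: "i \<in> {1..n} \<Longrightarrow> oder V i (der V a) = der V (oder V i a)"
  and oderV_anticomm: "i \<in> {1..n} \<Longrightarrow> j \<in> {1..n} \<Longrightarrow>
    oder V i (oder V j a) + oder V j (oder V i a) = (if i = j then 2 *\<^sub>C der V a else 0)"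
  using nmV by (simp_all add: is_nabla_module_def)

lemmas \<sigma>_linear = clinear_parity_map[OF nmV]
lemmas \<sigma>_part = parity_map_part[OF nmV]

lemma even_comp_linear: "clinear even_comp" and odd_comp_linear: "clinear odd_comp"
  unfolding even_comp_def[abs_def] odd_comp_def[abs_def]
  by (intro clinear_intros clinear_parity_map[OF nmW])+

lemma comp_part:
  assumes "w \<in> part W s"
  shows "even_comp w = (if even s then w else 0)" "odd_comp w = (if even s then 0 else w)"
proof -
  have "(1 / 2) *\<^sub>C (w + w) = (1 / 2 + 1 / 2) *\<^sub>C w"
    by (simp only: cvec.scale_right_distrib scaleC_add_left)
  then have "(1 / 2) *\<^sub>C (w + w) = w"
    by simp
  then show "even_comp w = (if even s then w else 0)" "odd_comp w = (if even s then 0 else w)"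
    by (simp_all add: even_comp_def odd_comp_def parity_map_part[OF nmW assms])
qed

text \<open>
  On \<open>a \<otimes> w\<close> and \<open>b \<otimes> z\<close> this is \<open>g a b (w z)\<close> with the sign of moving \<open>w\<close> past \<open>b\<close>; the sign is expressed
  by \<open>\<sigma>\<close> because neither argument need be homogeneous.
\<close>

definition super_extension ::
  "('v \<Rightarrow> 'v \<Rightarrow> 'w \<Rightarrow> 'c::complex_vector) \<Rightarrow> ('v, 'w) tensor \<Rightarrow> ('v, 'w) tensor \<Rightarrow> 'c" where
  "super_extension g x y = tensor_lift (\<lambda>a w. tensor_lift (\<lambda>b z.
     g a b (M (even_comp w) z) + g a (\<sigma> b) (M (odd_comp w) z)) y) x"

context
  fixes g :: "'v \<Rightarrow> 'v \<Rightarrow> 'w \<Rightarrow> 'c::complex_vector"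
  assumes g: "trilinear g"
begin

lemma inner_bilinear: "bilinear (\<lambda>b z. g a b (M (even_comp w) z) + g a (\<sigma> b) (M (odd_comp w) z))"
proof (intro bilinear_plus)
  have 1: "bilinear (\<lambda>b z. g a b (M w z))" for w
    by (rule bilinear_comp_right[of "g a"]) (use g M_bilinear in \<open>auto simp: trilinear_def bilinear_def\<close>)
  show "bilinear (\<lambda>b z. g a b (M (even_comp w) z))"
    by (rule 1)
  show "bilinear (\<lambda>b z. g a (\<sigma> b) (M (odd_comp w) z))"
    by (rule bilinear_comp_left[OF 1 \<sigma>_linear])
qed

lemma outer_bilinear:
  "bilinear (\<lambda>a w. tensor_lift (\<lambda>b z. g a b (M (even_comp w) z) + g a (\<sigma> b) (M (odd_comp w) z)) y)"
proof (rule bilinearI)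
  show "clinear (\<lambda>w. tensor_lift (\<lambda>b z. g a b (M (even_comp w) z) + g a (\<sigma> b) (M (odd_comp w) z)) y)" for a
    by (rule clinear_tensor_lift_param[OF inner_bilinear])
      (intro clinear_plus clinear_comp[OF trilinear_3[OF g]] clinear_comp[OF bilinear_left[OF M_bilinear]]
        even_comp_linear odd_comp_linear)
  show "clinear (\<lambda>a. tensor_lift (\<lambda>b z. g a b (M (even_comp w) z) + g a (\<sigma> b) (M (odd_comp w) z)) y)" for w
    by (rule clinear_tensor_lift_param[OF inner_bilinear]) (intro clinear_plus trilinear_1[OF g])
qed

lemma super_extension_bilinear: "bilinear (super_extension g)"
  unfolding super_extension_def[abs_def]
proof (rule bilinearI)
  show "clinear (\<lambda>x. tensor_lift (\<lambda>a w. tensor_lift (\<lambda>b z.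
     g a b (M (even_comp w) z) + g a (\<sigma> b) (M (odd_comp w) z)) y) x)" for y
    by (rule clinear_tensor_lift)
  show "clinear (\<lambda>y. tensor_lift (\<lambda>a w. tensor_lift (\<lambda>b z.
     g a b (M (even_comp w) z) + g a (\<sigma> b) (M (odd_comp w) z)) y) x)" for x
    by (intro clinear_tensor_lift_param outer_bilinear clinear_tensor_lift)
qed

lemma super_extension_tens:
  assumes "w \<in> part W s" "b \<in> part V q"
  shows "super_extension g (a \<otimes>\<^sub>C w) (b \<otimes>\<^sub>C z) = (- 1) ^ (s * q) *\<^sub>C g a b (M w z)"
proof -
  have M0: "M 0 z = 0"
    by (rule clinear_zero[OF bilinear_left[OF M_bilinear]])
  have "super_extension g (a \<otimes>\<^sub>C w) (b \<otimes>\<^sub>C z) =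
      g a b (M (even_comp w) z) + g a (\<sigma> b) (M (odd_comp w) z)"
    unfolding super_extension_def
    by (subst tensor_lift_tens[OF outer_bilinear], subst tensor_lift_tens[OF inner_bilinear]) (rule refl)
  then show ?thesis
    by (simp add: comp_part[OF assms(1)] \<sigma>_part[OF assms(2)] M0 clinear_zero[OF trilinear_3[OF g]]
        clinear_scale[OF trilinear_2[OF g]] minus_one_power_iff)
qed

end

definition tensor_part :: "nat \<Rightarrow> ('v, 'w) tensor set" where
  "tensor_part k = cvec.span {a \<otimes>\<^sub>C w | a w p q. a \<in> part V p \<and> w \<in> part W q \<and> even (p + q + k)}"

text \<open>For \<open>i > n\<close>, \<open>D\<^sup>i = \<theta>\<^sup>i \<partial> + \<partial>/\<partial>\<theta>\<^sup>i\<close>, and \<open>\<sigma>\<close> is the sign of moving it past \<open>a\<close>.\<close>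

definition tensor_va :: "('v, 'w) tensor susy_va" where
  "tensor_va = \<lparr>even_part = tensor_part 0, odd_part = tensor_part 1,
     der = tensor_lift (\<lambda>a w. der V a \<otimes>\<^sub>C w),
     oder = (\<lambda>i. if i \<le> n then tensor_lift (\<lambda>a w. oder V i a \<otimes>\<^sub>C w)
       else tensor_lift (\<lambda>a w. \<sigma> (der V a) \<otimes>\<^sub>C M (\<theta> i) w + \<sigma> a \<otimes>\<^sub>C d i w)),
     lbr = super_extension (\<lambda>a b w. coeff_map 0 (\<lambda>v. v \<otimes>\<^sub>C w) (lbr V a b)),
     vac = vac V \<otimes>\<^sub>C aone W,
     nop = super_extension (\<lambda>a b w. nop V a b \<otimes>\<^sub>C w)\<rparr>"

abbreviation "U \<equiv> tensor_va"
text \<open>Scalars are kept to the right of variables and coefficients; multiplying by one there is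
  an even map, which commutes with the variables and their derivatives without signs.\<close>

abbreviation "rho y p \<equiv> coeff_map 0 (\<lambda>v. v \<otimes>\<^sub>C y) p"
abbreviation "rho2 y Q \<equiv> coeff_map 0 (coeff_map 0 (\<lambda>v. v \<otimes>\<^sub>C y)) Q"

lemma part_U: "part U k = tensor_part k"
proof -
  have "tensor_part k = tensor_part (if even k then 0 else 1)"
    by (simp add: tensor_part_def)
  then show ?thesis
    by (simp add: part_def tensor_va_def)
qed

lemma vac_U: "vac U = vac V \<otimes>\<^sub>C aone W"
  by (simp add: tensor_va_def)

lemma clinear_rho: "clinear (rho y)"
  and clinear_rho2: "clinear (rho2 y)"
  by (intro clinear_coeff_map clinear_tens_left)+

lemma tens_linear: "bilinear (\<lambda>v y. v \<otimes>\<^sub>C y)"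
  by (intro bilinearI clinear_tens_left clinear_tens_right)

lemma rho_bilinear: "bilinear (\<lambda>p y. rho y p)"
  by (intro bilinearI clinear_rho clinear_coeff_map_param clinear_tens_right)

lemma rho2_bilinear: "bilinear (\<lambda>p y. rho2 y p)"
  by (intro bilinearI clinear_rho2 clinear_coeff_map_param clinear_tens_right)

lemma lbr_trilinear: "trilinear (\<lambda>a b w. rho w (lbr V a b))"
proof -
  have "bilinear (lbr V)"
    by (intro bilinearI lbr_linear_left[OF lca] lbr_linear_right[OF lca])
  then show ?thesis
    by (rule trilinear_comp_left[OF rho_bilinear])
qed

lemma nop_trilinear: "trilinear (\<lambda>a b w. nop V a b \<otimes>\<^sub>C w)"
  by (rule trilinear_comp_left[OF tens_linear nopV_bilinear])

lemma lbrU_bilinear: "bilinear (lbr U)"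
  and nopU_bilinear: "bilinear (nop U)"
  using super_extension_bilinear[OF lbr_trilinear] super_extension_bilinear[OF nop_trilinear]
  by (simp_all add: tensor_va_def)

lemma lbrU_tens:
  "w \<in> part W s \<Longrightarrow> b \<in> part V q \<Longrightarrow>
    lbr U (a \<otimes>\<^sub>C w) (b \<otimes>\<^sub>C x) = (- 1) ^ (s * q) *\<^sub>C rho (M w x) (lbr V a b)"
  using super_extension_tens[OF lbr_trilinear] by (simp add: tensor_va_def)

lemma nopU_tens:
  "w \<in> part W s \<Longrightarrow> b \<in> part V q \<Longrightarrow>
    nop U (a \<otimes>\<^sub>C w) (b \<otimes>\<^sub>C x) = (- 1) ^ (s * q) *\<^sub>C (nop V a b \<otimes>\<^sub>C M w x)"
  using super_extension_tens[OF nop_trilinear] by (simp add: tensor_va_def)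

lemma derU_linear: "clinear (der U)"
  and oderU_linear: "clinear (oder U i)"
  by (auto simp: tensor_va_def intro: clinear_tensor_lift)

lemma derU_tens: "der U (a \<otimes>\<^sub>C w) = der V a \<otimes>\<^sub>C w"
proof -
  have "bilinear (\<lambda>a (w :: 'w). der V a \<otimes>\<^sub>C w)"
    by (rule bilinear_comp_left[OF tens_linear derV_linear])
  then show ?thesis
    by (simp add: tensor_va_def tensor_lift_tens)
qed

lemma oderU_tens_low: "i \<in> {1..n} \<Longrightarrow> oder U i (a \<otimes>\<^sub>C w) = oder V i a \<otimes>\<^sub>C w"
proof -
  assume i: "i \<in> {1..n}"
  have "bilinear (\<lambda>a (w :: 'w). oder V i a \<otimes>\<^sub>C w)"
    by (rule bilinear_comp_left[OF tens_linear oderV_linear[OF i]])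
  then show ?thesis
    using i by (simp add: tensor_va_def tensor_lift_tens)
qed

lemma oderU_tens_high:
  assumes i: "n < i" and a: "a \<in> part V p"
  shows "oder U i (a \<otimes>\<^sub>C w) = (- 1) ^ p *\<^sub>C (der V a \<otimes>\<^sub>C M (\<theta> i) w + a \<otimes>\<^sub>C d i w)"
proof -
  have "bilinear (\<lambda>a w. \<sigma> (der V a) \<otimes>\<^sub>C M (\<theta> i) w)"
    using bilinear_comp_left[OF bilinear_comp_right[OF tens_linear bilinear_right[OF M_bilinear]]
        clinear_comp[OF \<sigma>_linear derV_linear]] .
  moreover have "bilinear (\<lambda>a w. \<sigma> a \<otimes>\<^sub>C d i w)"
    using bilinear_comp_left[OF bilinear_comp_right[OF tens_linear d_linear] \<sigma>_linear] .
  ultimately have "bilinear (\<lambda>a w. \<sigma> (der V a) \<otimes>\<^sub>C M (\<theta> i) w + \<sigma> a \<otimes>\<^sub>C d i w)"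
    by (rule bilinear_plus)
  then show ?thesis
    using i by (simp add: tensor_va_def tensor_lift_tens \<sigma>_part[OF a] \<sigma>_part[OF derV_part[OF a]]
        tens_scale_left cvec.scale_right_distrib)
qed

lemma tens_part: "a \<in> part V p \<Longrightarrow> w \<in> part W s \<Longrightarrow> even (p + s + k) \<Longrightarrow> a \<otimes>\<^sub>C w \<in> part U k"
  unfolding part_U tensor_part_def by (rule cvec.span_base) blast

lemma partU_subspace: "cvec.subspace (part U k)"
  unfolding part_U tensor_part_def by (rule cvec.subspace_span)

section \<open>Reduction of identities to homogeneous pure tensors\<close>

lemma part_in_subspaceI:
  assumes "x \<in> part U k" "cvec.subspace S"
    and "\<And>a w p s. a \<in> part V p \<Longrightarrow> w \<in> part W s \<Longrightarrow> even (p + s + k) \<Longrightarrow> a \<otimes>\<^sub>C w \<in> S"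
  shows "x \<in> S"
proof -
  have "tensor_part k \<subseteq> S"
    unfolding tensor_part_def by (rule cvec.span_minimal) (use assms(2,3) in auto)
  then show ?thesis
    using assms(1) by (auto simp: part_U)
qed

lemma in_subspaceI:
  assumes S: "cvec.subspace S"
    and hom: "\<And>a w p s. a \<in> part V p \<Longrightarrow> w \<in> part W s \<Longrightarrow> a \<otimes>\<^sub>C w \<in> S"
  shows "x \<in> S"
proof (rule tensor_in_subspace[OF S])
  fix a w
  have w: "w \<in> {w. a \<otimes>\<^sub>C w \<in> S}" if a: "a \<in> part V p" for a p
    by (rule part_in_subspace[OF nmW clinear_vimage_subspace[OF clinear_tens_right S]])
      (simp add: hom[OF a])
  have "a \<in> {a. a \<otimes>\<^sub>C w \<in> S}"
    by (rule part_in_subspace[OF nmV clinear_vimage_subspace[OF clinear_tens_left S]])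
      (use w in simp)
  then show "a \<otimes>\<^sub>C w \<in> S"
    by simp
qed

lemma part_eqI:
  assumes "clinear f" "clinear g" "x \<in> part U k"
    and "\<And>a w p s. a \<in> part V p \<Longrightarrow> w \<in> part W s \<Longrightarrow> even (p + s + k) \<Longrightarrow> f (a \<otimes>\<^sub>C w) = g (a \<otimes>\<^sub>C w)"
  shows "f x = g x"
  using part_in_subspaceI[OF assms(3) clinear_eq_subspace[OF assms(1,2)]] assms(4) by blast

lemma hom_eqI:
  assumes "clinear f" "clinear g"
    and "\<And>a w p s. a \<in> part V p \<Longrightarrow> w \<in> part W s \<Longrightarrow> f (a \<otimes>\<^sub>C w) = g (a \<otimes>\<^sub>C w)"
  shows "f x = g x"
  using in_subspaceI[OF clinear_eq_subspace[OF assms(1,2)]] assms(3) by blast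

text \<open>The axioms carry signs in the parities \<open>k\<close> and \<open>l\<close> of the
  arguments, whereas pure tensors come with the parities of their factors. The link is that
  \<open>p + s + k\<close> and \<open>q + t + l\<close> are even, so sign comparisons are made
  modulo 2.\<close>

lemma bilinear_part_eqI:
  assumes F: "bilinear F" and G: "bilinear G" and x: "x \<in> part U k" and y: "y \<in> part U l"
    and hom: "\<And>a w p s b z q t. a \<in> part V p \<Longrightarrow> w \<in> part W s \<Longrightarrow> even (p + s + k) \<Longrightarrow>
      b \<in> part V q \<Longrightarrow> z \<in> part W t \<Longrightarrow> even (q + t + l) \<Longrightarrow> F (a \<otimes>\<^sub>C w) (b \<otimes>\<^sub>C z) = G (a \<otimes>\<^sub>C w) (b \<otimes>\<^sub>C z)"
  shows "F x y = G x y"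
proof (rule part_eqI[OF bilinear_left[OF F] bilinear_left[OF G] x])
  fix a w p s
  assume aw: "a \<in> part V p" "w \<in> part W s" "even (p + s + k)"
  show "F (a \<otimes>\<^sub>C w) y = G (a \<otimes>\<^sub>C w) y"
    by (rule part_eqI[OF bilinear_right[OF F] bilinear_right[OF G] y]) (rule hom[OF aw])
qed

lemma bilinear_hom_eqI:
  assumes F: "bilinear F" and G: "bilinear G" and x: "x \<in> part U k"
    and hom: "\<And>a w p s b z q t. a \<in> part V p \<Longrightarrow> w \<in> part W s \<Longrightarrow> even (p + s + k) \<Longrightarrow>
      b \<in> part V q \<Longrightarrow> z \<in> part W t \<Longrightarrow> F (a \<otimes>\<^sub>C w) (b \<otimes>\<^sub>C z) = G (a \<otimes>\<^sub>C w) (b \<otimes>\<^sub>C z)"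
  shows "F x y = G x y"
proof (rule part_eqI[OF bilinear_left[OF F] bilinear_left[OF G] x])
  fix a w p s
  assume aw: "a \<in> part V p" "w \<in> part W s" "even (p + s + k)"
  show "F (a \<otimes>\<^sub>C w) y = G (a \<otimes>\<^sub>C w) y"
    by (rule hom_eqI[OF bilinear_right[OF F] bilinear_right[OF G]]) (rule hom[OF aw])
qed

lemma trilinear_part_eqI:
  assumes F: "trilinear F" and G: "trilinear G" and x: "x \<in> part U k" and y: "y \<in> part U l"
    and hom: "\<And>a w p s b v q t c z r u. a \<in> part V p \<Longrightarrow> w \<in> part W s \<Longrightarrow> even (p + s + k) \<Longrightarrow>
      b \<in> part V q \<Longrightarrow> v \<in> part W t \<Longrightarrow> even (q + t + l) \<Longrightarrow> c \<in> part V r \<Longrightarrow> z \<in> part W u \<Longrightarrow>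
      F (a \<otimes>\<^sub>C w) (b \<otimes>\<^sub>C v) (c \<otimes>\<^sub>C z) = G (a \<otimes>\<^sub>C w) (b \<otimes>\<^sub>C v) (c \<otimes>\<^sub>C z)"
  shows "F x y c' = G x y c'"
proof (rule part_eqI[OF trilinear_1[OF F] trilinear_1[OF G] x])
  fix a w p s
  assume aw: "a \<in> part V p" "w \<in> part W s" "even (p + s + k)"
  show "F (a \<otimes>\<^sub>C w) y c' = G (a \<otimes>\<^sub>C w) y c'"
    by (rule bilinear_hom_eqI[OF _ _ y])
      (use F G hom[OF aw] in \<open>auto simp: trilinear_def\<close>)
qed

section \<open>The underlying superalgebra\<close>

lemma derU_part: "x \<in> part U k \<Longrightarrow> der U x \<in> part U k"
proof -
  assume x: "x \<in> part U k"
  have "x \<in> {x. der U x \<in> part U k}"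
    by (rule part_in_subspaceI[OF x clinear_vimage_subspace[OF derU_linear partU_subspace]])
      (auto simp: derU_tens intro!: tens_part derV_part)
  then show ?thesis
    by simp
qed

lemma oderU_part:
  assumes "i \<ge> 1" and x: "x \<in> part U k"
  shows "oder U i x \<in> part U (Suc k)"
proof -
  have "x \<in> {x. oder U i x \<in> part U (Suc k)}"
  proof (rule part_in_subspaceI[OF x clinear_vimage_subspace[OF oderU_linear partU_subspace]])
    fix a w p s
    assume *: "a \<in> part V p" "w \<in> part W s" "even (p + s + k)"
    show "a \<otimes>\<^sub>C w \<in> {x. oder U i x \<in> part U (Suc k)}"
    proof (cases "i \<le> n")
      case True
      then have i: "i \<in> {1..n}"
        using assms(1) by simp
      have "oder V i a \<otimes>\<^sub>C w \<in> part U (Suc k)"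
        by (rule tens_part[OF oderV_part[OF i *(1)] *(2)]) (use *(3) in simp)
      then show ?thesis
        by (simp add: oderU_tens_low[OF i])
    next
      case False
      have "der V a \<otimes>\<^sub>C M (\<theta> i) w \<in> part U (Suc k)"
        by (rule tens_part[OF derV_part[OF *(1)] M_part[OF \<theta>_odd *(2)]]) (use *(3) in simp)
      moreover have "a \<otimes>\<^sub>C d i w \<in> part U (Suc k)"
        by (rule tens_part[OF *(1) d_part[OF *(2)]]) (use *(3) in simp)
      ultimately show ?thesis
        using False by (simp add: oderU_tens_high[OF _ *(1)] cvec.subspace_add[OF partU_subspace]
            cvec.subspace_scale[OF partU_subspace])
    qed
  qed
  then show ?thesis
    by simp
qed

lemma oderU_derU: "i \<ge> 1 \<Longrightarrow> oder U i (der U x) = der U (oder U i x)"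
proof (rule hom_eqI[where x = x])
  fix a w p s
  assume i: "i \<ge> 1" and a: "a \<in> part V p"
  show "oder U i (der U (a \<otimes>\<^sub>C w)) = der U (oder U i (a \<otimes>\<^sub>C w))"
    using i by (cases "i \<le> n")
      (simp_all add: derU_tens oderU_tens_low oderU_tens_high[OF _ a] oderU_tens_high[OF _ derV_part[OF a]]
        oderV_der clinear_scale[OF derU_linear] clinear_add[OF derU_linear])
qed (auto intro: clinear_comp derU_linear oderU_linear)

lemma \<theta>_anticomm: "M (\<theta> i) (M (\<theta> j) w) + M (\<theta> j) (M (\<theta> i) w) = 0"
proof -
  have "M (\<theta> i) (\<theta> j) = - M (\<theta> j) (\<theta> i)"
    using M_comm[OF \<theta>_odd \<theta>_odd, of i j] by simp
  then show ?thesis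
    by (simp flip: M_assoc add: clinear_neg[OF bilinear_left[OF M_bilinear]])
qed

lemma d_\<theta>_mult: "d i (M (\<theta> j) w) = (if i = j then w else 0) - M (\<theta> j) (d i w)"
  by (simp add: d_mult[OF \<theta>_odd] d_\<theta> M_one clinear_zero[OF bilinear_left[OF M_bilinear]])

text \<open>A low \<open>D^i\<close> acts on \<open>V\<close> alone and shifts the parity of
  \<open>a\<close> by one, which flips the sign in a high \<open>D^j\<close>. For two high ones the
  \<theta>\<theta> and \<open>d d\<close> parts cancel, and the mixed parts leave one \<partial>
  from each order when \<open>i = j\<close>.\<close>

lemma oderU_anticomm:
  assumes "i \<ge> 1" "j \<ge> 1"
  shows "oder U i (oder U j x) + oder U j (oder U i x) = (if i = j then 2 *\<^sub>C der U x else 0)"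
proof (rule hom_eqI[where x = x])
  fix a w p s
  assume a: "a \<in> part V p" and w: "w \<in> part W s"
  note simps = clinear_scale[OF oderU_linear] clinear_add[OF oderU_linear] clinear_neg[OF oderU_linear]
    tens_scale_left tens_scale_right
  have low_high: "oder U i (oder U j (a \<otimes>\<^sub>C w)) + oder U j (oder U i (a \<otimes>\<^sub>C w)) = 0"
    if i: "i \<in> {1..n}" and j: "n < j" for i j
    by (simp add: oderU_tens_low[OF i] oderU_tens_high[OF j a] oderU_tens_high[OF j oderV_part[OF i a]]
        simps oderV_der[OF i])
  \<comment> \<open>The product of \<theta>^i \<partial> + \<open>d i\<close> and \<theta>^j
    \<partial> + \<open>d j\<close>, expanded. The two parity signs cancel, as neither factor
    changes the parity of \<open>a\<close>.\<close>
  have high: "oder U i (oder U j (a \<otimes>\<^sub>C w)) =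
      der V (der V a) \<otimes>\<^sub>C M (\<theta> i) (M (\<theta> j) w) + a \<otimes>\<^sub>C d i (d j w)
      + der V a \<otimes>\<^sub>C (M (\<theta> i) (d j w) - M (\<theta> j) (d i w)) + (if i = j then der V a \<otimes>\<^sub>C w else 0)"
    if i: "n < i" and j: "n < j" for i j
    by (simp add: oderU_tens_high[OF j a] oderU_tens_high[OF i a] oderU_tens_high[OF i derV_part[OF a]] simps
        d_\<theta>_mult clinear_zero[OF clinear_tens_right] clinear_diff[OF clinear_tens_right] clinear_neg[OF clinear_tens_right]
        tens_add_right cvec.scale_right_distrib cvec.scale_right_diff_distrib minus_one_power_iff)
  show "oder U i (oder U j (a \<otimes>\<^sub>C w)) + oder U j (oder U i (a \<otimes>\<^sub>C w)) =
      (if i = j then 2 *\<^sub>C der U (a \<otimes>\<^sub>C w) else 0)"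
  proof (cases "i \<le> n"; cases "j \<le> n")
    assume "i \<le> n" "j \<le> n"
    then have ij: "i \<in> {1..n}" "j \<in> {1..n}"
      using assms by auto
    have "oder U i (oder U j (a \<otimes>\<^sub>C w)) + oder U j (oder U i (a \<otimes>\<^sub>C w)) =
        (oder V i (oder V j a) + oder V j (oder V i a)) \<otimes>\<^sub>C w"
      by (simp only: oderU_tens_low[OF ij(1)] oderU_tens_low[OF ij(2)] tens_add_left)
    then show ?thesis
      by (simp add: oderV_anticomm[OF ij] derU_tens tens_scale_left clinear_zero[OF clinear_tens_left])
  next
    assume "i \<le> n" "\<not> j \<le> n"
    then show ?thesis
      using low_high[of i j] assms by auto
  next
    assume "\<not> i \<le> n" "j \<le> n"
    then show ?thesis
      using low_high[of j i] assms by (auto simp: add.commute)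
  next
    assume "\<not> i \<le> n" "\<not> j \<le> n"
    then have ij: "n < i" "n < j"
      by auto
    have "der V (der V a) \<otimes>\<^sub>C M (\<theta> i) (M (\<theta> j) w) + der V (der V a) \<otimes>\<^sub>C M (\<theta> j) (M (\<theta> i) w) = 0"
      by (simp flip: tens_add_right add: \<theta>_anticomm clinear_zero[OF clinear_tens_right])
    moreover have "a \<otimes>\<^sub>C d i (d j w) + a \<otimes>\<^sub>C d j (d i w) = 0"
      by (simp flip: tens_add_right add: d_anticomm clinear_zero[OF clinear_tens_right])
    moreover have "2 *\<^sub>C (der V a \<otimes>\<^sub>C w) = der V a \<otimes>\<^sub>C w + der V a \<otimes>\<^sub>C w"
      by (metis one_add_one scaleC_add_left scaleC_one)
    ultimately show ?thesis
      by (simp add: high[OF ij] high[OF ij(2,1)] derU_tens clinear_diff[OF clinear_tens_right]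
          eq_neg_iff_add_eq_0[symmetric])
  qed
next
  show "clinear (\<lambda>x. oder U i (oder U j x) + oder U j (oder U i x))"
    by (rule clinear_plus; rule clinear_comp[OF oderU_linear oderU_linear])
  show "clinear (\<lambda>x. if i = j then 2 *\<^sub>C der U x else 0)"
    by (intro clinear_intros derU_linear)
qed

lemma is_nabla_module_U: "is_nabla_module m U"
proof -
  \<comment> \<open>The parity involution of the tensor product: it acts by \<open>(-1)^k\<close> on
    \<open>part U k\<close>, so an element of both parts equals its own negative.\<close>
  let ?\<tau> = "tensor_lift (\<lambda>a w. \<sigma> a \<otimes>\<^sub>C parity_map W w)"
  have "bilinear (\<lambda>a w. \<sigma> a \<otimes>\<^sub>C parity_map W w)"
    using bilinear_comp_left[OF bilinear_comp_right[OF tens_linear clinear_parity_map[OF nmW]] \<sigma>_linear] .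
  note bil = this
  have \<tau>: "?\<tau> x = (- 1) ^ k *\<^sub>C x" if "x \<in> part U k" for x k
    by (rule part_eqI[OF clinear_tensor_lift clinear_scaled[OF clinear_id] that])
      (auto simp: tensor_lift_tens[OF bil] \<sigma>_part parity_map_part[OF nmW] tens_scale_left tens_scale_right
        minus_one_power_iff)
  have "even_part U \<inter> odd_part U = {0}"
  proof -
    have "x = 0" if "x \<in> even_part U" "x \<in> odd_part U" for x
    proof -
      have "x = - x"
        using \<tau>[of x 0] \<tau>[of x 1] that by (simp add: part_def)
      then have "(1 + 1) *\<^sub>C x = 0"
        by (simp only: scaleC_add_left scaleC_one eq_neg_iff_add_eq_0)
      then show ?thesis
        by simp
    qed
    then show ?thesis
      using cvec.subspace_0[OF partU_subspace[of 0]] cvec.subspace_0[OF partU_subspace[of 1]]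
      by (auto simp: part_def)
  qed
  moreover have "\<exists>x\<in>even_part U. \<exists>y\<in>odd_part U. v = x + y" for v
  proof -
    have "v \<in> {x + y | x y. x \<in> part U 0 \<and> y \<in> part U 1}"
    proof (rule in_subspaceI[OF cvec.subspace_sums[OF partU_subspace partU_subspace]])
      fix a w p s
      assume *: "a \<in> part V p" "w \<in> part W s"
      show "a \<otimes>\<^sub>C w \<in> {x + y | x y. x \<in> part U 0 \<and> y \<in> part U 1}"
      proof (cases "even (p + s)")
        case True
        then have "a \<otimes>\<^sub>C w \<in> part U 0"
          by (intro tens_part[OF *]) simp
        then show ?thesis
          using cvec.subspace_0[OF partU_subspace[of 1]]
          by (intro CollectI exI[of _ "a \<otimes>\<^sub>C w"] exI[of _ 0]) simp
      next
        case False
        then have "a \<otimes>\<^sub>C w \<in> part U 1"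
          by (intro tens_part[OF *]) simp
        then show ?thesis
          using cvec.subspace_0[OF partU_subspace[of 0]]
          by (intro CollectI exI[of _ "a \<otimes>\<^sub>C w"] exI[of _ 0]) simp
      qed
    qed
    then show ?thesis
      by (auto simp: part_def)
  qed
  ultimately show ?thesis
    unfolding is_nabla_module_def
    using partU_subspace derU_linear oderU_linear derU_part oderU_part oderU_derU oderU_anticomm
    by simp
qed

end

context scalar_extension
begin

lemma nopU_part: "x \<in> part U k \<Longrightarrow> y \<in> part U l \<Longrightarrow> nop U x y \<in> part U (k + l)"
proof -
  assume x: "x \<in> part U k" and y: "y \<in> part U l"
  have "nop U (a \<otimes>\<^sub>C w) y \<in> part U (k + l)"
    if aw: "a \<in> part V p" "w \<in> part W s" "even (p + s + k)" for a w p s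
  proof -
    have "y \<in> {y. nop U (a \<otimes>\<^sub>C w) y \<in> part U (k + l)}"
    proof (rule part_in_subspaceI[OF y clinear_vimage_subspace[OF bilinear_right[OF nopU_bilinear] partU_subspace]])
      fix b v q t
      assume bv: "b \<in> part V q" "v \<in> part W t" "even (q + t + l)"
      have "nop V a b \<otimes>\<^sub>C M w v \<in> part U (k + l)"
        by (rule tens_part[OF nopV_part[OF aw(1) bv(1)] M_part[OF aw(2) bv(2)]]) (use aw bv in auto)
      then show "b \<otimes>\<^sub>C v \<in> {y. nop U (a \<otimes>\<^sub>C w) y \<in> part U (k + l)}"
        by (simp add: nopU_tens[OF aw(2) bv(1)] cvec.subspace_scale[OF partU_subspace])
    qed
    then show ?thesis
      by simp
  qed
  then have "x \<in> {x. nop U x y \<in> part U (k + l)}"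
    by (intro part_in_subspaceI[OF x clinear_vimage_subspace[OF bilinear_left[OF nopU_bilinear] partU_subspace]]) simp
  then show ?thesis
    by simp
qed

lemma nopU_vac: "nop U (vac U) x = x" "nop U x (vac U) = x"
proof -
  show "nop U (vac U) x = x"
    by (rule hom_eqI[where x = x, OF bilinear_right[OF nopU_bilinear] clinear_id])
      (simp add: vac_U nopU_tens[OF aone_even] nopV_vac M_one)
  show "nop U x (vac U) = x"
    by (rule hom_eqI[where x = x, OF bilinear_left[OF nopU_bilinear] clinear_id])
      (simp add: vac_U nopU_tens[OF _ vac_even] nopV_vac M_one)
qed

lemma derU_nopU: "der U (nop U x y) = nop U (der U x) y + nop U x (der U y)"
proof -
  have bil: "bilinear (\<lambda>x y. der U (nop U x y))"
    "bilinear (\<lambda>x y. nop U (der U x) y + nop U x (der U y))"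
    by (intro bilinear_comp[OF derU_linear] bilinear_plus bilinear_comp_left[OF _ derU_linear]
        bilinear_comp_right[OF _ derU_linear] nopU_bilinear)+
  show ?thesis
  proof (rule hom_eqI[OF bilinear_left[OF bil(1)] bilinear_left[OF bil(2)]])
    fix a w p s
    assume w: "w \<in> part W s"
    show "der U (nop U (a \<otimes>\<^sub>C w) y) = nop U (der U (a \<otimes>\<^sub>C w)) y + nop U (a \<otimes>\<^sub>C w) (der U y)"
      by (rule hom_eqI[OF bilinear_right[OF bil(1)] bilinear_right[OF bil(2)]])
        (simp add: nopU_tens[OF w] nopU_tens[OF w derV_part] derU_tens clinear_scale[OF derU_linear]
          nopV_der tens_add_left cvec.scale_right_distrib)
  qed
qed

lemma M_odd_left: "w \<in> part W s \<Longrightarrow> M w (M (\<theta> i) x) = (- 1) ^ s *\<^sub>C M (\<theta> i) (M w x)"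
  using M_comm[OF _ \<theta>_odd, of w s i]
  by (simp flip: M_assoc add: clinear_scale[OF bilinear_left[OF M_bilinear]])

lemma oderU_nopU:
  assumes i: "i \<ge> 1" and x: "x \<in> part U k"
  shows "oder U i (nop U x y) = nop U (oder U i x) y + (- 1) ^ k *\<^sub>C nop U x (oder U i y)"
proof (rule bilinear_hom_eqI[where F = "\<lambda>x y. oder U i (nop U x y)" and
      G = "\<lambda>x y. nop U (oder U i x) y + (- 1) ^ k *\<^sub>C nop U x (oder U i y)", OF _ _ x])
  show "bilinear (\<lambda>x y. oder U i (nop U x y))"
    by (rule bilinear_comp[OF oderU_linear nopU_bilinear])
  show "bilinear (\<lambda>x y. nop U (oder U i x) y + (- 1) ^ k *\<^sub>C nop U x (oder U i y))"
    by (intro bilinear_plus bilinear_scaled bilinear_comp_left[OF nopU_bilinear oderU_linear]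
        bilinear_comp_right[OF nopU_bilinear oderU_linear])
  fix a w p s b z q t
  assume a: "a \<in> part V p" and w: "w \<in> part W s" and ps: "even (p + s + k)"
    and b: "b \<in> part V q" and z: "z \<in> part W t"
  have k: "(- 1 :: complex) ^ k = (- 1) ^ (p + s)"
    using ps by (intro minus_one_power_eqI) auto
  show "oder U i (nop U (a \<otimes>\<^sub>C w) (b \<otimes>\<^sub>C z)) =
      nop U (oder U i (a \<otimes>\<^sub>C w)) (b \<otimes>\<^sub>C z) + (- 1) ^ k *\<^sub>C nop U (a \<otimes>\<^sub>C w) (oder U i (b \<otimes>\<^sub>C z))"
  proof (cases "i \<le> n")
    case True
    then have i: "i \<in> {1..n}"
      using i by simp
    show ?thesis
      unfolding k nopU_tens[OF w b] oderU_tens_low[OF i] clinear_scale[OF oderU_linear]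
        nopU_tens[OF w oderV_part[OF i b]] nopV_oder[OF i a]
      by (simp add: tens_add_left tens_scale_left cvec.scale_right_distrib minus_one_power_iff)
  next
    case False
    then have i: "n < i"
      by simp
    note simps = clinear_add[OF bilinear_left[OF nopU_bilinear]] clinear_add[OF bilinear_right[OF nopU_bilinear]]
      clinear_scale[OF bilinear_left[OF nopU_bilinear]] clinear_scale[OF bilinear_right[OF nopU_bilinear]]
    show ?thesis
      unfolding k nopU_tens[OF w b] oderU_tens_high[OF i a] oderU_tens_high[OF i b]
        oderU_tens_high[OF i nopV_part[OF a b]] clinear_scale[OF oderU_linear] simps
        nopU_tens[OF w derV_part[OF b]] nopU_tens[OF M_part[OF \<theta>_odd w] b] nopU_tens[OF d_part[OF w] b]
        M_assoc M_odd_left[OF w] d_mult[OF w] nopV_der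
      by (simp add: tens_add_left tens_add_right tens_scale_right cvec.scale_right_distrib minus_one_power_iff)
  qed
qed

lemma unital_diff_superalgebra_U: "unital_diff_superalgebra m U (vac U) (nop U)"
proof -
  have "vac U \<in> even_part U"
    using tens_part[OF vac_even aone_even, of 0] by (simp add: vac_U part_def)
  then show ?thesis
    unfolding unital_diff_superalgebra_def
    using is_nabla_module_U nopU_bilinear nopU_part nopU_vac derU_nopU oderU_nopU
    by (simp add: bilinear_def)
qed

section \<open>The bracket on the tensor product\<close>

lemma lookup_rho: "Poly_Mapping.lookup (rho y p) (m, I) = Poly_Mapping.lookup p (m, I) \<otimes>\<^sub>C y"
  by (simp add: lookup_coeff_map clinear_zero[OF clinear_tens_left])

lemma lbrU_in_subspace:
  assumes S: "cvec.subspace S" and x: "x \<in> part U k" and y: "y \<in> part U l"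
    and hom: "\<And>a w p s b z q t. a \<in> part V p \<Longrightarrow> w \<in> part W s \<Longrightarrow> even (p + s + k) \<Longrightarrow>
      b \<in> part V q \<Longrightarrow> z \<in> part W t \<Longrightarrow> even (q + t + l) \<Longrightarrow> rho (M w z) (lbr V a b) \<in> S"
  shows "lbr U x y \<in> S"
proof -
  have "lbr U (a \<otimes>\<^sub>C w) y \<in> S" if aw: "a \<in> part V p" "w \<in> part W s" "even (p + s + k)" for a w p s
  proof -
    have "y \<in> {y. lbr U (a \<otimes>\<^sub>C w) y \<in> S}"
    proof (rule part_in_subspaceI[OF y clinear_vimage_subspace[OF bilinear_right[OF lbrU_bilinear] S]])
      fix b z q t
      assume bz: "b \<in> part V q" "z \<in> part W t" "even (q + t + l)"
      show "b \<otimes>\<^sub>C z \<in> {y. lbr U (a \<otimes>\<^sub>C w) y \<in> S}"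
        using cvec.subspace_scale[OF S hom[OF aw bz]] by (simp only: lbrU_tens[OF aw(2) bz(1)] mem_Collect_eq)
    qed
    then show ?thesis
      by simp
  qed
  then have "x \<in> {x. lbr U x y \<in> S}"
    by (intro part_in_subspaceI[OF x clinear_vimage_subspace[OF bilinear_left[OF lbrU_bilinear] S]]) simp
  then show ?thesis
    by simp
qed

lemma lam_supp_subspace: "cvec.subspace {p :: 'a::complex_vector lam. lam_supp \<A> p}"
  by (auto simp: cvec.subspace_def intro: lam_supp_add lam_supp_scale)

lemma lbrU_below: "lam_below n (lbr U x y)"
proof -
  have S: "cvec.subspace {p :: ('v, 'w) tensor lam. lam_below n p}"
    by (rule lam_supp_subspace)
  have left: "lbr U (a \<otimes>\<^sub>C w) y \<in> Collect (lam_below n)" if "w \<in> part W s" for a w s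
  proof -
    have "y \<in> {y. lbr U (a \<otimes>\<^sub>C w) y \<in> Collect (lam_below n)}"
      by (rule in_subspaceI[OF clinear_vimage_subspace[OF bilinear_right[OF lbrU_bilinear] S]])
        (simp only: lbrU_tens[OF that] mem_Collect_eq, intro lam_supp_scale lam_supp_coeff_map lbr_below[OF lca])
    then show ?thesis
      by simp
  qed
  have "x \<in> {x. lbr U x y \<in> Collect (lam_below n)}"
    by (rule in_subspaceI[OF clinear_vimage_subspace[OF bilinear_left[OF lbrU_bilinear] S]])
      (use left in blast)
  then show ?thesis
    by simp
qed

lemma lbrU_part:
  assumes x: "x \<in> part U k" and y: "y \<in> part U l"
  shows "Poly_Mapping.lookup (lbr U x y) (m, I) \<in> part U (k + l + n + card I)"
proof -
  have "lbr U x y \<in> {p. Poly_Mapping.lookup p (m, I) \<in> part U (k + l + n + card I)}"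
  proof (rule lbrU_in_subspace[OF _ x y])
    show "cvec.subspace {p. Poly_Mapping.lookup p (m, I) \<in> part U (k + l + n + card I)}"
      by (rule clinear_vimage_subspace[OF clinear_lookup partU_subspace])
    fix a w p s b z q t
    assume *: "a \<in> part V p" "w \<in> part W s" "even (p + s + k)" "b \<in> part V q" "z \<in> part W t" "even (q + t + l)"
    have "Poly_Mapping.lookup (lbr V a b) (m, I) \<otimes>\<^sub>C M w z \<in> part U (k + l + n + card I)"
      by (rule tens_part[OF lbr_part[OF lca *(1,4)] M_part[OF *(2,5)]]) (use * in auto)
    then show "rho (M w z) (lbr V a b) \<in> {p. Poly_Mapping.lookup p (m, I) \<in> part U (k + l + n + card I)}"
      by (simp add: lookup_rho)
  qed
  then show ?thesis
    by simp
qed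

lemma lam_mult_rho: "lam_mult (rho y p) = rho y (lam_mult p)"
  by (rule coeff_map_lam_mult[OF clinear_tens_left, symmetric])

lemma chi_mult_rho: "chi_mult i (rho y p) = rho y (chi_mult i p)"
  by (rule coeff_map_0_chi_mult[OF clinear_tens_left, symmetric])

lemma chi_deriv_rho: "chi_deriv i (rho y p) = rho y (chi_deriv i p)"
  by (rule coeff_map_0_chi_deriv[OF clinear_tens_left, symmetric])

lemma lam_der_rho: "lam_der U (rho y p) = rho y (lam_der V p)"
  by (simp add: lam_der_def coeff_map_coeff_map derU_linear derV_linear clinear_zero
      clinear_zero[OF clinear_tens_left] clinear_tens_left derU_tens)

lemma lam_oder_rho: "i \<in> {1..n} \<Longrightarrow> lam_oder U i (rho y p) = rho y (lam_oder V i p)"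
proof -
  assume i: "i \<in> {1..n}"
  have "coeff_map 1 (oder U i) (rho y p) = rho y (coeff_map 1 (oder V i) p)"
    using i by (subst (1 2) coeff_map_coeff_map)
      (simp_all only: oderU_linear oderV_linear clinear_zero clinear_zero[OF clinear_tens_left]
        clinear_tens_left oderU_tens_low add_0_left add_0_right)
  then show ?thesis
    by (simp add: lam_oder_def chi_deriv_rho lam_mult_rho clinear_add[OF clinear_rho] clinear_scale[OF clinear_rho])
qed

lemmas rho_linear_simps = clinear_add[OF clinear_rho] clinear_diff[OF clinear_rho] clinear_neg[OF clinear_rho]
  clinear_scale[OF clinear_rho]

lemma lbrU_der_left: "lbr U (der U x) y = - lam_mult (lbr U x y)"
proof -
  have bil: "bilinear (\<lambda>x y. lbr U (der U x) y)" "bilinear (\<lambda>x y. - lam_mult (lbr U x y))"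
    by (intro bilinear_comp[OF clinear_uminus[OF clinear_lam_mult]] bilinear_comp_left[OF _ derU_linear]
        lbrU_bilinear)+
  show ?thesis
  proof (rule hom_eqI[OF bilinear_left[OF bil(1)] bilinear_left[OF bil(2)]])
    fix a w p s
    assume w: "w \<in> part W s"
    show "lbr U (der U (a \<otimes>\<^sub>C w)) y = - lam_mult (lbr U (a \<otimes>\<^sub>C w) y)"
      by (rule hom_eqI[OF bilinear_right[OF bil(1)] bilinear_right[OF bil(2)]])
        (simp add: lbrU_tens[OF w] derU_tens lbr_der_left[OF lca] ops_linear_simps lam_mult_rho rho_linear_simps)
  qed
qed

lemma lbrU_der_right: "lbr U x (der U y) = lam_der U (lbr U x y) + lam_mult (lbr U x y)"
proof -
  have lin: "clinear (\<lambda>p. lam_der U p + lam_mult p)"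
    unfolding lam_der_def by (intro clinear_intros clinear_lam_mult clinear_coeff_map derU_linear)
  have bil: "bilinear (\<lambda>x y. lbr U x (der U y))" "bilinear (\<lambda>x y. lam_der U (lbr U x y) + lam_mult (lbr U x y))"
    by (intro bilinear_comp[OF lin] bilinear_comp_right[OF _ derU_linear] lbrU_bilinear)+
  show ?thesis
  proof (rule hom_eqI[OF bilinear_left[OF bil(1)] bilinear_left[OF bil(2)]])
    fix a w p s
    assume w: "w \<in> part W s"
    show "lbr U (a \<otimes>\<^sub>C w) (der U y) = lam_der U (lbr U (a \<otimes>\<^sub>C w) y) + lam_mult (lbr U (a \<otimes>\<^sub>C w) y)"
    proof (rule hom_eqI[OF bilinear_right[OF bil(1)] bilinear_right[OF bil(2)]])
      fix b z q t
      assume b: "b \<in> part V q"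
      show "lbr U (a \<otimes>\<^sub>C w) (der U (b \<otimes>\<^sub>C z)) =
          lam_der U (lbr U (a \<otimes>\<^sub>C w) (b \<otimes>\<^sub>C z)) + lam_mult (lbr U (a \<otimes>\<^sub>C w) (b \<otimes>\<^sub>C z))"
        unfolding derU_tens lbrU_tens[OF w b] lbrU_tens[OF w derV_part[OF b]] lbr_der_right[OF lca]
          clinear_scale[OF clinear_lam_mult] lam_mult_rho rho_linear_simps
        by (simp only: lam_der_def coeff_map_linear_simps[OF derU_linear] lam_der_rho[unfolded lam_der_def]
            cvec.scale_right_distrib)
    qed
  qed
qed

lemma lbrU_oder_left:
  assumes i: "i \<in> {1..n}"
  shows "lbr U (oder U i x) y = (- 1) ^ (n + 1) *\<^sub>C chi_mult i (lbr U x y)"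
proof -
  have bil: "bilinear (\<lambda>x y. lbr U (oder U i x) y)" "bilinear (\<lambda>x y. (- 1) ^ (n + 1) *\<^sub>C chi_mult i (lbr U x y))"
    by (intro bilinear_scaled bilinear_comp[OF clinear_chi_mult] bilinear_comp_left[OF _ oderU_linear]
        lbrU_bilinear)+
  show ?thesis
  proof (rule hom_eqI[OF bilinear_left[OF bil(1)] bilinear_left[OF bil(2)]])
    fix a w p s
    assume w: "w \<in> part W s"
    show "lbr U (oder U i (a \<otimes>\<^sub>C w)) y = (- 1) ^ (n + 1) *\<^sub>C chi_mult i (lbr U (a \<otimes>\<^sub>C w) y)"
      by (rule hom_eqI[OF bilinear_right[OF bil(1)] bilinear_right[OF bil(2)]])
        (simp add: lbrU_tens[OF w] oderU_tens_low[OF i] lbr_oder_left[OF lca i] ops_linear_simps chi_mult_rho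
          rho_linear_simps minus_one_power_iff)
  qed
qed

lemma lbrU_oder_right:
  assumes i: "i \<in> {1..n}" and x: "x \<in> part U k"
  shows "lbr U x (oder U i y) = (- 1) ^ (k + n) *\<^sub>C (lam_oder U i (lbr U x y) + chi_mult i (lbr U x y))"
proof (rule bilinear_hom_eqI[where F = "\<lambda>x y. lbr U x (oder U i y)" and
      G = "\<lambda>x y. (- 1) ^ (k + n) *\<^sub>C (lam_oder U i (lbr U x y) + chi_mult i (lbr U x y))", OF _ _ x])
  note lin = clinear_lam_oder[where M = U, OF oderU_linear]
  show "bilinear (\<lambda>x y. lbr U x (oder U i y))"
    by (rule bilinear_comp_right[OF lbrU_bilinear oderU_linear])
  show "bilinear (\<lambda>x y. (- 1) ^ (k + n) *\<^sub>C (lam_oder U i (lbr U x y) + chi_mult i (lbr U x y)))"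
    by (intro bilinear_scaled bilinear_plus bilinear_comp[OF clinear_chi_mult] bilinear_comp[OF lin] lbrU_bilinear)
  fix a w p s b z q t
  assume a: "a \<in> part V p" and w: "w \<in> part W s" and ps: "even (p + s + k)"
    and b: "b \<in> part V q" and z: "z \<in> part W t"
  have k: "(- 1 :: complex) ^ (k + n) = (- 1) ^ (p + s + n)"
    using ps by (intro minus_one_power_eqI) auto
  show "lbr U (a \<otimes>\<^sub>C w) (oder U i (b \<otimes>\<^sub>C z)) =
      (- 1) ^ (k + n) *\<^sub>C (lam_oder U i (lbr U (a \<otimes>\<^sub>C w) (b \<otimes>\<^sub>C z)) + chi_mult i (lbr U (a \<otimes>\<^sub>C w) (b \<otimes>\<^sub>C z)))"
    unfolding k lbrU_tens[OF w b] lbrU_tens[OF w oderV_part[OF i b]] oderU_tens_low[OF i]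
      lbr_oder_right[OF lca i a] clinear_scale[OF lin] clinear_scale[OF clinear_chi_mult]
      lam_oder_rho[OF i] chi_mult_rho rho_linear_simps
    by (simp add: minus_one_power_iff)
qed

lemma odd_bracket_derivation_U:
  assumes i: "n < i"
  shows "odd_bracket_derivation n U i"
  unfolding odd_bracket_derivation_def
proof (intro allI ballI)
  fix k x y
  assume x: "x \<in> part U k"
  show "coeff_map 1 (oder U i) (lbr U x y) =
      (- 1) ^ n *\<^sub>C (lbr U (oder U i x) y + (- 1) ^ k *\<^sub>C lbr U x (oder U i y))"
  proof (rule bilinear_hom_eqI[where F = "\<lambda>x y. coeff_map 1 (oder U i) (lbr U x y)" and
        G = "\<lambda>x y. (- 1) ^ n *\<^sub>C (lbr U (oder U i x) y + (- 1) ^ k *\<^sub>C lbr U x (oder U i y))", OF _ _ x])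
    show "bilinear (\<lambda>x y. coeff_map 1 (oder U i) (lbr U x y))"
      by (rule bilinear_comp[OF clinear_coeff_map[OF oderU_linear] lbrU_bilinear])
    show "bilinear (\<lambda>x y. (- 1) ^ n *\<^sub>C (lbr U (oder U i x) y + (- 1) ^ k *\<^sub>C lbr U x (oder U i y)))"
      by (intro bilinear_scaled bilinear_plus bilinear_comp_left[OF lbrU_bilinear oderU_linear]
          bilinear_comp_right[OF lbrU_bilinear oderU_linear])
    fix a w p s b z q t
    assume a: "a \<in> part V p" and w: "w \<in> part W s" and ps: "even (p + s + k)"
      and b: "b \<in> part V q" and z: "z \<in> part W t"
    have k: "(- 1 :: complex) ^ k = (- 1) ^ (p + s)"
      using ps by (intro minus_one_power_eqI) auto
    \<comment> \<open>The coefficient at the index set \<open>I\<close> has parity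
      \<open>p + q + n + card I\<close>; the contribution of \<open>card I\<close> is cancelled by
      the sign of moving the odd operator past the variables of \<open>I\<close>.\<close>
    have oder_rho: "coeff_map 1 (oder U i) (rho y (lbr V a b)) =
        (- 1) ^ (p + q + n) *\<^sub>C (rho (M (\<theta> i) y) (lam_der V (lbr V a b)) + rho (d i y) (lbr V a b))" for y
    proof (rule poly_mapping_eqI, unfold split_paired_all)
      fix m I
      have "Poly_Mapping.lookup (lbr V a b) (m, I) \<in> part V (p + q + n + card I)"
        by (rule lbr_part[OF lca a b])
      then show "Poly_Mapping.lookup (coeff_map 1 (oder U i) (rho y (lbr V a b))) (m, I) =
          Poly_Mapping.lookup ((- 1) ^ (p + q + n) *\<^sub>C
            (rho (M (\<theta> i) y) (lam_der V (lbr V a b)) + rho (d i y) (lbr V a b))) (m, I)"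
        by (simp add: lookup_scaleC lookup_add lookup_rho lam_der_def lookup_coeff_map
            clinear_zero[OF oderU_linear] clinear_zero[OF derV_linear] oderU_tens_high[OF i] power_add)
    qed
    \<comment> \<open>The \<lambda> terms of the two sesquilinearity rules cancel, so \<partial> is
      a derivation of the bracket.\<close>
    have lam_der: "lam_der V (lbr V a b) = lbr V (der V a) b + lbr V a (der V b)"
      by (simp add: lbr_der_left[OF lca] lbr_der_right[OF lca])
    note simps = clinear_add[OF bilinear_left[OF lbrU_bilinear]] clinear_add[OF bilinear_right[OF lbrU_bilinear]]
      clinear_scale[OF bilinear_left[OF lbrU_bilinear]] clinear_scale[OF bilinear_right[OF lbrU_bilinear]]
    show "coeff_map 1 (oder U i) (lbr U (a \<otimes>\<^sub>C w) (b \<otimes>\<^sub>C z)) =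
        (- 1) ^ n *\<^sub>C (lbr U (oder U i (a \<otimes>\<^sub>C w)) (b \<otimes>\<^sub>C z)
          + (- 1) ^ k *\<^sub>C lbr U (a \<otimes>\<^sub>C w) (oder U i (b \<otimes>\<^sub>C z)))"
      unfolding k lbrU_tens[OF w b] coeff_map_linear_simps[OF oderU_linear] oder_rho lam_der
        oderU_tens_high[OF i a] oderU_tens_high[OF i b] simps
        lbrU_tens[OF w derV_part[OF b]] lbrU_tens[OF M_part[OF \<theta>_odd w] b] lbrU_tens[OF d_part[OF w] b]
        M_assoc M_odd_left[OF w] d_mult[OF w] rho_linear_simps clinear_add[OF bilinear_right[OF rho_bilinear]]
        clinear_scale[OF bilinear_right[OF rho_bilinear]]
      by (simp add: cvec.scale_right_distrib minus_one_power_iff)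
  qed
qed

end

section \<open>Skew-symmetry and the Jacobi identity on the tensor product\<close>

lemma scaleC_sign_cong: "even a = even b \<Longrightarrow> (- 1) ^ a *\<^sub>C x = (- 1) ^ b *\<^sub>C (x :: 'a::complex_vector)"
  by (simp add: minus_one_power_iff)

lemma scaleC_sign: "(- 1) ^ a *\<^sub>C (- 1) ^ b *\<^sub>C x = (- 1) ^ (a + b) *\<^sub>C (x :: 'a::complex_vector)"
  by (simp add: power_add)

text \<open>Each derivative removes its variable. After all \<open>n\<close> of them no odd variable
  remains, which is how the \<lambda>-bracket is seen to be a polynomial in \<lambda> alone.\<close>

lemma chi_derivs_supp:
  "lam_below n p \<Longrightarrow> lam_supp (Pow ({1..n} - set xs)) (foldr chi_deriv xs p)"
proof (induction xs)
  case (Cons i xs)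
  then have IH: "lam_supp (Pow ({1..n} - set xs)) (foldr chi_deriv xs p)"
    by simp
  have "lam_supp (Pow ({1..n} - set (i # xs))) (chi_deriv i (foldr chi_deriv xs p))"
    by (subst chi_deriv_def, rule lam_supp_sum_terms[OF IH]) (auto intro!: lam_supp_scale lam_supp_monom)
  then show ?case
    by simp
qed simp

context scalar_extension
begin

lemma M_swap: "w \<in> part W s \<Longrightarrow> v \<in> part W t \<Longrightarrow> M (M v w) z = (- 1) ^ (s * t) *\<^sub>C M (M w v) z"
  using M_comm[of v t w s] by (simp add: clinear_scale[OF bilinear_left[OF M_bilinear]] mult.commute)

lemmas rho_scale = clinear_scale[OF bilinear_right[OF rho_bilinear]]
lemmas rho2_scale = clinear_scale[OF bilinear_right[OF rho2_bilinear]]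

lemma coeff_map_rho: "clinear f \<Longrightarrow> coeff_map k f (rho y p) = coeff_map k (\<lambda>v. f (v \<otimes>\<^sub>C y)) p"
  by (subst coeff_map_coeff_map) (simp_all add: clinear_zero clinear_zero[OF clinear_tens_left])

text \<open>\<open>rho\<close> commutes with every operator substituted for a variable that occurs,
  so it can be pulled out of the substitution with \<open>d = 1\<close>.\<close>

lemma bracket_neg_tens:
  assumes "w \<in> part W s" "b \<in> part V q"
  shows "bracket_neg U (a \<otimes>\<^sub>C w) (b \<otimes>\<^sub>C z) = (- 1) ^ (s * q) *\<^sub>C rho (M w z) (bracket_neg V a b)"
proof -
  let ?L = "\<lambda>x. - lam_der U x - lam_mult x" and ?X = "\<lambda>i x. - lam_oder U i x - chi_mult i x"
  interpret substitution ?L ?X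
    by (intro substitution_neg derU_linear oderU_linear)
  have "lam_eval 1 ?L ?X const_lam (rho y (lbr V a b)) = lam_eval 1 ?L ?X (\<lambda>v. rho y (const_lam v)) (lbr V a b)" for y
    by (simp add: lam_eval_coeff_map[OF clinear_single clinear_tens_left] coeff_map_monom
        clinear_zero[OF clinear_tens_left])
  also have "\<dots> y = rho y (bracket_neg V a b)" for y
    using lam_eval_intertwine[where P = "\<lambda>_. True" and g = const_lam and d = 1 and c = 1 and
        L' = "\<lambda>x. - lam_der V x - lam_mult x" and X' = "\<lambda>i x. - lam_oder V i x - chi_mult i x",
        OF clinear_rho[of y] lbr_below[OF lca, of a b]]
    by (simp add: bracket_neg_eval lam_mult_rho lam_der_rho lam_oder_rho chi_mult_rho rho_linear_simps)
  finally show ?thesis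
    by (simp add: bracket_neg_eval lbrU_tens[OF assms] clinear_scale[OF clinear_lam_eval[OF clinear_single]])
qed

lemma lbrU_skew:
  assumes "x \<in> part U k" "y \<in> part U l"
  shows "lbr U y x = (- 1) ^ (k * l + n + 1) *\<^sub>C bracket_neg U x y"
proof (rule bilinear_part_eqI[where F = "\<lambda>x y. lbr U y x" and
      G = "\<lambda>x y. (- 1) ^ (k * l + n + 1) *\<^sub>C bracket_neg U x y", OF _ _ assms])
  show "bilinear (\<lambda>x y. lbr U y x)"
    by (rule bilinear_swap[OF lbrU_bilinear])
  show "bilinear (\<lambda>x y. (- 1) ^ (k * l + n + 1) *\<^sub>C bracket_neg U x y)"
    by (intro bilinear_scaled bilinear_bracket_neg lbrU_bilinear derU_linear oderU_linear)
  fix a w p s b z q t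
  assume a: "a \<in> part V p" and w: "w \<in> part W s" and b: "b \<in> part V q" and z: "z \<in> part W t"
    and par: "even (p + s + k)" "even (q + t + l)"
  show "lbr U (b \<otimes>\<^sub>C z) (a \<otimes>\<^sub>C w) = (- 1) ^ (k * l + n + 1) *\<^sub>C bracket_neg U (a \<otimes>\<^sub>C w) (b \<otimes>\<^sub>C z)"
    unfolding lbrU_tens[OF z a] bracket_neg_tens[OF w b] lbr_skew[OF lca a b] M_comm[OF z w]
      rho_linear_simps rho_scale scaleC_sign
    \<comment> \<open>The two exponents agree modulo 2; given the parities, this is a propositional
      fact.\<close>
    by (rule scaleC_sign_cong) (use par in \<open>simp; argo\<close>)
qed

lemma substitution_rho2:
  shows "lam_mult (rho2 y Q) = rho2 y (lam_mult Q)"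
    and "chi_mult i (rho2 y Q) = rho2 y (chi_mult i Q)"
    and "gamma_mult (rho2 y Q) = rho2 y (gamma_mult Q)"
    and "eta_mult i (rho2 y Q) = rho2 y (eta_mult i Q)"
    and "eta_deriv i (rho2 y Q) = rho2 y (eta_deriv i Q)"
  unfolding gamma_mult_def eta_mult_def eta_deriv_def
  by (simp_all add: coeff_map_lam_mult[OF clinear_rho] coeff_map_0_chi_mult[OF clinear_rho] coeff_map_coeff_map
      clinear_rho ops_linear clinear_zero[OF clinear_rho] clinear_zero[OF clinear_lam_mult]
      clinear_zero[OF clinear_chi_mult] clinear_zero[OF clinear_chi_deriv] lam_mult_rho chi_mult_rho chi_deriv_rho)

lemma J_rho: "coeff_map 0 const_lam (rho y p) = rho2 y (coeff_map 0 const_lam p)"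
  by (simp add: coeff_map_coeff_map clinear_single clinear_rho clinear_zero[OF clinear_rho]
      clinear_zero[OF clinear_tens_left] coeff_map_monom)

text \<open>In the exponent, \<open>t * r\<close> moves \<open>v\<close> past \<open>c\<close>, and
  \<open>s * (q + r + n)\<close> moves \<open>w\<close> past \<open>[b, c]\<close>. A coefficient of
  the latter has parity \<open>q + r + n + card I\<close>; the extra \<open>s * card I\<close> turns
  the sign per odd variable that belongs to the tensor of \<open>a\<close> and \<open>w\<close> into
  the one that belongs to \<open>a\<close>.\<close>

lemma bracket_right_tens:
  assumes a: "a \<in> part V p" and w: "w \<in> part W s" and par: "even (p + s + k)"
    and b: "b \<in> part V q" and v: "v \<in> part W t" and c: "c \<in> part V r"
  shows "bracket_right n U k (a \<otimes>\<^sub>C w) (b \<otimes>\<^sub>C v) (c \<otimes>\<^sub>C z) =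
    (- 1) ^ (t * r + s * (q + r + n)) *\<^sub>C rho2 (M (M w v) z) (bracket_right n V p a b c)"
proof -
  interpret substitution "gamma_mult :: ('v, 'w) tensor lam lam \<Rightarrow> _" eta_mult
    by (rule substitution_gamma)
  let ?J = "coeff_map 0 const_lam"
  have g: "clinear (\<lambda>x. ?J (lbr U (a \<otimes>\<^sub>C w) x))"
    by (rule clinear_J_lbr[OF lbrU_bilinear])
  have "bracket_right n U k (a \<otimes>\<^sub>C w) (b \<otimes>\<^sub>C v) (c \<otimes>\<^sub>C z) = (- 1) ^ (t * r) *\<^sub>C
      lam_eval ((- 1) ^ (k + n)) gamma_mult eta_mult (\<lambda>x. ?J (lbr U (a \<otimes>\<^sub>C w) (x \<otimes>\<^sub>C M v z))) (lbr V b c)"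
    by (simp add: bracket_right_eval lbrU_tens[OF v c] clinear_scale[OF clinear_lam_eval[OF g]]
        lam_eval_coeff_map[OF g clinear_tens_left])
  also have "lam_eval ((- 1) ^ (k + n)) gamma_mult eta_mult (\<lambda>x. ?J (lbr U (a \<otimes>\<^sub>C w) (x \<otimes>\<^sub>C M v z))) (lbr V b c) =
      (- 1) ^ (s * (q + r + n)) *\<^sub>C lam_eval ((- 1) ^ (k + n) * (- 1) ^ s) gamma_mult eta_mult
        (\<lambda>x. rho2 (M (M w v) z) (?J (lbr V a x))) (lbr V b c)"
  proof (rule lam_eval_cong_sign)
    fix m I
    have "Poly_Mapping.lookup (lbr V b c) (m, I) \<in> part V (q + r + n + card I)"
      by (rule lbr_part[OF lca b c])
    then show "?J (lbr U (a \<otimes>\<^sub>C w) (Poly_Mapping.lookup (lbr V b c) (m, I) \<otimes>\<^sub>C M v z)) =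
        ((- 1) ^ (s * (q + r + n)) * ((- 1) ^ s) ^ card I) *\<^sub>C
          rho2 (M (M w v) z) (?J (lbr V a (Poly_Mapping.lookup (lbr V b c) (m, I))))"
      by (simp only: lbrU_tens[OF w] coeff_map_linear_simps[OF clinear_single] J_rho M_assoc
          distrib_left power_add power_mult)
  qed
  also have "(- 1) ^ (k + n) * (- 1) ^ s = (- 1 :: complex) ^ (p + n)"
    unfolding power_add[symmetric] by (rule minus_one_power_eqI) (use par in \<open>simp; argo\<close>)
  also have "lam_eval ((- 1) ^ (p + n)) gamma_mult eta_mult (\<lambda>x. rho2 (M (M w v) z) (?J (lbr V a x))) (lbr V b c) =
      rho2 (M (M w v) z) (bracket_right n V p a b c)"
    using lam_eval_intertwine[where P = "\<lambda>_. True" and g = "\<lambda>x. ?J (lbr V a x)" and d = 1 and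
        c = "(- 1) ^ (p + n)" and L' = gamma_mult and X' = eta_mult, OF clinear_rho2[of "M (M w v) z"] lbr_below[OF lca, of b c]]
    by (simp add: bracket_right_eval substitution_rho2)
  finally show ?thesis
    by (simp only: scaleC_sign)
qed

text \<open>In the exponent, \<open>s * r\<close> moves \<open>w\<close> past \<open>c\<close>,
  \<open>t * (p + r + n)\<close> moves \<open>v\<close> past \<open>[a, c]\<close>, and
  \<open>s * t\<close> restores the order of \<open>w\<close> and \<open>v\<close>, so that the same
  scalar multiplies all three terms of the Jacobi identity.\<close>

lemma bracket_right_swap_tens:
  assumes a: "a \<in> part V p" and w: "w \<in> part W s"
    and b: "b \<in> part V q" and v: "v \<in> part W t" and par: "even (q + t + l)" and c: "c \<in> part V r"
  shows "bracket_right_swap n U l (b \<otimes>\<^sub>C v) (a \<otimes>\<^sub>C w) (c \<otimes>\<^sub>C z) =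
    (- 1) ^ (s * r + t * (p + r + n) + s * t) *\<^sub>C rho2 (M (M w v) z) (bracket_right_swap n V q b a c)"
proof -
  have lin: "clinear (lbr U (b \<otimes>\<^sub>C v))"
    by (rule bilinear_right[OF lbrU_bilinear])
  have "bracket_right_swap n U l (b \<otimes>\<^sub>C v) (a \<otimes>\<^sub>C w) (c \<otimes>\<^sub>C z) = (- 1) ^ (s * r) *\<^sub>C
      coeff_map (l + n) (\<lambda>x. lbr U (b \<otimes>\<^sub>C v) (x \<otimes>\<^sub>C M w z)) (lbr V a c)"
    by (simp add: bracket_right_swap_def lbrU_tens[OF w c] coeff_map_linear_simps[OF lin] coeff_map_rho[OF lin])
  also have "coeff_map (l + n) (\<lambda>x. lbr U (b \<otimes>\<^sub>C v) (x \<otimes>\<^sub>C M w z)) (lbr V a c) =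
      (- 1) ^ (t * (p + r + n)) *\<^sub>C coeff_map (l + n + t) (\<lambda>x. rho (M (M v w) z) (lbr V b x)) (lbr V a c)"
  proof (rule coeff_map_cong_sign)
    fix m I
    have "Poly_Mapping.lookup (lbr V a c) (m, I) \<in> part V (p + r + n + card I)"
      by (rule lbr_part[OF lca a c])
    then show "lbr U (b \<otimes>\<^sub>C v) (Poly_Mapping.lookup (lbr V a c) (m, I) \<otimes>\<^sub>C M w z) =
        ((- 1) ^ (t * (p + r + n)) * (- 1) ^ (t * card I)) *\<^sub>C
          rho (M (M v w) z) (lbr V b (Poly_Mapping.lookup (lbr V a c) (m, I)))"
      by (simp only: lbrU_tens[OF v] M_assoc distrib_left power_add)
  qed
  also have "coeff_map (l + n + t) (\<lambda>x. rho (M (M v w) z) (lbr V b x)) (lbr V a c) =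
      coeff_map (0 + (q + n)) (\<lambda>x. rho (M (M v w) z) (lbr V b x)) (lbr V a c)"
    by (rule arg_cong[where f = "\<lambda>g. g (lbr V a c)"], rule coeff_map_parity) (use par in \<open>simp; argo\<close>)
  also have "\<dots> = rho2 (M (M v w) z) (bracket_right_swap n V q b a c)"
    unfolding bracket_right_swap_def
    by (subst coeff_map_coeff_map) (simp_all add: clinear_rho clinear_zero[OF clinear_rho]
        clinear_zero[OF lbr_linear_right[OF lca]])
  finally show ?thesis
    by (simp only: scaleC_sign M_swap[OF w v] rho2_scale add.assoc)
qed

text \<open>In the exponent, \<open>s * q\<close> moves \<open>w\<close> past \<open>b\<close>, and
  \<open>(s + t) * r\<close> moves the product of \<open>w\<close> and \<open>v\<close> past
  \<open>c\<close>. The variables contribute nothing, as the scalars already stand to their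
  right.\<close>

lemma bracket_left_sum_tens:
  assumes w: "w \<in> part W s" and b: "b \<in> part V q" and v: "v \<in> part W t" and c: "c \<in> part V r"
  shows "bracket_left_sum n U (a \<otimes>\<^sub>C w) (b \<otimes>\<^sub>C v) (c \<otimes>\<^sub>C z) =
    (- 1) ^ (s * q + (s + t) * r) *\<^sub>C rho2 (M (M w v) z) (bracket_left_sum n V a b c)"
proof -
  let ?L = "\<lambda>x::('v, 'w) tensor lam lam. lam_mult x + gamma_mult x"
    and ?X = "\<lambda>i (x::('v, 'w) tensor lam lam). chi_mult i x + eta_mult i x"
  let ?cc = "\<lambda>w. const_lam (const_lam w)"
  let ?y = "M (M w v) z"
  let ?g = "\<lambda>x. lam_eval 1 ?L ?X ?cc (lbr U x (c \<otimes>\<^sub>C z))"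
  let ?gV = "\<lambda>x. lam_eval 1 (\<lambda>x. lam_mult x + gamma_mult x) (\<lambda>i x. chi_mult i x + eta_mult i x) ?cc (lbr V x c)"
  interpret S: substitution ?L ?X
    by (rule substitution_sum)
  interpret substitution "lam_mult :: ('v, 'w) tensor lam lam \<Rightarrow> _" chi_mult
    by (rule substitution_lam)
  have cc: "clinear (?cc :: ('v, 'w) tensor \<Rightarrow> _)"
    by (intro clinear_comp[OF clinear_single] clinear_single)
  have g: "clinear ?g"
    by (rule clinear_comp[OF S.clinear_lam_eval[OF cc] bilinear_left[OF lbrU_bilinear]])
  have inner: "?g (x \<otimes>\<^sub>C M w v) = (- 1) ^ ((s + t) * r) *\<^sub>C rho2 ?y (?gV x)" for x
  proof -
    have "lam_eval 1 ?L ?X ?cc (rho ?y (lbr V x c)) = lam_eval 1 ?L ?X (\<lambda>v. rho2 ?y (?cc v)) (lbr V x c)"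
      by (simp add: S.lam_eval_coeff_map[OF cc clinear_tens_left] coeff_map_monom
          clinear_zero[OF clinear_tens_left] clinear_zero[OF clinear_rho])
    also have "\<dots> = rho2 ?y (?gV x)"
      using S.lam_eval_intertwine[where P = "\<lambda>_. True" and g = ?cc and d = 1 and c = 1 and
        L' = "\<lambda>x. lam_mult x + gamma_mult x" and X' = "\<lambda>i x. chi_mult i x + eta_mult i x",
        OF clinear_rho2[of ?y] lbr_below[OF lca, of x c]]
      by (simp add: substitution_rho2 clinear_add[OF clinear_rho2])
    finally show ?thesis
      by (simp add: lbrU_tens[OF M_part[OF w v] c] clinear_scale[OF S.clinear_lam_eval[OF cc]])
  qed
  have "bracket_left_sum n U (a \<otimes>\<^sub>C w) (b \<otimes>\<^sub>C v) (c \<otimes>\<^sub>C z) = (- 1) ^ (s * q) *\<^sub>C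
      lam_eval ((- 1) ^ n) lam_mult chi_mult (\<lambda>x. ?g (x \<otimes>\<^sub>C M w v)) (lbr V a b)"
    by (simp add: bracket_left_sum_eval lbrU_tens[OF w b] clinear_scale[OF clinear_lam_eval[OF g]]
        lam_eval_coeff_map[OF g clinear_tens_left])
  also have "\<dots> = (- 1) ^ (s * q) *\<^sub>C (- 1) ^ ((s + t) * r) *\<^sub>C
      lam_eval ((- 1) ^ n) lam_mult chi_mult (\<lambda>x. rho2 ?y (?gV x)) (lbr V a b)"
    by (simp only: inner lam_eval_scaled)
  also have "lam_eval ((- 1) ^ n) lam_mult chi_mult (\<lambda>x. rho2 ?y (?gV x)) (lbr V a b) =
      rho2 ?y (bracket_left_sum n V a b c)"
    using lam_eval_intertwine[where P = "\<lambda>_. True" and g = ?gV and d = 1 and c = "(- 1) ^ n" and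
        L' = lam_mult and X' = chi_mult, OF clinear_rho2[of ?y] lbr_below[OF lca, of a b]]
    by (simp add: bracket_left_sum_eval substitution_rho2)
  finally show ?thesis
    by (simp only: scaleC_sign)
qed

lemma lbrU_jacobi:
  assumes "x \<in> part U k" "y \<in> part U l"
  shows "bracket_right n U k x y z' =
    (- 1) ^ ((k + 1) * n) *\<^sub>C bracket_left_sum n U x y z'
    + (- 1) ^ ((k + n) * (l + n)) *\<^sub>C bracket_right_swap n U l y x z'"
proof (rule trilinear_part_eqI[where F = "bracket_right n U k" and G = "\<lambda>x y z'.
      (- 1) ^ ((k + 1) * n) *\<^sub>C bracket_left_sum n U x y z'
      + (- 1) ^ ((k + n) * (l + n)) *\<^sub>C bracket_right_swap n U l y x z'", OF _ _ assms])
  show "trilinear (bracket_right n U k)"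
    by (rule trilinear_bracket_right[OF lbrU_bilinear])
  show "trilinear (\<lambda>x y z'. (- 1) ^ ((k + 1) * n) *\<^sub>C bracket_left_sum n U x y z'
      + (- 1) ^ ((k + n) * (l + n)) *\<^sub>C bracket_right_swap n U l y x z')"
    by (intro trilinear_plus trilinear_scaled trilinear_bracket_left_sum[OF lbrU_bilinear]
        trilinear_swap[OF trilinear_bracket_right_swap[OF lbrU_bilinear]])
  fix a w p s b v q t c z r u
  assume a: "a \<in> part V p" and w: "w \<in> part W s" and b: "b \<in> part V q" and v: "v \<in> part W t"
    and par: "even (p + s + k)" "even (q + t + l)" and c: "c \<in> part V r" and z: "z \<in> part W u"
  show "bracket_right n U k (a \<otimes>\<^sub>C w) (b \<otimes>\<^sub>C v) (c \<otimes>\<^sub>C z) =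
      (- 1) ^ ((k + 1) * n) *\<^sub>C bracket_left_sum n U (a \<otimes>\<^sub>C w) (b \<otimes>\<^sub>C v) (c \<otimes>\<^sub>C z)
      + (- 1) ^ ((k + n) * (l + n)) *\<^sub>C bracket_right_swap n U l (b \<otimes>\<^sub>C v) (a \<otimes>\<^sub>C w) (c \<otimes>\<^sub>C z)"
    unfolding bracket_right_tens[OF a w par(1) b v c] bracket_left_sum_tens[OF w b v c]
      bracket_right_swap_tens[OF a w b v par(2) c] lbr_jacobi[OF lca a b]
      clinear_add[OF clinear_rho2] clinear_scale[OF clinear_rho2] cvec.scale_right_distrib scaleC_sign
    by (rule arg_cong2[where f = "(+)"]; rule scaleC_sign_cong) (use par in \<open>simp; argo\<close>)+
qed

lemma susy_lie_conformal_algebra_U: "susy_lie_conformal_algebra n U"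
  unfolding susy_lie_conformal_algebra_def
proof (intro conjI allI ballI)
  show "Poly_Mapping.keys (lbr U x y) \<subseteq> UNIV \<times> Pow {1..n}" for x y
    using lbrU_below by (simp add: lam_supp_def)
qed (fact is_nabla_module_U lbrU_der_left lbrU_der_right bilinear_left[OF lbrU_bilinear]
      bilinear_right[OF lbrU_bilinear]
    | (rule lbrU_part lbrU_oder_left lbrU_oder_right lbrU_skew lbrU_jacobi, assumption+))+

section \<open>The remaining vertex algebra axioms on the tensor product\<close>

lemma lambda_bracket_tens:
  assumes "w \<in> part W s" "b \<in> part V q"
  shows "lambda_bracket n U (a \<otimes>\<^sub>C w) (b \<otimes>\<^sub>C z) = (- 1) ^ (s * q) *\<^sub>C rho (M w z) (lambda_bracket n V a b)"
proof -
  have "foldr chi_deriv xs (rho y p) = rho y (foldr chi_deriv xs p)" for xs y p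
    by (induction xs) (simp_all add: chi_deriv_rho)
  then show ?thesis
    by (simp add: lambda_bracket_def chi_derivs_def lbrU_tens[OF assms]
        clinear_scale[OF clinear_foldr[OF clinear_chi_deriv]] del: upt_Suc)
qed

text \<open>The bracket has parity \<open>n\<close>, and taking \<open>n\<close> odd derivatives
  shifts the parity of the coefficients by \<open>n\<close> again. No odd variable is left at a key,
  so \<open>card I\<close> is 0 there.\<close>

lemma lambda_bracket_part:
  assumes "a \<in> part V p" "b \<in> part V q" and key: "(m, I) \<in> Poly_Mapping.keys (lambda_bracket n V a b)"
  shows "Poly_Mapping.lookup (lambda_bracket n V a b) (m, I) \<in> part V (p + q)"
proof -
  have "Poly_Mapping.lookup (foldr chi_deriv xs (lbr V a b)) (m, I) \<in> part V (p + q + n + card I + length xs)"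
    if "finite I" for xs m I
    using that
  proof (induction xs arbitrary: m I)
    case (Cons i xs)
    have "Poly_Mapping.lookup (chi_deriv i x) (m, I) =
        (if i \<in> I then 0 else place_sign i I *\<^sub>C Poly_Mapping.lookup x (m, insert i I))" for x :: "'v lam"
    proof (rule lam_eqI[where p = x])
      show "clinear (\<lambda>x. Poly_Mapping.lookup (chi_deriv i x) (m, I))"
        by (rule clinear_comp[OF clinear_lookup clinear_chi_deriv])
      show "clinear (\<lambda>x. if i \<in> I then 0 else place_sign i I *\<^sub>C Poly_Mapping.lookup x (m, insert i I))"
        by (intro clinear_intros clinear_lookup)
      show "Poly_Mapping.lookup (chi_deriv i (monom_lam m' J v)) (m, I) =
          (if i \<in> I then 0 else place_sign i I *\<^sub>C Poly_Mapping.lookup (monom_lam m' J v) (m, insert i I))" for m' J v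
        by (auto simp: chi_deriv_monom lookup_scaleC lookup_single when_def insert_absorb)
    qed
    moreover have "Poly_Mapping.lookup (foldr chi_deriv xs (lbr V a b)) (m, insert i I) \<in>
        part V (p + q + n + card I + length (i # xs))" if "i \<notin> I"
      using Cons.IH[of "insert i I" m] Cons.prems that by simp
    ultimately show ?case
      by (simp add: cvec.subspace_0[OF part_subspace[OF nmV]] cvec.subspace_scale[OF part_subspace[OF nmV]])
  qed (simp add: lbr_part[OF lca assms(1,2)])
  from this[of I "[Suc 0..<Suc n]" m] have *: "finite I \<Longrightarrow>
      Poly_Mapping.lookup (lambda_bracket n V a b) (m, I) \<in> part V (p + q + n + card I + n)"
    by (simp add: lambda_bracket_def chi_derivs_def del: upt_Suc)
  have "lam_supp (Pow ({1..n} - set [Suc 0..<Suc n])) (lambda_bracket n V a b)"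
    unfolding lambda_bracket_def chi_derivs_def by (rule chi_derivs_supp[OF lbr_below[OF lca]])
  then have "I \<in> Pow ({1..n} - set [Suc 0..<Suc n])"
    using key by (rule lam_suppD)
  then have "I = {}"
    by (auto simp: subset_iff)
  moreover have "part V (p + q + n + 0 + n) = part V (p + q)"
    by (rule part_cong) (simp; argo)
  ultimately show ?thesis
    using * by simp
qed

lemma derU_power_tens: "(der U ^^ m) (a \<otimes>\<^sub>C w) = (der V ^^ m) a \<otimes>\<^sub>C w"
  by (induction m) (simp_all add: derU_tens)

lemma integral_neg_nabla_tens:
  assumes "w \<in> part W s" "b \<in> part V q"
  shows "integral_neg_nabla n U (a \<otimes>\<^sub>C w) (b \<otimes>\<^sub>C z) = (- 1) ^ (s * q) *\<^sub>C (integral_neg_nabla n V a b \<otimes>\<^sub>C M w z)"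
proof -
  have pow: "((\<lambda>x. - der U x) ^^ m) (v \<otimes>\<^sub>C y) = ((\<lambda>x. - der V x) ^^ m) v \<otimes>\<^sub>C y" for m v y
    by (induction m) (simp_all add: derU_tens clinear_neg[OF clinear_tens_left])
  let ?F = "\<lambda>m (I :: nat set) v. - ((1 / of_nat (Suc m)) *\<^sub>C ((\<lambda>x. - der U x) ^^ Suc m) v)"
  have F: "clinear (?F m I)" for m I
    by (intro clinear_uminus clinear_scaled clinear_funpow derU_linear)
  show ?thesis
    unfolding integral_neg_nabla_def lambda_bracket_tens[OF assms] clinear_scale[OF clinear_sum_terms[OF F]]
      sum_terms_coeff_map[OF F clinear_tens_left] pow
    by (simp add: sum_terms_comp[OF clinear_tens_left] clinear_neg[OF clinear_tens_left] tens_scale_left)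
qed

lemma nopU_quasi_commutative:
  assumes "x \<in> part U k" "y \<in> part U l"
  shows "nop U x y - (- 1) ^ (k * l) *\<^sub>C nop U y x = integral_neg_nabla n U x y"
proof (rule bilinear_part_eqI[where F = "\<lambda>x y. nop U x y - (- 1) ^ (k * l) *\<^sub>C nop U y x" and
      G = "integral_neg_nabla n U", OF _ _ assms])
  show "bilinear (\<lambda>x y. nop U x y - (- 1) ^ (k * l) *\<^sub>C nop U y x)"
    by (intro bilinear_minus bilinear_scaled bilinear_swap[OF nopU_bilinear] nopU_bilinear)
  show "bilinear (integral_neg_nabla n U)"
    by (rule bilinear_integral_neg_nabla[OF lbrU_bilinear derU_linear])
  fix a w p s b z q t
  assume a: "a \<in> part V p" and w: "w \<in> part W s" and b: "b \<in> part V q" and z: "z \<in> part W t"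
    and par: "even (p + s + k)" "even (q + t + l)"
  have "nop V a b - (- 1) ^ (p * q) *\<^sub>C nop V b a = integral_neg_nabla n V a b"
    using va a b by (simp add: susy_vertex_algebra_def)
  moreover have "(- 1) ^ (k * l + (t * p + t * s)) *\<^sub>C (nop V b a \<otimes>\<^sub>C M w z) =
      (- 1) ^ (s * q + p * q) *\<^sub>C (nop V b a \<otimes>\<^sub>C M w z)"
    by (rule scaleC_sign_cong) (use par in \<open>simp; argo\<close>)
  ultimately show "nop U (a \<otimes>\<^sub>C w) (b \<otimes>\<^sub>C z) - (- 1) ^ (k * l) *\<^sub>C nop U (b \<otimes>\<^sub>C z) (a \<otimes>\<^sub>C w) =
      integral_neg_nabla n U (a \<otimes>\<^sub>C w) (b \<otimes>\<^sub>C z)"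
    unfolding nopU_tens[OF w b] nopU_tens[OF z a] M_comm[OF z w] integral_neg_nabla_tens[OF w b]
      tens_scale_right scaleC_sign
    by (simp only: clinear_diff[OF clinear_tens_left, symmetric] tens_scale_left scaleC_sign
        cvec.scale_right_diff_distrib flip: \<open>nop V a b - _ = _\<close>)
      (simp only: clinear_diff[OF clinear_tens_left] tens_scale_left scaleC_sign
        cvec.scale_right_diff_distrib)
qed

text \<open>Compared with the nested brackets, \<open>n\<close> is absent from
  \<open>s * (q + r)\<close>: the \<lambda>-bracket is even, so its coefficients have parity
  \<open>q + r\<close>. The powers of \<partial> act on \<open>V\<close> alone.\<close>

lemma integral_nabla_tens:
  assumes a: "a \<in> part V p" and w: "w \<in> part W s" and b: "b \<in> part V q" and v: "v \<in> part W t" and c: "c \<in> part V r"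
  shows "integral_nabla n U (a \<otimes>\<^sub>C w) (b \<otimes>\<^sub>C v) (c \<otimes>\<^sub>C z) =
    (- 1) ^ (t * r + s * (q + r)) *\<^sub>C (integral_nabla n V a b c \<otimes>\<^sub>C M (M w v) z)"
proof -
  let ?F = "\<lambda>j (I :: nat set) x. (1 / of_nat (Suc j)) *\<^sub>C nop U ((der U ^^ Suc j) (a \<otimes>\<^sub>C w)) x"
  have F: "clinear (?F j I)" for j I
    by (intro clinear_scaled bilinear_right[OF nopU_bilinear])
  have "integral_nabla n U (a \<otimes>\<^sub>C w) (b \<otimes>\<^sub>C v) (c \<otimes>\<^sub>C z) =
      (- 1) ^ (t * r) *\<^sub>C sum_terms (\<lambda>j I x. ?F j I (x \<otimes>\<^sub>C M v z)) (lambda_bracket n V b c)"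
    unfolding integral_nabla_def lambda_bracket_tens[OF v c] clinear_scale[OF clinear_sum_terms[OF F]]
      sum_terms_coeff_map[OF F clinear_tens_left] by simp
  also have "sum_terms (\<lambda>j I x. ?F j I (x \<otimes>\<^sub>C M v z)) (lambda_bracket n V b c) =
      sum_terms (\<lambda>j I x. (- 1) ^ (s * (q + r)) *\<^sub>C
        (((1 / of_nat (Suc j)) *\<^sub>C nop V ((der V ^^ Suc j) a) x) \<otimes>\<^sub>C M (M w v) z)) (lambda_bracket n V b c)"
  proof (rule sum_terms_cong)
    fix j I
    assume "(j, I) \<in> Poly_Mapping.keys (lambda_bracket n V b c)"
    from lambda_bracket_part[OF b c this]
    show "?F j I (Poly_Mapping.lookup (lambda_bracket n V b c) (j, I) \<otimes>\<^sub>C M v z) = (- 1) ^ (s * (q + r)) *\<^sub>C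
        (((1 / of_nat (Suc j)) *\<^sub>C nop V ((der V ^^ Suc j) a)
          (Poly_Mapping.lookup (lambda_bracket n V b c) (j, I))) \<otimes>\<^sub>C M (M w v) z)"
      by (simp only: derU_power_tens nopU_tens[OF w] M_assoc tens_scale_left scaleC_scaleC mult.commute)
  qed
  also have "\<dots> = (- 1) ^ (s * (q + r)) *\<^sub>C (integral_nabla n V a b c \<otimes>\<^sub>C M (M w v) z)"
    unfolding integral_nabla_def
    by (simp only: sum_terms_comp[OF clinear_tens_left] sum_terms_comp[OF clinear_scaled[OF clinear_id]])
  finally show ?thesis
    by (simp only: scaleC_sign)
qed

lemma nopU_quasi_associative:
  assumes "x \<in> part U k" "y \<in> part U l"
  shows "nop U (nop U x y) z' - nop U x (nop U y z') =
    integral_nabla n U x y z' + (- 1) ^ (k * l) *\<^sub>C integral_nabla n U y x z'"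
proof (rule trilinear_part_eqI[where F = "\<lambda>x y z'. nop U (nop U x y) z' - nop U x (nop U y z')" and
      G = "\<lambda>x y z'. integral_nabla n U x y z' + (- 1) ^ (k * l) *\<^sub>C integral_nabla n U y x z'", OF _ _ assms])
  note int = trilinear_integral_nabla[OF lbrU_bilinear nopU_bilinear derU_linear]
  show "trilinear (\<lambda>x y z'. nop U (nop U x y) z' - nop U x (nop U y z'))"
    by (intro trilinear_minus trilinear_comp_left[OF nopU_bilinear nopU_bilinear]
        trilinear_comp_right[OF nopU_bilinear nopU_bilinear])
  show "trilinear (\<lambda>x y z'. integral_nabla n U x y z' + (- 1) ^ (k * l) *\<^sub>C integral_nabla n U y x z')"
    by (intro trilinear_plus trilinear_scaled trilinear_swap[OF int] int)
  fix a w p s b v q t c z r u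
  assume a: "a \<in> part V p" and w: "w \<in> part W s" and b: "b \<in> part V q" and v: "v \<in> part W t"
    and par: "even (p + s + k)" "even (q + t + l)" and c: "c \<in> part V r" and z: "z \<in> part W u"
  let ?T = "\<lambda>x. x \<otimes>\<^sub>C M (M w v) z"
  have eq: "nop V (nop V a b) c = nop V a (nop V b c) + (integral_nabla n V a b c + (- 1) ^ (p * q) *\<^sub>C integral_nabla n V b a c)"
  proof -
    have "nop V (nop V a b) c - nop V a (nop V b c) =
        integral_nabla n V a b c + (- 1) ^ (p * q) *\<^sub>C integral_nabla n V b a c"
      using va a b unfolding susy_vertex_algebra_def by blast
    then show ?thesis
      by (simp only: diff_eq_eq add.commute)
  qed
  \<comment> \<open>All terms are brought to the sign of the product \<open>(ab)c\<close>, so that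
    quasi-associativity of \<open>V\<close> can be applied inside the tensor product.\<close>
  have s1: "(- 1) ^ (t * r + s * (q + r)) *\<^sub>C ?T x = (- 1) ^ (s * q + (s + t) * r) *\<^sub>C ?T x" for x
    by (rule scaleC_sign_cong) (simp; argo)
  have s2: "(- 1) ^ (k * l + (s * r + t * (p + r) + s * t)) *\<^sub>C ?T x = (- 1) ^ (s * q + (s + t) * r + p * q) *\<^sub>C ?T x" for x
    by (rule scaleC_sign_cong) (use par in \<open>simp; argo\<close>)
  have l: "nop U (nop U (a \<otimes>\<^sub>C w) (b \<otimes>\<^sub>C v)) (c \<otimes>\<^sub>C z) = (- 1) ^ (s * q + (s + t) * r) *\<^sub>C ?T (nop V (nop V a b) c)"
    by (simp only: nopU_tens[OF w b] clinear_scale[OF bilinear_left[OF nopU_bilinear]]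
        nopU_tens[OF M_part[OF w v] c] scaleC_sign)
  have m: "nop U (a \<otimes>\<^sub>C w) (nop U (b \<otimes>\<^sub>C v) (c \<otimes>\<^sub>C z)) = (- 1) ^ (t * r + s * (q + r)) *\<^sub>C ?T (nop V a (nop V b c))"
    by (simp only: nopU_tens[OF v c] clinear_scale[OF bilinear_right[OF nopU_bilinear]]
        nopU_tens[OF w nopV_part[OF b c]] scaleC_sign M_assoc)
  show "nop U (nop U (a \<otimes>\<^sub>C w) (b \<otimes>\<^sub>C v)) (c \<otimes>\<^sub>C z) - nop U (a \<otimes>\<^sub>C w) (nop U (b \<otimes>\<^sub>C v) (c \<otimes>\<^sub>C z)) =
      integral_nabla n U (a \<otimes>\<^sub>C w) (b \<otimes>\<^sub>C v) (c \<otimes>\<^sub>C z)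
      + (- 1) ^ (k * l) *\<^sub>C integral_nabla n U (b \<otimes>\<^sub>C v) (a \<otimes>\<^sub>C w) (c \<otimes>\<^sub>C z)"
    unfolding l m integral_nabla_tens[OF a w b v c] integral_nabla_tens[OF b v a w c] M_swap[OF w v]
      tens_scale_right scaleC_sign eq s1 s2
    by (simp add: tens_add_left tens_scale_left cvec.scale_right_distrib power_add)
qed

text \<open>The scalar passes unchanged through the odd derivatives and the integral, because it
  stands to the right of both sets of variables; the sign is that of the nested bracket.\<close>

lemma wick_integral_tens:
  assumes w: "w \<in> part W s" and b: "b \<in> part V q" and v: "v \<in> part W t" and c: "c \<in> part V r"
  shows "wick_integral n U (a \<otimes>\<^sub>C w) (b \<otimes>\<^sub>C v) (c \<otimes>\<^sub>C z) =
    (- 1) ^ (s * q + (s + t) * r) *\<^sub>C rho (M (M w v) z) (wick_integral n V a b c)"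
proof -
  let ?y = "M (M w v) z"
  let ?f = "\<lambda>x. lbr U x (c \<otimes>\<^sub>C z)"
  have f: "clinear ?f"
    by (rule bilinear_left[OF lbrU_bilinear])
  have lin: "clinear (\<lambda>x. lbr V x c)"
    by (rule lbr_linear_left[OF lca])
  have "coeff_map n ?f (lbr U (a \<otimes>\<^sub>C w) (b \<otimes>\<^sub>C v)) =
      (- 1) ^ (s * q) *\<^sub>C coeff_map n (\<lambda>x. ?f (x \<otimes>\<^sub>C M w v)) (lbr V a b)"
    by (simp add: lbrU_tens[OF w b] coeff_map_linear_simps[OF f] coeff_map_rho[OF f])
  also have "coeff_map n (\<lambda>x. ?f (x \<otimes>\<^sub>C M w v)) (lbr V a b) =
      (- 1) ^ ((s + t) * r) *\<^sub>C coeff_map (0 + n) (\<lambda>x. rho ?y (lbr V x c)) (lbr V a b)"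
    by (simp add: lbrU_tens[OF M_part[OF w v] c] coeff_map_scale clinear_comp[OF clinear_rho lin])
  also have "coeff_map (0 + n) (\<lambda>x. rho ?y (lbr V x c)) (lbr V a b) =
      rho2 ?y (coeff_map n (\<lambda>x. lbr V x c) (lbr V a b))"
    by (rule coeff_map_coeff_map[symmetric]) (simp_all add: clinear_rho clinear_zero[OF clinear_rho] clinear_zero[OF lin])
  finally have eq: "coeff_map n ?f (lbr U (a \<otimes>\<^sub>C w) (b \<otimes>\<^sub>C v)) =
      (- 1) ^ (s * q + (s + t) * r) *\<^sub>C rho2 ?y (coeff_map n (\<lambda>x. lbr V x c) (lbr V a b))"
    by (simp only: scaleC_sign)
  have "foldr eta_deriv xs (rho2 ?y Q) = rho2 ?y (foldr eta_deriv xs Q)" for xs and Q :: "'v lam lam"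
    by (induction xs) (simp_all add: substitution_rho2)
  moreover have "gamma_integral (rho2 ?y Q) = rho ?y (gamma_integral Q)" for Q :: "'v lam lam"
  proof (rule lam_eqI[where p = Q])
    show "gamma_integral (rho2 ?y (monom_lam m I x)) = rho ?y (gamma_integral (monom_lam m I x))" for m I x
      by (simp add: coeff_map_monom clinear_zero[OF clinear_rho] gamma_integral_monom
          sum_terms_coeff_map[OF clinear_scaled[OF clinear_single] clinear_tens_left]
          sum_terms_comp[OF clinear_rho] clinear_zero[OF clinear_tens_left] rho_linear_simps)
  qed (rule clinear_comp[OF clinear_gamma_integral clinear_rho2] clinear_comp[OF clinear_rho clinear_gamma_integral])+
  ultimately show ?thesis
    by (simp add: wick_integral_eq eq clinear_scale[OF clinear_foldr[OF clinear_eta_deriv]]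
        clinear_scale[OF clinear_gamma_integral] del: upt_Suc)
qed

lemma nopU_wick:
  assumes "x \<in> part U k" "y \<in> part U l"
  shows "lbr U x (nop U y z') = coeff_map 0 (\<lambda>v. nop U v z') (lbr U x y)
    + (- 1) ^ ((k + n) * l) *\<^sub>C coeff_map l (nop U y) (lbr U x z') + wick_integral n U x y z'"
proof (rule trilinear_part_eqI[where F = "\<lambda>x y z'. lbr U x (nop U y z')" and
      G = "\<lambda>x y z'. coeff_map 0 (\<lambda>v. nop U v z') (lbr U x y)
        + (- 1) ^ ((k + n) * l) *\<^sub>C coeff_map l (nop U y) (lbr U x z') + wick_integral n U x y z'", OF _ _ assms])
  show "trilinear (\<lambda>x y z'. lbr U x (nop U y z'))"
    by (rule trilinear_comp_right[OF lbrU_bilinear nopU_bilinear])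
  have "trilinear (\<lambda>x y z'. coeff_map 0 (\<lambda>v. nop U v z') (lbr U x y))"
    by (rule trilinear_comp_left[where f = "\<lambda>p z'. coeff_map 0 (\<lambda>v. nop U v z') p", OF _ lbrU_bilinear])
      (intro bilinearI clinear_coeff_map clinear_coeff_map_param bilinear_left[OF nopU_bilinear]
        bilinear_right[OF nopU_bilinear])
  moreover have sw: "trilinear (\<lambda>y x z'. coeff_map l (nop U y) (lbr U x z'))"
    by (rule trilinear_comp_right[where f = "\<lambda>y p. coeff_map l (nop U y) p", OF _ lbrU_bilinear])
      (intro bilinearI clinear_coeff_map clinear_coeff_map_param bilinear_left[OF nopU_bilinear]
        bilinear_right[OF nopU_bilinear])
  ultimately show "trilinear (\<lambda>x y z'. coeff_map 0 (\<lambda>v. nop U v z') (lbr U x y)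
        + (- 1) ^ ((k + n) * l) *\<^sub>C coeff_map l (nop U y) (lbr U x z') + wick_integral n U x y z')"
    by (intro trilinear_plus trilinear_scaled trilinear_wick_integral[OF lbrU_bilinear] trilinear_swap[OF sw])
  fix a w p s b v q t c z r u
  assume a: "a \<in> part V p" and w: "w \<in> part W s" and b: "b \<in> part V q" and v: "v \<in> part W t"
    and par: "even (p + s + k)" "even (q + t + l)" and c: "c \<in> part V r" and z: "z \<in> part W u"
  let ?y = "M (M w v) z"
  have wick: "lbr V a (nop V b c) = coeff_map 0 (\<lambda>v. nop V v c) (lbr V a b)
      + (- 1) ^ ((p + n) * q) *\<^sub>C coeff_map q (nop V b) (lbr V a c) + wick_integral n V a b c"
    using va a b unfolding susy_vertex_algebra_def by blast
  have lin: "clinear (\<lambda>x. nop U x (c \<otimes>\<^sub>C z))" "clinear (nop U (b \<otimes>\<^sub>C v))" "clinear (\<lambda>x. nop V x c)" "clinear (nop V b)"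
    by (rule bilinear_left[OF nopU_bilinear] bilinear_right[OF nopU_bilinear]
        bilinear_left[OF nopV_bilinear] bilinear_right[OF nopV_bilinear])+
  have l: "lbr U (a \<otimes>\<^sub>C w) (nop U (b \<otimes>\<^sub>C v) (c \<otimes>\<^sub>C z)) =
      (- 1) ^ (t * r + s * (q + r)) *\<^sub>C rho ?y (lbr V a (nop V b c))"
    by (simp only: nopU_tens[OF v c] clinear_scale[OF bilinear_right[OF lbrU_bilinear]]
        lbrU_tens[OF w nopV_part[OF b c]] scaleC_sign M_assoc)
  have 1: "coeff_map 0 (\<lambda>x. nop U x (c \<otimes>\<^sub>C z)) (lbr U (a \<otimes>\<^sub>C w) (b \<otimes>\<^sub>C v)) =
      (- 1) ^ (s * q + (s + t) * r) *\<^sub>C rho ?y (coeff_map 0 (\<lambda>x. nop V x c) (lbr V a b))"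
  proof -
    have "coeff_map 0 (\<lambda>x. nop U x (c \<otimes>\<^sub>C z)) (rho (M w v) (lbr V a b)) =
        (- 1) ^ ((s + t) * r) *\<^sub>C coeff_map 0 (\<lambda>x. nop V x c \<otimes>\<^sub>C ?y) (lbr V a b)"
      by (simp add: coeff_map_rho[OF lin(1)] nopU_tens[OF M_part[OF w v] c]
          coeff_map_scale[OF clinear_comp[OF clinear_tens_left lin(3)]])
    also have "coeff_map 0 (\<lambda>x. nop V x c \<otimes>\<^sub>C ?y) (lbr V a b) = rho ?y (coeff_map 0 (\<lambda>x. nop V x c) (lbr V a b))"
      by (subst coeff_map_coeff_map) (simp_all add: clinear_zero[OF lin(3)] clinear_zero[OF clinear_tens_left] clinear_tens_left)
    finally show ?thesis
      by (simp only: lbrU_tens[OF w b] coeff_map_linear_simps[OF lin(1)] scaleC_sign)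
  qed
  have 2: "coeff_map l (nop U (b \<otimes>\<^sub>C v)) (lbr U (a \<otimes>\<^sub>C w) (c \<otimes>\<^sub>C z)) =
      (- 1) ^ (s * r + t * (p + r + n) + s * t) *\<^sub>C rho ?y (coeff_map q (nop V b) (lbr V a c))"
  proof -
    have "coeff_map l (nop U (b \<otimes>\<^sub>C v)) (rho (M w z) (lbr V a c)) =
        (- 1) ^ (t * (p + r + n)) *\<^sub>C coeff_map (l + t) (\<lambda>x. nop V b x \<otimes>\<^sub>C M (M v w) z) (lbr V a c)"
      unfolding coeff_map_rho[OF lin(2)]
    proof (rule coeff_map_cong_sign)
      fix m I
      have "Poly_Mapping.lookup (lbr V a c) (m, I) \<in> part V (p + r + n + card I)"
        by (rule lbr_part[OF lca a c])
      then show "nop U (b \<otimes>\<^sub>C v) (Poly_Mapping.lookup (lbr V a c) (m, I) \<otimes>\<^sub>C M w z) =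
          ((- 1) ^ (t * (p + r + n)) * (- 1) ^ (t * card I)) *\<^sub>C
            (nop V b (Poly_Mapping.lookup (lbr V a c) (m, I)) \<otimes>\<^sub>C M (M v w) z)"
        by (simp only: nopU_tens[OF v] M_assoc distrib_left power_add)
    qed
    also have "coeff_map (l + t) (\<lambda>x. nop V b x \<otimes>\<^sub>C M (M v w) z) (lbr V a c) =
        coeff_map (0 + q) (\<lambda>x. nop V b x \<otimes>\<^sub>C M (M v w) z) (lbr V a c)"
      by (rule arg_cong[where f = "\<lambda>g. g (lbr V a c)"], rule coeff_map_parity) (use par in \<open>simp; argo\<close>)
    also have "\<dots> = rho (M (M v w) z) (coeff_map q (nop V b) (lbr V a c))"
      by (subst coeff_map_coeff_map) (simp_all add: clinear_zero[OF lin(4)] clinear_zero[OF clinear_tens_left] clinear_tens_left)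
    finally show ?thesis
      by (simp only: lbrU_tens[OF w c] coeff_map_linear_simps[OF lin(2)] scaleC_sign M_swap[OF w v] rho_scale add.assoc)
  qed
  show "lbr U (a \<otimes>\<^sub>C w) (nop U (b \<otimes>\<^sub>C v) (c \<otimes>\<^sub>C z)) =
      coeff_map 0 (\<lambda>x. nop U x (c \<otimes>\<^sub>C z)) (lbr U (a \<otimes>\<^sub>C w) (b \<otimes>\<^sub>C v))
      + (- 1) ^ ((k + n) * l) *\<^sub>C coeff_map l (nop U (b \<otimes>\<^sub>C v)) (lbr U (a \<otimes>\<^sub>C w) (c \<otimes>\<^sub>C z))
      + wick_integral n U (a \<otimes>\<^sub>C w) (b \<otimes>\<^sub>C v) (c \<otimes>\<^sub>C z)"
    unfolding l 1 2 wick_integral_tens[OF w b v c] wick rho_linear_simps cvec.scale_right_distrib scaleC_sign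
    by (intro arg_cong2[where f = "(+)"] scaleC_sign_cong) (use par in \<open>simp; argo\<close>)+
qed

theorem susy_vertex_algebra_U: "susy_vertex_algebra n U"
  unfolding susy_vertex_algebra_def
  using susy_lie_conformal_algebra_U unital_diff_superalgebra_U nopU_quasi_commutative
    nopU_quasi_associative nopU_wick
  by blast

end

section \<open>The Grassmann algebra on countably many generators\<close>

lemma basis_eq_scale: "Poly_Mapping.single k c = c *\<^sub>C Poly_Mapping.single k (1 :: complex)"
  using clinear_scale[OF clinear_single, of k c "1 :: complex"] by (simp add: scaleC_complex_def)

text \<open>The number of transpositions that sort the product of the monomials of \<open>A\<close>
  and \<open>B\<close>.\<close>

definition inversions :: "nat set \<Rightarrow> nat set \<Rightarrow> nat" where
  "inversions A B = card {(a, b) \<in> A \<times> B. b < a}"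

lemma finite_inversions: "finite A \<Longrightarrow> finite B \<Longrightarrow> finite {(a, b). a \<in> A \<and> b \<in> B \<and> P a b}"
  by (rule finite_subset[of _ "A \<times> B"]) auto

lemma inversions_Un_left:
  assumes "finite A" "finite B" "finite C" "A \<inter> B = {}"
  shows "inversions (A \<union> B) C = inversions A C + inversions B C"
proof -
  have "{(a, b) \<in> (A \<union> B) \<times> C. b < a} = {(a, b) \<in> A \<times> C. b < a} \<union> {(a, b) \<in> B \<times> C. b < a}"
    by auto
  moreover have "card ({(a, b) \<in> A \<times> C. b < a} \<union> {(a, b) \<in> B \<times> C. b < a}) =
      card {(a, b) \<in> A \<times> C. b < a} + card {(a, b) \<in> B \<times> C. b < a}"
    by (rule card_Un_disjoint) (use assms in \<open>auto intro!: finite_inversions\<close>)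
  ultimately show ?thesis
    by (simp only: inversions_def)
qed

lemma inversions_Un_right:
  assumes "finite A" "finite B" "finite C" "B \<inter> C = {}"
  shows "inversions A (B \<union> C) = inversions A B + inversions A C"
proof -
  have "{(a, b) \<in> A \<times> (B \<union> C). b < a} = {(a, b) \<in> A \<times> B. b < a} \<union> {(a, b) \<in> A \<times> C. b < a}"
    by auto
  moreover have "card ({(a, b) \<in> A \<times> B. b < a} \<union> {(a, b) \<in> A \<times> C. b < a}) =
      card {(a, b) \<in> A \<times> B. b < a} + card {(a, b) \<in> A \<times> C. b < a}"
    by (rule card_Un_disjoint) (use assms in \<open>auto intro!: finite_inversions\<close>)
  ultimately show ?thesis
    by (simp only: inversions_def)
qed

text \<open>A pair of elements of two disjoint sets is an inversion in exactly one of the two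
  orders. This yields supercommutativity.\<close>

lemma inversions_swap:
  assumes "finite A" "finite B" "A \<inter> B = {}"
  shows "inversions A B + inversions B A = card A * card B"
proof -
  have "inversions B A = card {(a, b) \<in> A \<times> B. a < b}"
    unfolding inversions_def
    by (rule bij_betw_same_card[of prod.swap]) (auto simp: bij_betw_def inj_on_def)
  moreover have "A \<times> B = {(a, b) \<in> A \<times> B. b < a} \<union> {(a, b) \<in> A \<times> B. a < b}"
    using assms(3) nat_neq_iff by blast
  moreover have "card ({(a, b) \<in> A \<times> B. b < a} \<union> {(a, b) \<in> A \<times> B. a < b}) =
      card {(a, b) \<in> A \<times> B. b < a} + card {(a, b) \<in> A \<times> B. a < b}"
    by (rule card_Un_disjoint) (use assms in \<open>auto intro!: finite_inversions\<close>)
  ultimately show ?thesis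
    by (metis inversions_def card_cartesian_product)
qed

lemma inversions_singleton: "(- 1) ^ inversions {i} B = place_sign i B"
proof -
  have "inversions {i} B = card {j \<in> B. j < i}"
    unfolding inversions_def
    by (rule bij_betw_same_card[of snd]) (auto simp: bij_betw_def inj_on_def image_iff)
  then show ?thesis
    by (simp add: place_sign_def)
qed

lemma inversions_empty [simp]: "inversions {} B = 0" "inversions A {} = 0"
  by (simp_all add: inversions_def)

text \<open>The element \<open>\<theta>\<^bsub>a\<^sub>1\<^esub> \<dots> \<theta>\<^bsub>a\<^sub>r\<^esub>\<close> for \<open>A = {a\<^sub>1 < \<dots> < a\<^sub>r}\<close>.\<close>

definition grassmann_monom :: "nat set \<Rightarrow> nat \<Rightarrow>\<^sub>0 complex" where
  "grassmann_monom A = Poly_Mapping.single (set_encode A) 1"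

text \<open>Natural numbers index the basis through the bijection \<open>set_decode\<close> with
  finite sets, which lets \<open>f\<close> be given on sets.\<close>

definition grassmann_extension :: "(nat set \<Rightarrow> 'c::complex_vector) \<Rightarrow> (nat \<Rightarrow>\<^sub>0 complex) \<Rightarrow> 'c" where
  "grassmann_extension f = linear_extension (\<lambda>k. f (set_decode k))"

definition monom_mult :: "nat set \<Rightarrow> nat set \<Rightarrow> nat \<Rightarrow>\<^sub>0 complex" where
  "monom_mult A B = (if A \<inter> B = {} then (- 1) ^ inversions A B *\<^sub>C grassmann_monom (A \<union> B) else 0)"

definition grassmann_mult :: "(nat \<Rightarrow>\<^sub>0 complex) \<Rightarrow> (nat \<Rightarrow>\<^sub>0 complex) \<Rightarrow> nat \<Rightarrow>\<^sub>0 complex" where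
  "grassmann_mult w x = grassmann_extension (\<lambda>A. grassmann_extension (monom_mult A) x) w"

definition grassmann_part :: "nat \<Rightarrow> (nat \<Rightarrow>\<^sub>0 complex) set" where
  "grassmann_part s = {w. \<forall>k\<in>Poly_Mapping.keys w. even (card (set_decode k) + s)}"

definition grassmann_deriv :: "nat \<Rightarrow> (nat \<Rightarrow>\<^sub>0 complex) \<Rightarrow> nat \<Rightarrow>\<^sub>0 complex" where
  "grassmann_deriv i = grassmann_extension
     (\<lambda>A. if i \<in> A then place_sign i A *\<^sub>C grassmann_monom (A - {i}) else 0)"

definition grassmann_algebra :: "(nat \<Rightarrow>\<^sub>0 complex) diff_superalgebra" where
  "grassmann_algebra = \<lparr>even_part = grassmann_part 0, odd_part = grassmann_part 1,
     der = \<lambda>_. 0, oder = \<lambda>_ _. 0, aone = grassmann_monom {}, amult = grassmann_mult\<rparr>"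

lemma clinear_grassmann_extension: "clinear (grassmann_extension f)"
  unfolding grassmann_extension_def by (rule clinear_linear_extension)

lemma grassmann_extension_monom: "finite A \<Longrightarrow> grassmann_extension f (grassmann_monom A) = f A"
  by (simp add: grassmann_extension_def grassmann_monom_def linear_extension_single)

lemma grassmann_part_eqI:
  assumes "clinear f" "clinear g" "w \<in> grassmann_part s"
    and "\<And>A. finite A \<Longrightarrow> even (card A + s) \<Longrightarrow> f (grassmann_monom A) = g (grassmann_monom A)"
  shows "f w = g w"
proof (rule clinear_eq_on_singles[OF assms(1,2)])
  fix k
  assume "k \<in> Poly_Mapping.keys w"
  then have "even (card (set_decode k) + s)"
    using assms(3) by (simp add: grassmann_part_def)
  then have "f (Poly_Mapping.single k 1) = g (Poly_Mapping.single k 1)"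
    using assms(4)[of "set_decode k"] by (simp add: grassmann_monom_def)
  then show "f (Poly_Mapping.single k (Poly_Mapping.lookup w k)) = g (Poly_Mapping.single k (Poly_Mapping.lookup w k))"
    unfolding basis_eq_scale[of k "Poly_Mapping.lookup w k"]
    by (simp only: clinear_scale[OF assms(1)] clinear_scale[OF assms(2)])
qed

lemma grassmann_eqI:
  assumes "clinear f" "clinear g" "\<And>A. finite A \<Longrightarrow> f (grassmann_monom A) = g (grassmann_monom A)"
  shows "f w = g w"
proof (rule clinear_eq_on_singles[OF assms(1,2)])
  fix k
  have "f (Poly_Mapping.single k 1) = g (Poly_Mapping.single k 1)"
    using assms(3)[of "set_decode k"] by (simp add: grassmann_monom_def)
  then show "f (Poly_Mapping.single k (Poly_Mapping.lookup w k)) = g (Poly_Mapping.single k (Poly_Mapping.lookup w k))"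
    unfolding basis_eq_scale[of k "Poly_Mapping.lookup w k"]
    by (simp only: clinear_scale[OF assms(1)] clinear_scale[OF assms(2)])
qed

lemma grassmann_part_subspace: "cvec.subspace (grassmann_part s)"
  unfolding cvec.subspace_def grassmann_part_def
  using Poly_Mapping.keys_add by (fastforce simp: in_keys_iff lookup_scaleC)

lemma grassmann_monom_part: "finite A \<Longrightarrow> even (card A + s) \<Longrightarrow> grassmann_monom A \<in> grassmann_part s"
  by (simp add: grassmann_part_def grassmann_monom_def)

lemma grassmann_extension_in_subspace:
  assumes "cvec.subspace S" "w \<in> grassmann_part s" "\<And>A. finite A \<Longrightarrow> even (card A + s) \<Longrightarrow> f A \<in> S"
  shows "grassmann_extension f w \<in> S"
  unfolding grassmann_extension_def linear_extension_def
  by (intro cvec.subspace_sum cvec.subspace_scale assms) (use assms(2) in \<open>auto simp: grassmann_part_def\<close>)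

lemma bilinear_grassmann_mult: "bilinear grassmann_mult"
proof (rule bilinearI)
  show "clinear (\<lambda>w. grassmann_mult w x)" for x
    unfolding grassmann_mult_def by (rule clinear_grassmann_extension)
  show "clinear (grassmann_mult w)" for w
    unfolding grassmann_mult_def[abs_def] grassmann_extension_def[of "\<lambda>A. grassmann_extension (monom_mult A) x" for x]
      linear_extension_def[of "\<lambda>k. grassmann_extension (monom_mult (set_decode k)) x" for x]
    by (intro clinear_summed clinear_scaled clinear_grassmann_extension)
qed

lemma grassmann_mult_monom:
  "finite A \<Longrightarrow> finite B \<Longrightarrow> grassmann_mult (grassmann_monom A) (grassmann_monom B) = monom_mult A B"
  by (simp add: grassmann_mult_def grassmann_extension_monom)

lemma grassmann_mult_part:
  assumes w: "w \<in> grassmann_part s" and x: "x \<in> grassmann_part t"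
  shows "grassmann_mult w x \<in> grassmann_part (s + t)"
  unfolding grassmann_mult_def
proof (intro grassmann_extension_in_subspace[OF grassmann_part_subspace w]
    grassmann_extension_in_subspace[OF grassmann_part_subspace x])
  fix A B :: "nat set"
  assume "finite A" "finite B" "even (card A + s)" "even (card B + t)"
  then show "monom_mult A B \<in> grassmann_part (s + t)"
    by (auto simp: monom_mult_def card_Un_disjoint cvec.subspace_0[OF grassmann_part_subspace]
        intro!: cvec.subspace_scale[OF grassmann_part_subspace] grassmann_monom_part)
qed

lemmas grassmann_mult_linear_simps =
  clinear_scale[OF bilinear_left[OF bilinear_grassmann_mult]] clinear_scale[OF bilinear_right[OF bilinear_grassmann_mult]]
  clinear_zero[OF bilinear_left[OF bilinear_grassmann_mult]] clinear_zero[OF bilinear_right[OF bilinear_grassmann_mult]]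

lemma grassmann_mult_one: "grassmann_mult (grassmann_monom {}) w = w" "grassmann_mult w (grassmann_monom {}) = w"
proof -
  show "grassmann_mult (grassmann_monom {}) w = w"
    by (rule grassmann_eqI[where w = w, OF bilinear_right[OF bilinear_grassmann_mult] clinear_id])
      (simp add: grassmann_mult_monom monom_mult_def)
  show "grassmann_mult w (grassmann_monom {}) = w"
    by (rule grassmann_eqI[where w = w, OF bilinear_left[OF bilinear_grassmann_mult] clinear_id])
      (simp add: grassmann_mult_monom monom_mult_def)
qed

text \<open>For pairwise disjoint sets both exponents are the sum of the inversions of the three
  pairs, because inversions are additive in each argument; otherwise both products vanish.\<close>

lemma grassmann_mult_assoc: "grassmann_mult (grassmann_mult w x) y = grassmann_mult w (grassmann_mult x y)"
proof -
  let ?F = "\<lambda>w x y. grassmann_mult (grassmann_mult w x) y" and ?G = "\<lambda>w x y. grassmann_mult w (grassmann_mult x y)"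
  have F: "trilinear ?F" and G: "trilinear ?G"
    by (rule trilinear_comp_left[OF bilinear_grassmann_mult bilinear_grassmann_mult]
        trilinear_comp_right[OF bilinear_grassmann_mult bilinear_grassmann_mult])+
  have "?F (grassmann_monom A) (grassmann_monom B) (grassmann_monom C) =
      ?G (grassmann_monom A) (grassmann_monom B) (grassmann_monom C)"
    if "finite A" "finite B" "finite C" for A B C
  proof (cases "A \<inter> B = {} \<and> A \<inter> C = {} \<and> B \<inter> C = {}")
    case True
    then have "(A \<union> B) \<inter> C = {}" "A \<inter> (B \<union> C) = {}"
      by auto
    with True that show ?thesis
      by (simp add: grassmann_mult_monom monom_mult_def grassmann_mult_linear_simps inversions_Un_left
          inversions_Un_right power_add Un_assoc mult_ac)
  next
    case False
    then have "\<not> (A \<inter> B = {} \<and> (A \<union> B) \<inter> C = {})" "\<not> (B \<inter> C = {} \<and> A \<inter> (B \<union> C) = {})"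
      by auto
    with that show ?thesis
      by (auto simp: grassmann_mult_monom monom_mult_def grassmann_mult_linear_simps)
  qed
  then have "?F (grassmann_monom A) (grassmann_monom B) y = ?G (grassmann_monom A) (grassmann_monom B) y"
    if "finite A" "finite B" for A B
    by (rule grassmann_eqI[OF trilinear_3[OF F] trilinear_3[OF G]]) (use that in auto)
  then have "?F (grassmann_monom A) x y = ?G (grassmann_monom A) x y" if "finite A" for A
    by (rule grassmann_eqI[OF trilinear_2[OF F] trilinear_2[OF G]]) (use that in auto)
  then show ?thesis
    by (rule grassmann_eqI[OF trilinear_1[OF F] trilinear_1[OF G]])
qed

lemma grassmann_mult_comm:
  assumes w: "w \<in> grassmann_part s" and x: "x \<in> grassmann_part t"
  shows "grassmann_mult w x = (- 1) ^ (s * t) *\<^sub>C grassmann_mult x w"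
proof -
  note lin = bilinear_left[OF bilinear_grassmann_mult] bilinear_right[OF bilinear_grassmann_mult]
  have hom: "grassmann_mult (grassmann_monom A) (grassmann_monom B) =
      (- 1) ^ (s * t) *\<^sub>C grassmann_mult (grassmann_monom B) (grassmann_monom A)"
    if A: "finite A" "even (card A + s)" and B: "finite B" "even (card B + t)" for A B
  proof (cases "A \<inter> B = {}")
    case True
    then have "even (inversions A B + inversions B A) = even (s * t)"
      using A B by (simp only: inversions_swap) auto
    then have "even (inversions A B) = even (s * t + inversions B A)"
      by (simp; argo)
    then have "(- 1) ^ inversions A B *\<^sub>C grassmann_monom (A \<union> B) =
        (- 1) ^ (s * t) *\<^sub>C (- 1) ^ inversions B A *\<^sub>C grassmann_monom (B \<union> A)"
      unfolding scaleC_sign Un_commute[of B A] by (rule scaleC_sign_cong)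
    then show ?thesis
      using True A(1) B(1) by (simp only: grassmann_mult_monom monom_mult_def Int_commute[of B A] if_True refl)
  next
    case False
    then show ?thesis
      using A B by (simp add: grassmann_mult_monom monom_mult_def Int_commute)
  qed
  have "grassmann_mult (grassmann_monom A) x = (- 1) ^ (s * t) *\<^sub>C grassmann_mult x (grassmann_monom A)"
    if A: "finite A" "even (card A + s)" for A
    by (rule grassmann_part_eqI[OF lin(2) clinear_scaled[OF lin(1)] x]) (rule hom[OF A])
  then show ?thesis
    by (rule grassmann_part_eqI[OF lin(1) clinear_scaled[OF lin(2)] w])
qed

lemma clinear_grassmann_deriv: "clinear (grassmann_deriv i)"
  unfolding grassmann_deriv_def by (rule clinear_grassmann_extension)

lemma grassmann_deriv_monom:
  "finite A \<Longrightarrow> grassmann_deriv i (grassmann_monom A) =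
    (if i \<in> A then place_sign i A *\<^sub>C grassmann_monom (A - {i}) else 0)"
  by (simp add: grassmann_deriv_def grassmann_extension_monom)

lemma grassmann_deriv_part:
  assumes "w \<in> grassmann_part s"
  shows "grassmann_deriv i w \<in> grassmann_part (Suc s)"
  unfolding grassmann_deriv_def
proof (rule grassmann_extension_in_subspace[OF grassmann_part_subspace assms])
  fix A :: "nat set"
  assume A: "finite A" "even (card A + s)"
  have "grassmann_monom (A - {i}) \<in> grassmann_part (Suc s)" if "i \<in> A"
    using A card.remove[OF A(1) that] by (intro grassmann_monom_part) auto
  then show "(if i \<in> A then place_sign i A *\<^sub>C grassmann_monom (A - {i}) else 0) \<in> grassmann_part (Suc s)"
    by (simp add: cvec.subspace_0[OF grassmann_part_subspace] cvec.subspace_scale[OF grassmann_part_subspace])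
qed

lemmas grassmann_deriv_linear_simps = clinear_add[OF clinear_grassmann_deriv] clinear_diff[OF clinear_grassmann_deriv]
  clinear_scale[OF clinear_grassmann_deriv] clinear_zero[OF clinear_grassmann_deriv]

lemma grassmann_deriv_anticomm: "grassmann_deriv i (grassmann_deriv j w) + grassmann_deriv j (grassmann_deriv i w) = 0"
proof (rule grassmann_eqI[where w = w])
  show "clinear (\<lambda>w. grassmann_deriv i (grassmann_deriv j w) + grassmann_deriv j (grassmann_deriv i w))"
    by (rule clinear_plus; rule clinear_comp[OF clinear_grassmann_deriv clinear_grassmann_deriv])
  fix A :: "nat set"
  assume "finite A"
  then show "grassmann_deriv i (grassmann_deriv j (grassmann_monom A))
      + grassmann_deriv j (grassmann_deriv i (grassmann_monom A)) = 0"
    by (auto simp: grassmann_deriv_monom grassmann_deriv_linear_simps place_sign_remove set_diff_swap[of A "{i}"] mult.commute)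
qed (rule clinear_0)

lemma grassmann_generator_mult:
  "finite B \<Longrightarrow> grassmann_mult (grassmann_monom {j}) (grassmann_monom B) =
    (if j \<in> B then 0 else place_sign j B *\<^sub>C grassmann_monom (insert j B))"
  by (simp add: grassmann_mult_monom monom_mult_def inversions_singleton)

text \<open>The Clifford relation between \<partial>/\<partial>\<theta>^i and multiplication by
  \<theta>^j. The general Leibniz rule follows from it by building a monomial from
  generators.\<close>

lemma grassmann_deriv_generator_mult:
  "grassmann_deriv i (grassmann_mult (grassmann_monom {j}) x) =
    (if i = j then x else 0) - grassmann_mult (grassmann_monom {j}) (grassmann_deriv i x)"
proof (rule grassmann_eqI[where w = x])
  note lin = bilinear_right[OF bilinear_grassmann_mult]
  show "clinear (\<lambda>x. grassmann_deriv i (grassmann_mult (grassmann_monom {j}) x))"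
    by (rule clinear_comp[OF clinear_grassmann_deriv lin])
  show "clinear (\<lambda>x. (if i = j then x else 0) - grassmann_mult (grassmann_monom {j}) (grassmann_deriv i x))"
    by (intro clinear_minus clinear_if clinear_id clinear_0 clinear_comp[OF lin] clinear_grassmann_deriv)
  fix B :: "nat set"
  assume "finite B"
  then show "grassmann_deriv i (grassmann_mult (grassmann_monom {j}) (grassmann_monom B)) =
      (if i = j then grassmann_monom B else 0)
      - grassmann_mult (grassmann_monom {j}) (grassmann_deriv i (grassmann_monom B))"
    by (auto simp: grassmann_generator_mult grassmann_deriv_monom grassmann_deriv_linear_simps
        grassmann_mult_linear_simps place_sign_insert place_sign_remove insert_remove_swap insert_absorb mult.commute)
qed

lemma grassmann_deriv_mult:
  assumes "w \<in> grassmann_part s"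
  shows "grassmann_deriv i (grassmann_mult w x) =
    grassmann_mult (grassmann_deriv i w) x + (- 1) ^ s *\<^sub>C grassmann_mult w (grassmann_deriv i x)"
proof -
  note lin = bilinear_left[OF bilinear_grassmann_mult]
  note lin_simps = clinear_diff[OF lin] clinear_diff[OF bilinear_right[OF bilinear_grassmann_mult]]
    clinear_add[OF bilinear_right[OF bilinear_grassmann_mult]] grassmann_mult_linear_simps
  have monom: "grassmann_deriv i (grassmann_mult (grassmann_monom A) x) =
      grassmann_mult (grassmann_deriv i (grassmann_monom A)) x
      + (- 1) ^ card A *\<^sub>C grassmann_mult (grassmann_monom A) (grassmann_deriv i x)" if "finite A" for A
    using that
  \<comment> \<open>Adding a new smallest index puts its generator in front without a sign:
    \<open>place_sign b A\<close> is 1.\<close>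
  proof (induction A rule: finite_linorder_min_induct)
    case empty
    then show ?case
      by (simp add: grassmann_deriv_monom grassmann_mult_one lin_simps)
  next
    case (insert b A)
    then have b: "b \<notin> A"
      by auto
    have "{j \<in> A. j < b} = {}"
      using insert by auto
    then have "place_sign b A = 1"
      unfolding place_sign_def by (simp only: card.empty power_0)
    then have A: "grassmann_monom (insert b A) = grassmann_mult (grassmann_monom {b}) (grassmann_monom A)"
      using insert b by (simp add: grassmann_generator_mult)
    show ?case
      unfolding A grassmann_mult_assoc grassmann_deriv_generator_mult insert.IH
      using insert(1) b by (auto simp: lin_simps grassmann_mult_assoc)
  qed
  show ?thesis
  proof (rule grassmann_part_eqI[OF _ _ assms])
    show "clinear (\<lambda>w. grassmann_deriv i (grassmann_mult w x))"
      by (rule clinear_comp[OF clinear_grassmann_deriv lin])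
    show "clinear (\<lambda>w. grassmann_mult (grassmann_deriv i w) x + (- 1) ^ s *\<^sub>C grassmann_mult w (grassmann_deriv i x))"
      by (intro clinear_plus clinear_scaled clinear_comp[OF lin] clinear_grassmann_deriv lin)
    fix A :: "nat set"
    assume A: "finite A" "even (card A + s)"
    then have "(- 1 :: complex) ^ card A = (- 1) ^ s"
      by (intro minus_one_power_eqI) simp
    then show "grassmann_deriv i (grassmann_mult (grassmann_monom A) x) =
        grassmann_mult (grassmann_deriv i (grassmann_monom A)) x
        + (- 1) ^ s *\<^sub>C grassmann_mult (grassmann_monom A) (grassmann_deriv i x)"
      using monom[OF A(1)] by simp
  qed
qed

section \<open>The Grassmann algebra as a differential superalgebra with zero derivations\<close>

lemma part_grassmann: "part grassmann_algebra s = grassmann_part s"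
  by (simp add: part_def grassmann_algebra_def grassmann_part_def)

lemma grassmann_simps:
  "der grassmann_algebra w = 0" "oder grassmann_algebra i w = 0"
  "aone grassmann_algebra = grassmann_monom {}" "amult grassmann_algebra = grassmann_mult"
  by (simp_all add: grassmann_algebra_def)

lemma is_nabla_module_grassmann: "is_nabla_module n grassmann_algebra"
proof -
  have "even_part grassmann_algebra \<inter> odd_part grassmann_algebra = {0}"
    by (auto simp: grassmann_algebra_def grassmann_part_def)
  moreover have "\<exists>a\<in>even_part grassmann_algebra. \<exists>b\<in>odd_part grassmann_algebra. w = a + b" for w
  proof (intro bexI)
    let ?e = "grassmann_extension (\<lambda>A. if even (card A) then grassmann_monom A else 0)"
    let ?o = "grassmann_extension (\<lambda>A. if odd (card A) then grassmann_monom A else 0)"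
    show "w = ?e w + ?o w"
      by (rule grassmann_eqI[where w = w]; (intro clinear_plus clinear_id clinear_grassmann_extension)?)
        (simp add: grassmann_extension_monom)
    show "?e w \<in> even_part grassmann_algebra" "?o w \<in> odd_part grassmann_algebra"
      unfolding grassmann_extension_def linear_extension_def grassmann_algebra_def
      by (auto intro!: cvec.subspace_sum[OF grassmann_part_subspace] cvec.subspace_scale[OF grassmann_part_subspace]
          grassmann_monom_part cvec.subspace_0[OF grassmann_part_subspace])
  qed
  ultimately show ?thesis
    unfolding is_nabla_module_def part_grassmann
    by (simp add: grassmann_part_subspace grassmann_simps clinear_0 cvec.subspace_0[OF grassmann_part_subspace]
        grassmann_algebra_def)
qed

lemma commutative_grassmann: "commutative_diff_superalgebra n grassmann_algebra"
  unfolding commutative_diff_superalgebra_def unital_diff_superalgebra_def part_grassmann grassmann_simps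
proof (intro conjI allI ballI)
  show "grassmann_monom {} \<in> even_part grassmann_algebra"
    using grassmann_monom_part[of "{}" 0] by (simp add: grassmann_algebra_def)
qed (fact is_nabla_module_grassmann bilinear_right[OF bilinear_grassmann_mult]
      bilinear_left[OF bilinear_grassmann_mult] grassmann_mult_one grassmann_mult_assoc
    | (rule grassmann_mult_part grassmann_mult_comm, assumption+)
    | (simp add: grassmann_mult_linear_simps; fail))+

lemma scalar_extension_grassmann:
  assumes "susy_vertex_algebra n V"
  shows "scalar_extension n V grassmann_algebra (\<lambda>i. grassmann_monom {i}) grassmann_deriv"
proof (rule scalar_extension.intro)
  show "grassmann_monom {i} \<in> part grassmann_algebra 1" for i
    unfolding part_grassmann by (rule grassmann_monom_part) auto
  show "grassmann_deriv i (grassmann_monom {j}) = (if i = j then aone grassmann_algebra else 0)" for i j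
    by (simp add: grassmann_deriv_monom grassmann_simps place_sign_insert_self[of j "{}"] place_sign_def[of j "{}"])
qed (use assms in \<open>simp_all add: commutative_grassmann grassmann_simps clinear_grassmann_deriv part_grassmann
  grassmann_deriv_part grassmann_deriv_mult grassmann_deriv_anticomm\<close>)

section \<open>Adjoining the remaining odd derivations\<close>

primrec extend_brackets :: "nat \<Rightarrow> 'a::complex_vector susy_va \<Rightarrow> nat \<Rightarrow> 'a susy_va" where
  "extend_brackets n U 0 = U"
| "extend_brackets n U (Suc j) = extend_bracket (n + j) (extend_brackets n U j)"

lemma extend_brackets_simps [simp]:
  "part (extend_brackets n U j) = part U"
  "der (extend_brackets n U j) = der U"
  "oder (extend_brackets n U j) = oder U"
  "vac (extend_brackets n U j) = vac U"
  "nop (extend_brackets n U j) = nop U"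
  by (induction j) simp_all

text \<open>The steps change the bracket only. Hence putting the recovered bracket back, as
  \<open>susy_reduct\<close> does, returns the very record \<open>U\<close>.\<close>

lemma extend_brackets_lbr: "(extend_brackets n U j)\<lparr>lbr := f\<rparr> = U\<lparr>lbr := f\<rparr>"
  by (induction j arbitrary: f) (simp_all add: extend_bracket_def)

lemma unital_diff_superalgebra_cong:
  assumes "part U' = part U" "der U' = der U" "oder U' = oder U"
  shows "unital_diff_superalgebra m U' u f = unital_diff_superalgebra m U u f"
proof -
  have "even_part U' = even_part U" "odd_part U' = odd_part U"
    using fun_cong[OF assms(1), of 0] fun_cong[OF assms(1), of 1] by (simp_all add: part_def)
  then show ?thesis
    using assms by (simp add: unital_diff_superalgebra_def is_nabla_module_def)
qed

text \<open>The relations and Leibniz rules for the product hold at every level \<open>m\<close>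
  from the beginning; what the induction has to renew is the derivation property of the
  \<open>D^i\<close> not yet used, with respect to the current bracket. In the last clause the
  newest variable is differentiated first, which undoes the last step.\<close>

lemma extend_brackets_properties:
  fixes U :: "'a::complex_vector susy_va"
  assumes va: "susy_vertex_algebra n U"
    and ud: "\<And>m. unital_diff_superalgebra m U (vac U) (nop U)"
    and lin: "\<And>i. clinear (oder U i)"
    and deriv: "\<And>i. n < i \<Longrightarrow> odd_bracket_derivation n U i"
  shows "susy_vertex_algebra (n + j) (extend_brackets n U j) \<and>
    (\<forall>i>n + j. odd_bracket_derivation (n + j) (extend_brackets n U j) i) \<and>
    (\<forall>a b. chi_derivs n (n + j) (lbr (extend_brackets n U j) a b) = lbr U a b)"
proof (induction j)
  case 0
  then show ?case
    using va deriv by (simp add: chi_derivs_def)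
next
  case (Suc j)
  let ?U = "extend_brackets n U j"
  have nmU: "is_nabla_module m U" for m
    using ud by (simp add: unital_diff_superalgebra_def)
  interpret susy_step "n + j" ?U
  proof (rule susy_step.intro)
    show "unital_diff_superalgebra (Suc (n + j)) ?U (vac ?U) (nop ?U)"
      using ud by (subst unital_diff_superalgebra_cong[where U = U]) simp_all
  qed (use Suc lin in simp_all)
  have "odd_bracket_derivation (Suc (n + j)) (extend_bracket (n + j) ?U) i" if i: "Suc (n + j) < i" for i
  proof (rule odd_bracket_derivation_extend_bracket)
    show "odd_bracket_derivation (n + j) ?U i"
      using Suc i by simp
    show "oder ?U i a \<in> part ?U (Suc p)" if "a \<in> part ?U p" for p a
      using nmU[of i] that i by (simp add: is_nabla_module_def)
    have "oder U (Suc (n + j)) (oder U i a) + oder U i (oder U (Suc (n + j)) a) = 0" for a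
      using nmU[of i] i by (simp add: is_nabla_module_def)
    then show "oder ?U (Suc (n + j)) (oder ?U i a) = - oder ?U i (oder ?U (Suc (n + j)) a)" for a
      by (simp add: eq_neg_iff_add_eq_0)
  qed (rule i)
  then show ?case
    using susy_vertex_algebra_extend_bracket Suc
    by (simp add: chi_derivs_def chi_deriv_extended)
qed

text \<open>The functional \<phi>, with value 1 at the unit, supplies injectivity: the identity
  tensored with \<phi> is a left inverse of the embedding.\<close>

lemma (in scalar_extension) subalgebra_U:
  assumes \<phi>: "clinear \<phi>" "\<phi> (aone W) = (1 :: complex)"
  shows "susy_vertex_subalgebra_via n V U (\<lambda>a. a \<otimes>\<^sub>C aone W)"
proof -
  let ?f = "\<lambda>a :: 'v. a \<otimes>\<^sub>C aone W"
  \<comment> \<open>The formula on pure tensors asks for a homogeneous second argument, so the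
    identity is shown for such \<open>b\<close> and extended by linearity.\<close>
  have lbr: "lbr U (?f a) (?f b) = coeff_map 0 ?f (lbr V a b)" for a b
  proof (rule part_in_subspace[OF nmV, where S = "{b. lbr U (?f a) (?f b) = coeff_map 0 ?f (lbr V a b)}", simplified])
    show "cvec.subspace {b. lbr U (?f a) (?f b) = coeff_map 0 ?f (lbr V a b)}"
      by (rule clinear_eq_subspace[OF clinear_comp[OF bilinear_right[OF lbrU_bilinear] clinear_tens_left]
            clinear_comp[OF clinear_rho lbr_linear_right[OF lca]]])
  qed (simp add: lbrU_tens[OF aone_even] M_one)
  have nop: "nop U (?f a) (?f b) = ?f (nop V a b)" for a b
  proof (rule part_in_subspace[OF nmV, where S = "{b. nop U (?f a) (?f b) = ?f (nop V a b)}", simplified])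
    show "cvec.subspace {b. nop U (?f a) (?f b) = ?f (nop V a b)}"
      by (rule clinear_eq_subspace[OF clinear_comp[OF bilinear_right[OF nopU_bilinear] clinear_tens_left]
            clinear_comp[OF clinear_tens_left bilinear_right[OF nopV_bilinear]]])
  qed (simp add: nopU_tens[OF aone_even] M_one)
  have "inj ?f"
  proof (rule injI)
    fix a b
    assume eq: "?f a = ?f b"
    have "bilinear (\<lambda>(a :: 'v) w. \<phi> w *\<^sub>C a)"
      by (intro bilinearI clinearI)
        (simp_all add: clinear_add[OF \<phi>(1)] clinear_scale[OF \<phi>(1)] scaleC_add_left scaleC_add_right
          scaleC_complex_def mult.commute)
    then show "a = b"
      using arg_cong[OF eq, of "tensor_lift (\<lambda>(a :: 'v) w. \<phi> w *\<^sub>C a)"] by (simp add: tensor_lift_tens \<phi>(2))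
  qed
  moreover have "?f a \<in> part U k" if "a \<in> part V k" for a k
    by (rule tens_part[OF that aone_even]) simp
  ultimately have "lca_embedding n V U ?f"
    unfolding lca_embedding_def by (simp add: clinear_tens_left derU_tens oderU_tens_low lbr)
  moreover have "susy_vertex_subalgebra n U (range ?f)"
  proof -
    have "cvec.subspace (range ?f)"
      unfolding cvec.subspace_def
      by (auto simp: image_iff simp flip: tens_add_left tens_scale_left
          intro: exI[of _ 0] simp: clinear_zero[OF clinear_tens_left])
    then show ?thesis
      unfolding susy_vertex_subalgebra_def
      by (auto simp: vac_U derU_tens oderU_tens_low nop lbr lookup_rho)
  qed
  ultimately show ?thesis
    by (simp add: susy_vertex_subalgebra_via_def vac_U nop)
qed

lemma (in scalar_extension) underlying_tensor_product_U:
  assumes "part U' = part U" "der U' = der U" "oder U' = oder U" "vac U' = vac U" "nop U' = nop U"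
  shows "underlying_tensor_product n V W U'"
  unfolding underlying_tensor_product_def assms
  by (simp add: part_U tensor_part_def derU_tens der_W oderU_tens_low oder_W vac_U nopU_tens
      clinear_zero[OF clinear_tens_right])

theorem mainTheorem1:
  fixes n n' :: nat
    and R :: "'r::complex_vector susy_lca"
    and V :: "'v::complex_vector susy_va"
    and \<iota> :: "'r \<Rightarrow> 'v"
  assumes "n < n'"
    and "susy_lie_conformal_algebra n R"
    and "universal_enveloping n R V \<iota>"
  shows "\<exists>(W :: (nat \<Rightarrow>\<^sub>0 complex) diff_superalgebra)
            (U :: ('v, nat \<Rightarrow>\<^sub>0 complex) tensor susy_va).
           commutative_diff_superalgebra n W \<and>
           susy_vertex_algebra n' U \<and>
           underlying_tensor_product n V W U \<and>
           susy_vertex_subalgebra_via n V (susy_reduct n n' U) (\<lambda>a. a \<otimes>\<^sub>C aone W)"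
proof -
  have "susy_vertex_algebra n V"
    using assms(3) by (simp add: universal_enveloping_def)
  then interpret scalar_extension n V grassmann_algebra "\<lambda>i. grassmann_monom {i}" grassmann_deriv
    by (rule scalar_extension_grassmann)
  obtain j where n': "n' = n + j"
    using assms(1) less_imp_add_positive by blast
  let ?U = "extend_brackets n tensor_va j"
  have props: "susy_vertex_algebra (n + j) ?U"
    "chi_derivs n (n + j) (lbr ?U a b) = lbr tensor_va a b" for a b
    using extend_brackets_properties[OF susy_vertex_algebra_U unital_diff_superalgebra_U oderU_linear
        odd_bracket_derivation_U, of j] by auto
  have "susy_reduct n n' ?U = tensor_va"
    unfolding susy_reduct_def extend_brackets_lbr n' by (simp add: props(2))
  \<comment> \<open>The unit is the basis vector of the empty set, whose code is 0; the coefficient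
    at 0 is the functional that gives injectivity of the embedding.\<close>
  moreover have "Poly_Mapping.lookup (aone grassmann_algebra) 0 = 1"
    by (simp add: grassmann_simps grassmann_monom_def)
  then have "susy_vertex_subalgebra_via n V tensor_va (\<lambda>a. a \<otimes>\<^sub>C aone grassmann_algebra)"
    by (rule subalgebra_U[OF clinear_lookup])
  moreover have "underlying_tensor_product n V grassmann_algebra ?U"
    by (rule underlying_tensor_product_U) simp_all
  ultimately show ?thesis
    using props(1) commutative_grassmann n' by metis
qed

end
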